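(* (1) For every prime field $k$ there are valued rational function fields $k(t,x,y)$ of transcendence degree $3$ over the trivially valued subfield $k$ which do not admit any weak complements. There are ordered rational function fields of transcendence degree $3$ over $\mathbb{Q}$ which do not admit any integer parts. (2) There are valued rational function fields of transcendence degree $4$ over a trivially valued prime field which do not admit any weak complements, but admit an embedding of their residue field and a cross-section. There are ordered rational function fields of transcendence degree $4$ over $\mathbb{Q}$ which do not admit any integer parts, but admit an embedding of their residue field and a cross-section for their natural valuation.
   Context: Valuations are Krull valuations (arbitrary ordered abelian value groups), written additively with $v0=\infty$. A prime field is $\mathbb{Q}$ or $\mathbb{F}_p$ for a prime $p$. A rational function field over $k$ is a purely transcendental extension of $k$. A subring $R$ (not required to contain $1$) of a valued field $(K,v)$ is called a weak complement in $K$ if $vr\leq 0$ for all nonzero $r\in R$, and for all $a\in K$ there is $r\in R$ such that $v(a-r)\geq 0$. An integer part of an ordered field $K$ is a discretely ordered subring $I$ containing $1$ such that for all $a\in K$ there is $r\in I$ with $r\leq a<r+1$. A valuation $v$ of an ordered field $(K,<)$ is compatible with $<$ if $0<x\leq y$ implies $vx\geq vy$; then $<$ induces an ordering on $Kv$. The natural valuation of $(K,<)$ is the (unique) compatible valuation whose residue field, with the induced ordering, is archimedean ordered. An embedding of the residue field of $(K,v)$ is a field embedding of $Kv$ into the valuation ring of $K$ that is a section of the residue map. A cross-section is a group homomorphism $vK\to K^\times$ that is a section of $v$. *)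

theory Defs
  imports "HOL-Algebra.Generated_Fields" "HOL-Algebra.QuotRing" "HOL-Number_Theory.Residues"
begin

text \<open>Orderings are given as sets of pairs: \<open>(a, b) \<in> leq\<close> means that \<open>a \<le> b\<close>.\<close>

subsection \<open>Prime fields and rational function fields\<close>

definition rat_ring :: "rat ring" where
  "rat_ring = \<lparr>carrier = UNIV, monoid.mult = (*), one = 1, ring.zero = 0, add = (+)\<rparr>"

definition prime_field :: "('a, 'm) ring_scheme \<Rightarrow> bool" where
  "prime_field k \<longleftrightarrow>
     field k \<and> (k \<simeq> rat_ring \<or> (\<exists>p::nat. prime p \<and> k \<simeq> residue_ring (int p)))"

text \<open>A polynomial in \<open>n\<close> variables over \<open>F\<close> is given by a finite set \<open>S\<close> of exponent vectors
  and a family \<open>c\<close> of coefficients; extensionality makes different elements of \<open>S\<close> different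
  monomials.\<close>

definition algebraically_independent ::
    "('a, 'm) ring_scheme \<Rightarrow> 'a set \<Rightarrow> nat \<Rightarrow> (nat \<Rightarrow> 'a) \<Rightarrow> bool" where
  "algebraically_independent K F n x \<longleftrightarrow>
     (\<forall>S c. finite S \<and> S \<subseteq> ({..<n} \<rightarrow>\<^sub>E (UNIV :: nat set)) \<and> c \<in> S \<rightarrow> F \<and>
        finsum K (\<lambda>e. c e \<otimes>\<^bsub>K\<^esub> finprod K (\<lambda>i. x i [^]\<^bsub>K\<^esub> e i) {..<n}) S = \<zero>\<^bsub>K\<^esub>
        \<longrightarrow> (\<forall>e\<in>S. c e = \<zero>\<^bsub>K\<^esub>))"

definition rational_function_field :: "('a, 'm) ring_scheme \<Rightarrow> 'a set \<Rightarrow> nat \<Rightarrow> bool" where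
  "rational_function_field K F n \<longleftrightarrow>
     field K \<and> subfield F K \<and>
     (\<exists>x \<in> {..<n} \<rightarrow> carrier K. algebraically_independent K F n x \<and>
        generate_field K (F \<union> x ` {..<n}) = carrier K)"

subsection \<open>Krull valuations\<close>

text \<open>The operation of an ordered abelian group is written \<open>\<otimes>\<close>, as for all groups in the library,
  and its neutral element \<open>\<one>\<close>; these are the addition and the zero of a value group.\<close>

locale ordered_abelian_group =
  comm_group \<Gamma> for \<Gamma> :: "('g, 'n) monoid_scheme" (structure) and leq :: "('g \<times> 'g) set" +
  assumes linear_order: "linear_order_on (carrier \<Gamma>) leq"
    and translate: "(a, b) \<in> leq \<Longrightarrow> c \<in> carrier \<Gamma> \<Longrightarrow> (c \<otimes> a, c \<otimes> b) \<in> leq"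

datatype 'g extval = Fin 'g | Infty

fun extval_add :: "('g, 'n) monoid_scheme \<Rightarrow> 'g extval \<Rightarrow> 'g extval \<Rightarrow> 'g extval" where
  "extval_add \<Gamma> (Fin a) (Fin b) = Fin (a \<otimes>\<^bsub>\<Gamma>\<^esub> b)"
| "extval_add \<Gamma> _ _ = Infty"

fun extval_le :: "('g \<times> 'g) set \<Rightarrow> 'g extval \<Rightarrow> 'g extval \<Rightarrow> bool" where
  "extval_le leq (Fin a) (Fin b) \<longleftrightarrow> (a, b) \<in> leq"
| "extval_le leq _ Infty \<longleftrightarrow> True"
| "extval_le leq Infty (Fin b) \<longleftrightarrow> False"

text \<open>\<open>v\<close> need not be onto \<open>\<Gamma>\<close>; its value group is \<open>value_group K \<Gamma> v\<close> below. The last axiom says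
  \<open>v (a + b) \<ge> min (v a) (v b)\<close>.\<close>

locale valued_field =
  K: field K + \<Gamma>: ordered_abelian_group \<Gamma> leq
  for K :: "('a, 'm) ring_scheme" and \<Gamma> :: "('g, 'n) monoid_scheme"
    and leq :: "('g \<times> 'g) set" and v :: "'a \<Rightarrow> 'g extval" +
  assumes v_closed: "a \<in> carrier K \<Longrightarrow> v a \<in> insert Infty (Fin ` carrier \<Gamma>)"
    and v_eq_Infty_iff: "a \<in> carrier K \<Longrightarrow> v a = Infty \<longleftrightarrow> a = \<zero>\<^bsub>K\<^esub>"
    and v_mult: "a \<in> carrier K \<Longrightarrow> b \<in> carrier K \<Longrightarrow>
      v (a \<otimes>\<^bsub>K\<^esub> b) = extval_add \<Gamma> (v a) (v b)"
    and v_add: "a \<in> carrier K \<Longrightarrow> b \<in> carrier K \<Longrightarrow>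
      extval_le leq (v a) (v (a \<oplus>\<^bsub>K\<^esub> b)) \<or> extval_le leq (v b) (v (a \<oplus>\<^bsub>K\<^esub> b))"

definition trivially_valued ::
    "('a, 'm) ring_scheme \<Rightarrow> ('g, 'n) monoid_scheme \<Rightarrow> ('a \<Rightarrow> 'g extval) \<Rightarrow> 'a set \<Rightarrow> bool" where
  "trivially_valued K \<Gamma> v F \<longleftrightarrow> (\<forall>a \<in> F - {\<zero>\<^bsub>K\<^esub>}. v a = Fin \<one>\<^bsub>\<Gamma>\<^esub>)"

definition value_group ::
    "('a, 'm) ring_scheme \<Rightarrow> ('g, 'n) monoid_scheme \<Rightarrow> ('a \<Rightarrow> 'g extval) \<Rightarrow> ('g, 'n) monoid_scheme"
  where "value_group K \<Gamma> v = \<Gamma>\<lparr>carrier := {g \<in> carrier \<Gamma>. \<exists>a \<in> carrier K. v a = Fin g}\<rparr>"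

definition valuation_ring ::
    "('a, 'm) ring_scheme \<Rightarrow> ('g, 'n) monoid_scheme \<Rightarrow> ('g \<times> 'g) set \<Rightarrow> ('a \<Rightarrow> 'g extval)
      \<Rightarrow> ('a, 'm) ring_scheme" where
  "valuation_ring K \<Gamma> leq v =
     K\<lparr>carrier := {a \<in> carrier K. extval_le leq (Fin \<one>\<^bsub>\<Gamma>\<^esub>) (v a)}\<rparr>"

definition valuation_ideal ::
    "('a, 'm) ring_scheme \<Rightarrow> ('g, 'n) monoid_scheme \<Rightarrow> ('g \<times> 'g) set \<Rightarrow> ('a \<Rightarrow> 'g extval) \<Rightarrow> 'a set"
  where "valuation_ideal K \<Gamma> leq v =
     {a \<in> carrier K. extval_le leq (Fin \<one>\<^bsub>\<Gamma>\<^esub>) (v a) \<and> v a \<noteq> Fin \<one>\<^bsub>\<Gamma>\<^esub>}"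

definition residue_field ::
    "('a, 'm) ring_scheme \<Rightarrow> ('g, 'n) monoid_scheme \<Rightarrow> ('g \<times> 'g) set \<Rightarrow> ('a \<Rightarrow> 'g extval)
      \<Rightarrow> 'a set ring" where
  "residue_field K \<Gamma> leq v = valuation_ring K \<Gamma> leq v Quot valuation_ideal K \<Gamma> leq v"

definition residue_map ::
    "('a, 'm) ring_scheme \<Rightarrow> ('g, 'n) monoid_scheme \<Rightarrow> ('g \<times> 'g) set \<Rightarrow> ('a \<Rightarrow> 'g extval)
      \<Rightarrow> 'a \<Rightarrow> 'a set" where
  "residue_map K \<Gamma> leq v a = valuation_ideal K \<Gamma> leq v +>\<^bsub>valuation_ring K \<Gamma> leq v\<^esub> a"

definition residue_field_embedding ::
    "('a, 'm) ring_scheme \<Rightarrow> ('g, 'n) monoid_scheme \<Rightarrow> ('g \<times> 'g) set \<Rightarrow> ('a \<Rightarrow> 'g extval)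
      \<Rightarrow> ('a set \<Rightarrow> 'a) \<Rightarrow> bool" where
  "residue_field_embedding K \<Gamma> leq v f \<longleftrightarrow>
     f \<in> ring_hom (residue_field K \<Gamma> leq v) (valuation_ring K \<Gamma> leq v) \<and>
     (\<forall>A \<in> carrier (residue_field K \<Gamma> leq v). residue_map K \<Gamma> leq v (f A) = A)"

definition cross_section ::
    "('a, 'm) ring_scheme \<Rightarrow> ('g, 'n) monoid_scheme \<Rightarrow> ('a \<Rightarrow> 'g extval) \<Rightarrow> ('g \<Rightarrow> 'a) \<Rightarrow> bool"
  where "cross_section K \<Gamma> v s \<longleftrightarrow>
     s \<in> hom (value_group K \<Gamma> v) (units_of K) \<and>
     (\<forall>g \<in> carrier (value_group K \<Gamma> v). v (s g) = Fin g)"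

text \<open>The library's \<open>subring\<close> is unital, hence not used here.\<close>

definition weak_complement ::
    "('a, 'm) ring_scheme \<Rightarrow> ('g, 'n) monoid_scheme \<Rightarrow> ('g \<times> 'g) set \<Rightarrow> ('a \<Rightarrow> 'g extval)
      \<Rightarrow> 'a set \<Rightarrow> bool" where
  "weak_complement K \<Gamma> leq v R \<longleftrightarrow>
     additive_subgroup R K \<and> (\<forall>r\<in>R. \<forall>s\<in>R. r \<otimes>\<^bsub>K\<^esub> s \<in> R) \<and>
     (\<forall>r \<in> R - {\<zero>\<^bsub>K\<^esub>}. extval_le leq (v r) (Fin \<one>\<^bsub>\<Gamma>\<^esub>)) \<and>
     (\<forall>a \<in> carrier K. \<exists>r\<in>R. extval_le leq (Fin \<one>\<^bsub>\<Gamma>\<^esub>) (v (a \<ominus>\<^bsub>K\<^esub> r)))"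

subsection \<open>Ordered fields\<close>

locale ordered_field =
  field K for K :: "('a, 'm) ring_scheme" (structure) and leq :: "('a \<times> 'a) set" +
  assumes linear_order: "linear_order_on (carrier K) leq"
    and add_mono: "(a, b) \<in> leq \<Longrightarrow> c \<in> carrier K \<Longrightarrow> (c \<oplus> a, c \<oplus> b) \<in> leq"
    and mult_nonneg: "(\<zero>, a) \<in> leq \<Longrightarrow> (\<zero>, b) \<in> leq \<Longrightarrow> (\<zero>, a \<otimes> b) \<in> leq"

definition archimedean_ordered_field :: "('a, 'm) ring_scheme \<Rightarrow> ('a \<times> 'a) set \<Rightarrow> bool" where
  "archimedean_ordered_field K leq \<longleftrightarrow>
     ordered_field K leq \<and> (\<forall>a \<in> carrier K. \<exists>n::nat. (a, [n] \<cdot>\<^bsub>K\<^esub> \<one>\<^bsub>K\<^esub>) \<in> leq)"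

definition discretely_ordered ::
    "('a, 'm) ring_scheme \<Rightarrow> ('a \<times> 'a) set \<Rightarrow> 'a set \<Rightarrow> bool" where
  "discretely_ordered K leq I \<longleftrightarrow>
     (\<exists>e \<in> I - {\<zero>\<^bsub>K\<^esub>}. (\<zero>\<^bsub>K\<^esub>, e) \<in> leq \<and>
        (\<forall>r \<in> I - {\<zero>\<^bsub>K\<^esub>}. (\<zero>\<^bsub>K\<^esub>, r) \<in> leq \<longrightarrow> (e, r) \<in> leq))"

definition integer_part :: "('a, 'm) ring_scheme \<Rightarrow> ('a \<times> 'a) set \<Rightarrow> 'a set \<Rightarrow> bool" where
  "integer_part K leq I \<longleftrightarrow>
     subring I K \<and> discretely_ordered K leq I \<and>
     (\<forall>a \<in> carrier K. \<exists>r\<in>I. (r, a) \<in> leq \<and>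
        (a, r \<oplus>\<^bsub>K\<^esub> \<one>\<^bsub>K\<^esub>) \<in> leq \<and> a \<noteq> r \<oplus>\<^bsub>K\<^esub> \<one>\<^bsub>K\<^esub>)"

text \<open>In the next three definitions \<open>leK\<close> orders the field and \<open>leq\<close> the value group.\<close>

definition compatible_valuation ::
    "('a, 'm) ring_scheme \<Rightarrow> ('a \<times> 'a) set \<Rightarrow> ('g, 'n) monoid_scheme \<Rightarrow> ('g \<times> 'g) set
      \<Rightarrow> ('a \<Rightarrow> 'g extval) \<Rightarrow> bool" where
  "compatible_valuation K leK \<Gamma> leq v \<longleftrightarrow>
     valued_field K \<Gamma> leq v \<and>
     (\<forall>x y. (\<zero>\<^bsub>K\<^esub>, x) \<in> leK \<and> x \<noteq> \<zero>\<^bsub>K\<^esub> \<and> (x, y) \<in> leK \<longrightarrow> extval_le leq (v y) (v x))"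

definition residue_order ::
    "('a, 'm) ring_scheme \<Rightarrow> ('a \<times> 'a) set \<Rightarrow> ('g, 'n) monoid_scheme \<Rightarrow> ('g \<times> 'g) set
      \<Rightarrow> ('a \<Rightarrow> 'g extval) \<Rightarrow> ('a set \<times> 'a set) set" where
  "residue_order K leK \<Gamma> leq v =
     {(residue_map K \<Gamma> leq v a, residue_map K \<Gamma> leq v b) | a b.
        a \<in> carrier (valuation_ring K \<Gamma> leq v) \<and> b \<in> carrier (valuation_ring K \<Gamma> leq v) \<and>
        (a, b) \<in> leK}"

definition natural_valuation ::
    "('a, 'm) ring_scheme \<Rightarrow> ('a \<times> 'a) set \<Rightarrow> ('g, 'n) monoid_scheme \<Rightarrow> ('g \<times> 'g) set
      \<Rightarrow> ('a \<Rightarrow> 'g extval) \<Rightarrow> bool" where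
  "natural_valuation K leK \<Gamma> leq v \<longleftrightarrow>
     compatible_valuation K leK \<Gamma> leq v \<and>
     archimedean_ordered_field (residue_field K \<Gamma> leq v) (residue_order K leK \<Gamma> leq v)"

text \<open>A field of finite transcendence degree over a prime field is countable, and so is the value
  group of each of its valuations. Hence, up to isomorphism, all such infinite fields and all their
  value groups have their carriers in \<open>nat\<close>, and existence of a valued field of this kind may be
  stated with \<open>nat\<close> as the type of the elements of the field and of its value group.\<close>

end

theory Submission
  imports Defs "HOL-Library.Poly_Mapping" "HOL-Library.Function_Algebras" "HOL-Library.FSet"
begin

text \<open>Let \<open>k\<close> be the prime field. In \<open>K = k(x, z\<^sub>0, z\<^sub>1)\<close> define \<open>z\<^sub>n\<^sub>+\<^sub>2 = (z\<^sub>n\<^sub>+\<^sub>1 + z\<^sub>n\<^sub>+\<^sub>1\<^sup>2 - z\<^sub>n) / x\<close>; then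
  \<open>K = k(x, z\<^sub>n, z\<^sub>n\<^sub>+\<^sub>1)\<close> for every \<open>n\<close>. There is a discrete valuation of \<open>K\<close> with uniformizer \<open>x\<close>, the
  coarse valuation, for which all \<open>z\<^sub>n\<close> are integral. Their residues satisfy
  \<open>c\<^sub>n = c\<^sub>n\<^sub>+\<^sub>1 + c\<^sub>n\<^sub>+\<^sub>1\<^sup>2\<close>, so the residue field \<open>k(c\<^sub>0, c\<^sub>1, ...)\<close> is algebraic over \<open>k(c\<^sub>0)\<close>, of infinite
  degree: \<open>c\<^sub>n\<close> has degree \<open>2 ^ n\<close>. The critical point is that the coarse value of a nonzero element is
  finite. It holds because an infinitely \<open>x\<close>-divisible polynomial would, by a count of monomials,
  force a relation for \<open>c\<^sub>n\<close> of degree below \<open>2 ^ n\<close> when \<open>n\<close> is large (\<open>inf_div_imp_null\<close>).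

  Compose the coarse valuation with a valuation of the residue field. In a weak complement \<open>R\<close> of the
  result consider the ring \<open>R0\<close> of the elements that are integral for the coarse valuation. No nonzero
  element of \<open>R\<close> has positive value, so \<open>R0\<close> is embedded in the coarse residue field. The transcendence
  degree of \<open>R0\<close> is therefore at most that of the residue field (\<open>algebraic_dependence\<close>); but contrary
  to the residue field, \<open>R0\<close> lies in the finitely generated field \<open>K\<close>, where the algebraic closure of a
  subfield in a finitely generated field has finite degree (\<open>bounded_degree\<close>). On the other hand \<open>R\<close>
  has to approximate the \<open>z\<^sub>n\<close>, and this gives elements of \<open>R0\<close> of degree at least \<open>2 ^ n\<close>. For the degrees
  to be visible in the values, approximations are compared by the valuation at infinity of the
  residue field, for which \<open>c\<^sub>n\<close> has value \<open>- 2 / 2 ^ n\<close>.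

  In transcendence degree three the residue field carries the valuation at infinity itself; as
  \<open>z\<^sub>n\<close> is not integral, \<open>R\<close> contains an element of the same value (\<open>no_pair_complement_at_infinity\<close>).
  Its value group is not finitely generated. In transcendence degree four there is a further variable \<open>s\<close>,
  and the residue field \<open>k(c\<^sub>0, c\<^sub>1, ...)(s)\<close> carries first the \<open>s\<close>-adic valuation and then that of the
  rational place where all \<open>c\<^sub>n\<close> have value \<open>1\<close>. Now the value group is free of rank three and the
  residue field is \<open>k\<close>, so cross-sections and embeddings of the residue field exist; and \<open>R\<close> has to
  approximate \<open>z\<^sub>n / s\<close> (\<open>no_pair_complement_at_rational_place\<close>).

  All these valuations have residue field \<open>k\<close>, realized by a leading coefficient. In characteristic
  zero its sign orders \<open>K\<close>; the valuation is the natural one of this ordering, and integer parts are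
  weak complements (\<open>integer_part_weak_complement\<close>).

  Elements of \<open>K\<close> are handled as polynomials over the integers modulo \<open>q\<close>, the characteristic of \<open>k\<close>,
  together with an endomorphism \<open>T\<close> of the polynomial ring that expresses level \<open>n\<close> of the tower
  through level \<open>n + 1\<close>.\<close>

section \<open>Integer polynomials in finitely many variables\<close>

abbreviation "lookup \<equiv> Poly_Mapping.lookup"
abbreviation "keys \<equiv> Poly_Mapping.keys"
abbreviation "single \<equiv> Poly_Mapping.single"

type_synonym 'i mpoly = "('i \<Rightarrow> nat) \<Rightarrow>\<^sub>0 int"

text \<open>Countability is what allows fraction fields and value groups to be carried by \<^typ>\<open>nat\<close>.\<close>

instance poly_mapping :: (countable, "{countable, zero}") countable
proof
  let ?g = "\<lambda>f :: 'a \<Rightarrow>\<^sub>0 'b. Abs_fset ((\<lambda>k. (k, lookup f k)) ` keys f)"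
  have "inj ?g"
  proof (rule injI)
    fix f g :: "'a \<Rightarrow>\<^sub>0 'b" assume "?g f = ?g g"
    hence "fset (?g f) = fset (?g g)" by simp
    hence eq: "(\<lambda>k. (k, lookup f k)) ` keys f = (\<lambda>k. (k, lookup g k)) ` keys g"
      by (simp add: Abs_fset_inverse)
    show "f = g"
    proof (rule poly_mapping_eqI)
      fix k
      have "(k, y) \<in> (\<lambda>k. (k, lookup f k)) ` keys f \<longleftrightarrow> y \<noteq> 0 \<and> lookup f k = y"
        "(k, y) \<in> (\<lambda>k. (k, lookup g k)) ` keys g \<longleftrightarrow> y \<noteq> 0 \<and> lookup g k = y" for y
        by (auto simp: in_keys_iff)
      thus "lookup f k = lookup g k" using eq by metis
    qed
  qed
  hence "inj (to_nat \<circ> ?g)" by (intro inj_compose) auto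
  thus "\<exists>h :: ('a \<Rightarrow>\<^sub>0 'b) \<Rightarrow> nat. inj h" by blast
qed

lemma sum_single_keys: "(\<Sum>k\<in>keys f. single k (lookup f k)) = f"
proof (rule poly_mapping_eqI)
  fix k
  have "(\<Sum>l\<in>keys f. lookup (single l (lookup f l)) k) = (\<Sum>l\<in>keys f. if l = k then lookup f l else 0)"
    by (rule sum.cong) (auto simp: lookup_single when_def)
  thus "lookup (\<Sum>k\<in>keys f. single k (lookup f k)) k = lookup f k"
    by (auto simp: lookup_sum in_keys_iff)
qed

lemma mult_eq_sum_single:
  fixes f g :: "'a::comm_monoid_add \<Rightarrow>\<^sub>0 'b::comm_semiring_1"
  shows "f * g = (\<Sum>a\<in>keys f. \<Sum>b\<in>keys g. single (a + b) (lookup f a * lookup g b))"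
proof -
  have "f * g = (\<Sum>a\<in>keys f. single a (lookup f a)) * (\<Sum>b\<in>keys g. single b (lookup g b))"
    by (simp only: sum_single_keys)
  thus ?thesis by (simp add: sum_product mult_single)
qed

lemma single_0_int: "single 0 n = (of_int n :: 'a::monoid_add \<Rightarrow>\<^sub>0 int)"
  by (metis id_apply of_int_eq_id single_of_int)

lemma of_int_times_single [simp]: "of_int n * single k m = single k (n * m :: int)"
  by (simp flip: single_of_int add: mult_single)

lemma lookup_of_int_mult [simp]: "lookup (of_int n * f) k = n * lookup f k"
  for f :: "'a::comm_monoid_add \<Rightarrow>\<^sub>0 int"
proof -
  have "of_int n * f = (\<Sum>l\<in>keys f. single l (n * lookup f l))"
    by (subst sum_single_keys[of f, symmetric]) (simp add: sum_distrib_left)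
  also have "lookup \<dots> k = (\<Sum>l\<in>keys f. n * lookup (single l (lookup f l)) k)"
    unfolding lookup_sum by (intro sum.cong) (auto simp: lookup_single when_def)
  also have "\<dots> = n * lookup (\<Sum>l\<in>keys f. single l (lookup f l)) k"
    by (simp add: sum_distrib_left lookup_sum)
  finally show ?thesis by (simp only: sum_single_keys)
qed

definition unit_exp :: "'i \<Rightarrow> 'i \<Rightarrow> nat" where
  "unit_exp i = (\<lambda>j. if j = i then 1 else 0)"

definition mvar :: "'i \<Rightarrow> 'i mpoly" where
  "mvar i = single (unit_exp i) 1"

lemma power_mvar: "mvar i ^ n = single (\<lambda>j. if j = i then n else 0) 1"
proof (induction n)
  case 0
  have "(\<lambda>j. if j = i then 0 else 0) = (0 :: 'a \<Rightarrow> nat)" by auto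
  thus ?case by simp
next
  case (Suc n)
  have "unit_exp i + (\<lambda>j. if j = i then n else 0) = (\<lambda>j. if j = i then Suc n else 0)"
    by (auto simp: unit_exp_def)
  thus ?case unfolding power_Suc Suc.IH by (simp add: mvar_def mult_single)
qed

lemma prod_mvar:
  assumes "finite A"
  shows "(\<Prod>i\<in>A. mvar i ^ k i) = single (\<lambda>i. if i \<in> A then k i else 0) 1"
  using assms
proof (induction A)
  case empty
  have "(\<lambda>i. 0) = (0 :: 'a \<Rightarrow> nat)" by auto
  thus ?case by simp
next
  case (insert a A)
  have "(\<lambda>j. if j = a then k a else 0) + (\<lambda>i. if i \<in> A then k i else 0) =
    (\<lambda>i. if i \<in> insert a A then k i else 0)" using insert by auto
  thus ?case using insert by (simp add: power_mvar mult_single)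
qed

lemma single_eq_prod: "single k n = of_int n * (\<Prod>i\<in>UNIV. mvar i ^ k i)"
  for k :: "'i::finite \<Rightarrow> nat"
  by (simp add: prod_mvar)

definition subst :: "('i::finite \<Rightarrow> 'i mpoly) \<Rightarrow> 'i mpoly \<Rightarrow> 'i mpoly" where
  "subst a f = (\<Sum>k\<in>keys f. of_int (lookup f k) * (\<Prod>i\<in>UNIV. a i ^ k i))"

lemma subst_superset:
  assumes "finite A" "keys f \<subseteq> A"
  shows "subst a f = (\<Sum>k\<in>A. of_int (lookup f k) * (\<Prod>i\<in>UNIV. a i ^ k i))"
  unfolding subst_def using assms
  by (intro sum.mono_neutral_left) (auto simp: in_keys_iff)

lemma subst_add: "subst a (f + g) = subst a f + subst a g"
proof -
  let ?A = "keys f \<union> keys g"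
  have "keys (f + g) \<subseteq> ?A" by (rule keys_add)
  thus ?thesis
    by (simp add: subst_superset[of ?A] lookup_add algebra_simps sum.distrib)
qed

lemma subst_0 [simp]: "subst a 0 = 0" by (simp add: subst_def)

lemma subst_sum: "subst a (\<Sum>i\<in>I. f i) = (\<Sum>i\<in>I. subst a (f i))"
  by (induction I rule: infinite_finite_induct) (auto simp: subst_add)

lemma subst_single: "subst a (single k n) = of_int n * (\<Prod>i\<in>UNIV. a i ^ k i)"
  by (cases "n = 0") (auto simp: subst_def)

lemma subst_mult: "subst a (f * g) = subst a f * subst a g"
proof -
  have "subst a (f * g) = (\<Sum>k\<in>keys f. \<Sum>l\<in>keys g.
      of_int (lookup f k * lookup g l) * (\<Prod>i\<in>UNIV. a i ^ (k + l) i))"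
    by (simp add: mult_eq_sum_single[of f g] subst_sum subst_single del: of_int_mult)
  also have "\<dots> = subst a f * subst a g"
    unfolding subst_def sum_product
    by (intro sum.cong refl) (simp add: power_add prod.distrib algebra_simps)
  finally show ?thesis .
qed

lemma subst_of_int [simp]: "subst a (of_int n) = of_int n"
  using subst_single[of a 0 n] by (simp add: single_0_int)

lemma subst_1 [simp]: "subst a 1 = 1" using subst_of_int[of a 1] by simp

lemma subst_power [simp]: "subst a (f ^ n) = subst a f ^ n"
  by (induction n) (auto simp: subst_mult)

lemma subst_prod: "subst a (\<Prod>i\<in>I. f i) = (\<Prod>i\<in>I. subst a (f i))"
  by (induction I rule: infinite_finite_induct) (auto simp: subst_mult)

lemma subst_uminus: "subst a (- f) = - subst a f"
  using subst_add[of a f "- f"] by (simp add: eq_neg_iff_add_eq_0 add.commute)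

lemma subst_diff: "subst a (f - g) = subst a f - subst a g"
  using subst_add[of a f "- g"] by (simp add: subst_uminus)

lemma subst_mvar [simp]: "subst a (mvar i) = a i"
proof -
  have "(\<Prod>j\<in>UNIV. a j ^ unit_exp i j) = (\<Prod>j\<in>UNIV. if j = i then a j else 1)"
    by (intro prod.cong) (auto simp: unit_exp_def)
  thus ?thesis by (simp add: mvar_def subst_single)
qed

lemmas subst_simps = subst_add subst_mult subst_diff subst_uminus subst_sum subst_prod

text \<open>For statements that are compatible with the ring operations, such as identities between
  substitution homomorphisms.\<close>

lemma mpoly_induct [case_names const var add mult]:
  fixes f :: "'i::finite mpoly"
  assumes "\<And>n. Q (of_int n)" "\<And>i. Q (mvar i)"
    and add: "\<And>f g. Q f \<Longrightarrow> Q g \<Longrightarrow> Q (f + g)" and mult: "\<And>f g. Q f \<Longrightarrow> Q g \<Longrightarrow> Q (f * g)"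
  shows "Q f"
proof -
  have one: "Q 1" using assms(1)[of 1] by simp
  have zero: "Q 0" using assms(1)[of 0] by simp
  have pow: "Q (g ^ n)" if "Q g" for g n by (induction n) (auto intro: one mult that)
  have prod: "Q (prod g I)" if "\<And>i. i \<in> I \<Longrightarrow> Q (g i)" for g and I :: "'i set"
    using that by (induction I rule: infinite_finite_induct) (auto intro: one mult)
  have sum: "Q (sum g I)" if "\<And>i. i \<in> I \<Longrightarrow> Q (g i)" for g and I :: "('i \<Rightarrow> nat) set"
    using that by (induction I rule: infinite_finite_induct) (auto intro: zero add)
  have "Q (single k n)" for k n
    unfolding single_eq_prod by (intro mult assms(1) prod pow assms(2))
  hence "Q (\<Sum>k\<in>keys f. single k (lookup f k))" by (intro sum)
  thus ?thesis by (simp only: sum_single_keys)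
qed

definition deg_le :: "nat \<Rightarrow> 'i mpoly set" where
  "deg_le Y = {f. \<forall>k\<in>keys f. \<forall>i. k i \<le> Y}"

lemma deg_le_mono: "Y \<le> Z \<Longrightarrow> f \<in> deg_le Y \<Longrightarrow> f \<in> deg_le Z"
  unfolding deg_le_def using le_trans by blast

lemma deg_le_exists: "\<exists>Y. f \<in> deg_le Y" for f :: "'i::finite mpoly"
proof -
  let ?A = "(\<lambda>(k, i). k i) ` (keys f \<times> UNIV)"
  have "k i \<le> Max ?A" if "k \<in> keys f" for k i
    using that by (intro Max_ge) force+
  hence "f \<in> deg_le (Max ?A)" unfolding deg_le_def by blast
  thus ?thesis by blast
qed

lemma deg_le_add: "f \<in> deg_le Y \<Longrightarrow> g \<in> deg_le Y \<Longrightarrow> f + g \<in> deg_le Y"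
  unfolding deg_le_def using keys_add[of f g] by blast

lemma deg_le_0 [simp]: "0 \<in> deg_le Y" by (simp add: deg_le_def)

lemma deg_le_sum: "(\<And>i. i \<in> I \<Longrightarrow> f i \<in> deg_le Y) \<Longrightarrow> sum f I \<in> deg_le Y"
  by (induction I rule: infinite_finite_induct) (auto intro: deg_le_add)

lemma deg_le_mult:
  assumes "f \<in> deg_le Y" "g \<in> deg_le Z" shows "f * g \<in> deg_le (Y + Z)"
  unfolding deg_le_def
proof (intro CollectI ballI allI)
  fix k i assume "k \<in> keys (f * g)"
  then obtain a b where "a \<in> keys f" "b \<in> keys g" "k = a + b" using keys_mult[of f g] by blast
  thus "k i \<le> Y + Z" using assms by (auto simp: deg_le_def intro: add_mono)
qed

lemma deg_le_of_int [simp]: "of_int n \<in> deg_le Y"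
  by (simp flip: single_of_int add: deg_le_def)

lemma deg_le_1 [simp]: "1 \<in> deg_le Y" using deg_le_of_int[of 1] by simp

lemma deg_le_power: "f \<in> deg_le Y \<Longrightarrow> f ^ n \<in> deg_le (n * Y)"
  by (induction n) (auto intro: deg_le_mult)

lemma deg_le_prod: "(\<And>i. i \<in> I \<Longrightarrow> f i \<in> deg_le (Y i)) \<Longrightarrow> prod f I \<in> deg_le (sum Y I)"
  by (induction I rule: infinite_finite_induct) (auto intro: deg_le_mult)

lemma deg_le_mvar: "mvar i \<in> deg_le 1"
  by (simp add: mvar_def deg_le_def unit_exp_def)

section \<open>Reduction modulo \<open>q\<close>\<close>

text \<open>For \<open>q = 0\<close> this is the zero ideal. So the quotient by it is a polynomial ring over the integers
  or over a finite prime field, and both characteristics are treated with integer representatives.\<close>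

definition null :: "int \<Rightarrow> 'i mpoly set" where
  "null q = {f. \<forall>k. q dvd lookup f k}"

text \<open>The support of the reduction.\<close>

definition qkeys :: "int \<Rightarrow> 'i mpoly \<Rightarrow> ('i \<Rightarrow> nat) set" where
  "qkeys q f = {k. \<not> q dvd lookup f k}"

lemma null_iff_qkeys: "f \<in> null q \<longleftrightarrow> qkeys q f = {}"
  by (auto simp: null_def qkeys_def)

lemma qkeys_subset: "qkeys q f \<subseteq> keys f"
  by (auto simp: qkeys_def in_keys_iff)

lemma finite_qkeys [simp]: "finite (qkeys q f)"
  using qkeys_subset finite_subset by (metis finite_keys)

lemma null_0 [simp]: "0 \<in> null q" by (simp add: null_def)

lemma null_add: "f \<in> null q \<Longrightarrow> g \<in> null q \<Longrightarrow> f + g \<in> null q"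
  by (simp add: null_def lookup_add)

lemma null_uminus [simp]: "- f \<in> null q \<longleftrightarrow> f \<in> null q"
  by (simp add: null_def)

lemma null_diff: "f \<in> null q \<Longrightarrow> g \<in> null q \<Longrightarrow> f - g \<in> null q"
  by (simp add: null_def lookup_minus)

lemma null_diff_commute: "f - g \<in> null q \<longleftrightarrow> g - f \<in> null q"
  using null_uminus[of "f - g" q] by simp

lemma null_sum: "(\<And>i. i \<in> I \<Longrightarrow> f i \<in> null q) \<Longrightarrow> sum f I \<in> null q"
  by (induction I rule: infinite_finite_induct) (auto intro: null_add)

lemma lookup_mult_sum:
  fixes f g :: "'i mpoly"
  shows "lookup (f * g) k = (\<Sum>a\<in>keys f. \<Sum>b\<in>keys g. if a + b = k then lookup f a * lookup g b else 0)"
  by (simp add: mult_eq_sum_single[of f g] lookup_sum lookup_single when_def)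

lemma null_mult: "f \<in> null q \<Longrightarrow> f * g \<in> null q"
  unfolding null_def mem_Collect_eq lookup_mult_sum
  by (intro allI dvd_sum) auto

lemma null_mult': "f \<in> null q \<Longrightarrow> g * f \<in> null q"
  using null_mult[of f q g] by (simp add: mult.commute)

lemma lookup_of_int: "lookup (of_int n :: 'i mpoly) k = (if k = 0 then n else 0)"
  by (simp add: lookup_single when_def flip: single_0_int)

lemma null_of_int [simp]: "of_int n \<in> null q \<longleftrightarrow> q dvd n"
  by (auto simp: null_def lookup_of_int)

lemma null_subst:
  assumes "f \<in> null q" shows "subst a f \<in> null q"
proof -
  have "q dvd lookup f k" for k using assms by (simp add: null_def)
  thus ?thesis unfolding subst_def by (intro null_sum null_mult) simp
qed

lemma null_cong_mult: "a - b \<in> null q \<Longrightarrow> c - d \<in> null q \<Longrightarrow> a * c - b * d \<in> null q"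
proof -
  assume *: "a - b \<in> null q" "c - d \<in> null q"
  have "a * c - b * d = (a - b) * c + b * (c - d)" by (simp add: algebra_simps)
  thus ?thesis using * by (metis null_add null_mult null_mult')
qed

lemma null_cong: "a - b \<in> null q \<Longrightarrow> a \<in> null q \<longleftrightarrow> b \<in> null q"
  by (metis diff_add_cancel null_add null_diff_commute)

lemma null_cong_add: "a - b \<in> null q \<Longrightarrow> c - d \<in> null q \<Longrightarrow> (a + c) - (b + d) \<in> null q"
  using null_add[of "a - b" q "c - d"] by (simp add: algebra_simps)

lemma null_trans: "a - b \<in> null q \<Longrightarrow> b - c \<in> null q \<Longrightarrow> a - c \<in> null q"
  using null_add[of "a - b" q "b - c"] by simp

definition char_zero_or_prime :: "int \<Rightarrow> bool" where
  "char_zero_or_prime q \<longleftrightarrow> q = 0 \<or> prime q"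

lemma char_dvd_mult: "char_zero_or_prime q \<Longrightarrow> q dvd a * b \<longleftrightarrow> q dvd a \<or> q dvd b"
  by (auto simp: char_zero_or_prime_def prime_dvd_mult_iff)

lemma char_not_dvd_1: "char_zero_or_prime q \<Longrightarrow> \<not> q dvd 1"
  by (auto simp: char_zero_or_prime_def)

section \<open>Valuations with leading coefficients\<close>

text \<open>A valuation on a domain, given on representatives modulo a prime ideal \<open>N\<close>, whose residue
  field is the prime field: every element has a leading coefficient, an integer modulo \<open>q\<close>, and
  the cancellation in a sum is governed by the leading coefficients.\<close>

locale leading_valuation =
  fixes q :: int and N :: "'a::comm_ring_1 set"
    and val :: "'a \<Rightarrow> 'g::linordered_ab_group_add" and lc :: "'a \<Rightarrow> int"
  assumes char: "char_zero_or_prime q"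
    and N_0: "0 \<in> N" and N_add: "a \<in> N \<Longrightarrow> b \<in> N \<Longrightarrow> a + b \<in> N"
    and N_mult: "a \<in> N \<Longrightarrow> a * b \<in> N"
    and lc_nonzero: "a \<notin> N \<Longrightarrow> \<not> q dvd lc a"
    and mult_notin: "a \<notin> N \<Longrightarrow> b \<notin> N \<Longrightarrow> a * b \<notin> N"
    and val_mult: "a \<notin> N \<Longrightarrow> b \<notin> N \<Longrightarrow> val (a * b) = val a + val b"
    and lc_mult: "a \<notin> N \<Longrightarrow> b \<notin> N \<Longrightarrow> [lc (a * b) = lc a * lc b] (mod q)"
    and add_less: "a \<notin> N \<Longrightarrow> b \<in> N \<or> val a < val b \<Longrightarrow>
      a + b \<notin> N \<and> val (a + b) = val a \<and> [lc (a + b) = lc a] (mod q)"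
    and add_eq: "a \<notin> N \<Longrightarrow> b \<notin> N \<Longrightarrow> val a = val b \<Longrightarrow> \<not> q dvd lc a + lc b \<Longrightarrow>
      a + b \<notin> N \<and> val (a + b) = val a \<and> [lc (a + b) = lc a + lc b] (mod q)"
    and add_cancel: "a \<notin> N \<Longrightarrow> b \<notin> N \<Longrightarrow> val a = val b \<Longrightarrow> q dvd lc a + lc b \<Longrightarrow>
      a + b \<in> N \<or> val (a + b) > val a"
    and val_of_int: "\<not> q dvd n \<Longrightarrow> of_int n \<notin> N \<and> val (of_int n) = 0 \<and> [lc (of_int n) = n] (mod q)"
    and of_int_in_N: "q dvd n \<Longrightarrow> of_int n \<in> N"
begin

lemma one_notin [simp]: "1 \<notin> N" and val_1 [simp]: "val 1 = 0" and lc_1: "[lc 1 = 1] (mod q)"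
  using val_of_int[of 1] char_not_dvd_1[OF char] by auto

lemma N_mult': "a \<in> N \<Longrightarrow> b * a \<in> N" using N_mult[of a b] by (simp add: mult.commute)

lemma mult_in_iff: "a * b \<in> N \<longleftrightarrow> a \<in> N \<or> b \<in> N"
  using N_mult N_mult' mult_notin by blast

lemma power_notin: "a \<notin> N \<Longrightarrow> a ^ n \<notin> N"
  by (induction n) (auto simp: mult_in_iff)

lemma prod_notin: "(\<And>i. i \<in> I \<Longrightarrow> a i \<notin> N) \<Longrightarrow> prod a I \<notin> N"
  by (induction I rule: infinite_finite_induct) (auto simp: mult_in_iff)

lemma N_sum: "(\<And>i. i \<in> I \<Longrightarrow> a i \<in> N) \<Longrightarrow> sum a I \<in> N"
  by (induction I rule: infinite_finite_induct) (auto intro: N_add N_0)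

lemma N_uminus: "a \<in> N \<Longrightarrow> - a \<in> N" using N_mult[of a "-1"] by simp

lemma N_uminus_iff [simp]: "- a \<in> N \<longleftrightarrow> a \<in> N" using N_uminus[of a] N_uminus[of "- a"] by auto

lemma N_diff: "a \<in> N \<Longrightarrow> b \<in> N \<Longrightarrow> a - b \<in> N" using N_add[of a "- b"] by simp

lemma N_diff_commute: "a - b \<in> N \<longleftrightarrow> b - a \<in> N"
  using N_uminus_iff[of "a - b"] by simp

lemma val_uminus: "a \<notin> N \<Longrightarrow> val (- a) = val a"
proof -
  assume "a \<notin> N"
  moreover have "\<not> q dvd -1" using char_not_dvd_1[OF char] by simp
  hence "(-1 :: 'a) \<notin> N \<and> val (-1) = 0" using val_of_int[of "-1"] by simp
  ultimately show ?thesis using val_mult[of "-1" a] by simp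
qed

lemma lc_uminus: "a \<notin> N \<Longrightarrow> [lc (- a) = - lc a] (mod q)"
proof -
  assume a: "a \<notin> N"
  have "\<not> q dvd -1" using char_not_dvd_1[OF char] by simp
  hence *: "(-1 :: 'a) \<notin> N" "[lc (-1) = -1] (mod q)" using val_of_int[of "-1"] by auto
  have "[lc (-1 * a) = lc (-1) * lc a] (mod q)" using lc_mult[OF *(1) a] .
  also have "[lc (-1) * lc a = -1 * lc a] (mod q)" by (rule cong_mult[OF *(2) cong_refl])
  finally show ?thesis by simp
qed

lemma val_cong: "a \<notin> N \<Longrightarrow> a - b \<in> N \<Longrightarrow> b \<notin> N \<and> val b = val a \<and> [lc b = lc a] (mod q)"
  using add_less[of a "b - a"] N_diff_commute[of a b] by simp

lemma val_add_ge:
  assumes "a \<notin> N" "b \<notin> N" "a + b \<notin> N"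
  shows "val (a + b) \<ge> val a \<or> val (a + b) \<ge> val b"
proof -
  consider "val a < val b" | "val b < val a" | "val a = val b" by fastforce
  thus ?thesis
  proof cases
    case 1 thus ?thesis using add_less[of a b] assms by auto
  next
    case 2 thus ?thesis using add_less[of b a] assms by (auto simp: add.commute)
  next
    case 3 thus ?thesis using add_eq[of a b] add_cancel[of a b] assms
      by (cases "q dvd lc a + lc b") auto
  qed
qed

lemma val_prod:
  assumes "finite I" "\<And>i. i \<in> I \<Longrightarrow> a i \<notin> N"
  shows "val (prod a I) = (\<Sum>i\<in>I. val (a i))"
  using assms
  by (induction I rule: finite_induct) (auto simp: val_mult prod_notin)

lemma val_power_Suc: "a \<notin> N \<Longrightarrow> val (a ^ Suc n) = val a + val (a ^ n)"
  by (simp add: val_mult power_notin)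

text \<open>Terms with different values cannot cancel.\<close>

lemma sum_distinct_values:
  assumes "finite E" "E \<noteq> {}" "\<And>e. e \<in> E \<Longrightarrow> f e \<notin> N" "inj_on (\<lambda>e. val (f e)) E"
  shows "\<exists>e\<in>E. (\<forall>e'\<in>E. val (f e) \<le> val (f e')) \<and> sum f E \<notin> N \<and> val (sum f E) = val (f e) \<and>
    [lc (sum f E) = lc (f e)] (mod q)"
  using assms
proof (induction E rule: finite_ne_induct)
  case (singleton x)
  thus ?case by auto
next
  case (insert x E)
  then obtain e where e: "e \<in> E" "\<forall>e'\<in>E. val (f e) \<le> val (f e')" "sum f E \<notin> N"
    "val (sum f E) = val (f e)" "[lc (sum f E) = lc (f e)] (mod q)"
    by (auto simp: inj_on_def)
  have "val (f x) \<noteq> val (f e)" using insert.prems(2) insert.hyps e(1) by (auto simp: inj_on_def)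
  then consider "val (f x) < val (f e)" | "val (f e) < val (f x)" by fastforce
  thus ?case
  proof cases
    case 1
    have "f x + sum f E \<notin> N \<and> val (f x + sum f E) = val (f x) \<and> [lc (f x + sum f E) = lc (f x)] (mod q)"
      using add_less[of "f x" "sum f E"] 1 e insert.prems by auto
    moreover have "\<forall>e'\<in>E. val (f x) \<le> val (f e')" using 1 e(2) by fastforce
    ultimately show ?thesis using insert.hyps by (intro bexI[of _ x]) auto
  next
    case 2
    have "sum f E + f x \<notin> N \<and> val (sum f E + f x) = val (sum f E) \<and>
       [lc (sum f E + f x) = lc (sum f E)] (mod q)"
      using add_less[of "sum f E" "f x"] 2 e by auto
    thus ?thesis using insert.hyps 2 e
      by (intro bexI[of _ e]) (auto simp: add.commute intro: cong_trans)
  qed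
qed

text \<open>The form used for linear independence: terms whose coefficients vanish modulo \<open>q\<close> do not count.\<close>

lemma combination_distinct_values:
  assumes "finite E" "\<And>e. e \<in> E \<Longrightarrow> f e \<notin> N" "inj_on (\<lambda>e. val (f e)) E"
    and "e0 \<in> E" "\<not> q dvd c e0"
  shows "\<exists>e\<in>E. \<not> q dvd c e \<and> (\<forall>e'\<in>E. \<not> q dvd c e' \<longrightarrow> val (f e) \<le> val (f e')) \<and>
    (\<Sum>e\<in>E. of_int (c e) * f e) \<notin> N \<and> val (\<Sum>e\<in>E. of_int (c e) * f e) = val (f e) \<and>
    [lc (\<Sum>e\<in>E. of_int (c e) * f e) = c e * lc (f e)] (mod q)"
proof -
  let ?D = "{e \<in> E. \<not> q dvd c e}" and ?g = "\<lambda>e. of_int (c e) * f e"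
  have *: "?g e \<notin> N \<and> val (?g e) = val (f e) \<and> [lc (?g e) = c e * lc (f e)] (mod q)" if "e \<in> ?D" for e
  proof -
    have 1: "of_int (c e) \<notin> N" "val (of_int (c e)) = 0" "[lc (of_int (c e)) = c e] (mod q)"
      using val_of_int[of "c e"] that by auto
    have 2: "f e \<notin> N" using that assms(2) by simp
    from lc_mult[OF 1(1) 2] cong_scalar_right[OF 1(3)]
    have "[lc (?g e) = c e * lc (f e)] (mod q)" by (blast intro: cong_trans)
    thus ?thesis using 1 2 by (simp add: val_mult mult_in_iff)
  qed
  have "inj_on (\<lambda>e. val (?g e)) ?D" using assms(3) * by (auto simp: inj_on_def)
  from sum_distinct_values[of ?D ?g, OF _ _ _ this] * assms(1,4,5)
  obtain e where e: "e \<in> ?D" "\<forall>e'\<in>?D. val (?g e) \<le> val (?g e')" "sum ?g ?D \<notin> N"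
    "val (sum ?g ?D) = val (?g e)" "[lc (sum ?g ?D) = lc (?g e)] (mod q)"
    by auto
  have "sum ?g E = sum ?g ?D + sum ?g (E - ?D)"
    using assms(1) by (metis (no_types, lifting) add.commute mem_Collect_eq subsetI sum.subset_diff)
  moreover have "sum ?g (E - ?D) \<in> N" by (intro N_sum N_mult of_int_in_N) auto
  ultimately have "sum ?g E \<notin> N \<and> val (sum ?g E) = val (sum ?g ?D) \<and> [lc (sum ?g E) = lc (sum ?g ?D)] (mod q)"
    using add_less[of "sum ?g ?D" "sum ?g (E - ?D)"] e(3) by auto
  thus ?thesis using e * by (intro bexI[of _ e]) (auto intro: cong_trans)
qed

end

section \<open>Monomial valuations and elimination\<close>

text \<open>Distinct monomials have distinct weights, so a polynomial modulo \<open>q\<close> has a unique monomial of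
  least weight. This monomial plays the role of the leading one.\<close>

locale monomial_valuation =
  fixes q :: int and wt :: "('i \<Rightarrow> nat) \<Rightarrow> 'g::linordered_ab_group_add"
  assumes char: "char_zero_or_prime q"
    and wt_add: "wt (k + l) = wt k + wt l" and wt_inj: "wt k = wt l \<Longrightarrow> k = l"
begin

definition lm :: "'i mpoly \<Rightarrow> 'i \<Rightarrow> nat" where
  "lm f = (SOME k. k \<in> qkeys q f \<and> (\<forall>l\<in>qkeys q f. wt k \<le> wt l))"

definition val :: "'i mpoly \<Rightarrow> 'g" where "val f = wt (lm f)"

definition lc :: "'i mpoly \<Rightarrow> int" where "lc f = lookup f (lm f)"

lemma lm:
  assumes "f \<notin> null q" shows "lm f \<in> qkeys q f" "\<And>l. l \<in> qkeys q f \<Longrightarrow> wt (lm f) \<le> wt l"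
proof -
  have "\<exists>k. k \<in> qkeys q f \<and> (\<forall>l\<in>qkeys q f. wt k \<le> wt l)"
    using ex_min_if_finite[of "wt ` qkeys q f"] assms unfolding null_iff_qkeys
    by (auto simp: not_less)
  hence "lm f \<in> qkeys q f \<and> (\<forall>l\<in>qkeys q f. wt (lm f) \<le> wt l)"
    unfolding lm_def by (rule someI_ex)
  thus "lm f \<in> qkeys q f" "\<And>l. l \<in> qkeys q f \<Longrightarrow> wt (lm f) \<le> wt l" by auto
qed

lemma lmI:
  assumes "\<not> q dvd lookup f k" "\<And>l. wt l < wt k \<Longrightarrow> q dvd lookup f l"
  shows "f \<notin> null q \<and> lm f = k"
proof -
  have k: "k \<in> qkeys q f" using assms by (simp add: qkeys_def)
  hence f: "f \<notin> null q" by (auto simp: null_iff_qkeys)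
  have "wt (lm f) \<le> wt k" using lm(2)[OF f k] .
  moreover have "\<not> wt (lm f) < wt k" using assms(2) lm(1)[OF f] by (auto simp: qkeys_def)
  ultimately show ?thesis using wt_inj f by fastforce
qed

lemma dvd_below: "f \<notin> null q \<Longrightarrow> wt k < wt (lm f) \<Longrightarrow> q dvd lookup f k"
  using lm(2)[of f k] by (force simp: qkeys_def not_le[symmetric])

lemma lc_nonzero: "f \<notin> null q \<Longrightarrow> \<not> q dvd lc f"
  using lm(1) by (auto simp: qkeys_def lc_def)

text \<open>Any other factorization of the product of the leading monomials has a factor of smaller weight,
  whose coefficient vanishes modulo \<open>q\<close>.\<close>

lemma lookup_mult_leading:
  assumes "f \<notin> null q" "g \<notin> null q"
  shows "wt k < wt (lm f) + wt (lm g) \<Longrightarrow> q dvd lookup (f * g) k"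
    and "[lookup (f * g) (lm f + lm g) = lc f * lc g] (mod q)"
proof -
  have term_dvd: "q dvd lookup f a * lookup g b"
    if "wt (a + b) \<le> wt (lm f) + wt (lm g)" "(a, b) \<noteq> (lm f, lm g)" for a b
  proof (cases "wt a < wt (lm f) \<or> wt b < wt (lm g)")
    case True thus ?thesis using dvd_below assms by auto
  next
    case False
    hence "wt a = wt (lm f)" "wt b = wt (lm g)" using that(1) unfolding wt_add
      by (smt (verit) add_le_cancel_left add_le_cancel_right add_left_mono add_right_mono dual_order.trans
        linorder_not_less order_antisym)+
    thus ?thesis using that(2) wt_inj by blast
  qed
  show "q dvd lookup (f * g) k" if "wt k < wt (lm f) + wt (lm g)" for k
    unfolding lookup_mult_sum using that by (intro dvd_sum) (auto intro!: term_dvd simp: wt_add)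
  let ?t = "\<lambda>a b. if a + b = lm f + lm g then lookup f a * lookup g b else 0"
  have kf: "lm f \<in> keys f" "lm g \<in> keys g" using lm(1) assms qkeys_subset by blast+
  have "lookup (f * g) (lm f + lm g) = (\<Sum>(a,b)\<in>keys f \<times> keys g. ?t a b)"
    unfolding lookup_mult_sum by (simp add: sum.cartesian_product)
  also have "\<dots> = lc f * lc g + (\<Sum>(a,b)\<in>keys f \<times> keys g - {(lm f, lm g)}. ?t a b)"
    using kf by (subst sum.remove[of _ "(lm f, lm g)"]) (auto simp: lc_def)
  also have "[\<dots> = lc f * lc g + 0] (mod q)"
  proof (intro cong_add cong_refl iffD2[OF cong_0_iff] dvd_sum)
    fix p assume p: "p \<in> keys f \<times> keys g - {(lm f, lm g)}"
    obtain a b where [simp]: "p = (a, b)" by (cases p)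
    have "q dvd lookup f a * lookup g b" if "a + b = lm f + lm g"
      using p that by (intro term_dvd) (auto simp: wt_add[symmetric])
    thus "q dvd (case p of (a, b) \<Rightarrow> ?t a b)" by simp
  qed
  finally show "[lookup (f * g) (lm f + lm g) = lc f * lc g] (mod q)" by simp
qed

lemma mult:
  assumes "f \<notin> null q" "g \<notin> null q"
  shows "f * g \<notin> null q" "lm (f * g) = lm f + lm g" "[lc (f * g) = lc f * lc g] (mod q)"
proof -
  have "\<not> q dvd lc f * lc g" using lc_nonzero assms char_dvd_mult[OF char] by blast
  hence "\<not> q dvd lookup (f * g) (lm f + lm g)"
    using lookup_mult_leading(2)[OF assms] cong_dvd_iff by blast
  from lmI[OF this] lookup_mult_leading(1)[OF assms]
  show 1: "f * g \<notin> null q" "lm (f * g) = lm f + lm g" by (auto simp: wt_add)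
  show "[lc (f * g) = lc f * lc g] (mod q)"
    using lookup_mult_leading(2)[OF assms] by (simp add: lc_def[of "f * g"] 1)
qed

sublocale leading_valuation q "null q" val lc
proof
  show "a * b \<notin> null q" if "a \<notin> null q" "b \<notin> null q" for a b :: "'i mpoly"using mult[OF that] by simp
  show "val (a * b) = val a + val b" if "a \<notin> null q" "b \<notin> null q" for a b :: "'i mpoly"
    using mult[OF that] by (simp add: val_def wt_add)
  show "[lc (a * b) = lc a * lc b] (mod q)" if "a \<notin> null q" "b \<notin> null q" for a b :: "'i mpoly"
    using mult[OF that] by simp
next
  fix a b assume a: "a \<notin> null q" and b: "b \<in> null q \<or> val a < val b"
  have b': "q dvd lookup b k" if "wt k \<le> wt (lm a)" for k
    using b that dvd_below[of b k] unfolding val_def null_def by fastforce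
  have c: "[lookup (a + b) k = lookup a k] (mod q)" if "wt k \<le> wt (lm a)" for k
    using b'[OF that] by (simp add: lookup_add cong_iff_dvd_diff)
  have "\<not> q dvd lookup (a + b) (lm a)" using c[of "lm a"] lc_nonzero[OF a] cong_dvd_iff
    unfolding lc_def by blast
  moreover have "q dvd lookup (a + b) l" if "wt l < wt (lm a)" for l
    using c[of l] dvd_below[OF a that] that cong_dvd_iff by (metis less_imp_le)
  ultimately have "a + b \<notin> null q \<and> lm (a + b) = lm a" by (rule lmI)
  thus "a + b \<notin> null q \<and> val (a + b) = val a \<and> [lc (a + b) = lc a] (mod q)"
    using c[of "lm a"] by (simp add: val_def lc_def)
next
  fix a b assume ab: "a \<notin> null q" "b \<notin> null q" "val a = val b"
  hence [simp]: "lm b = lm a" using wt_inj unfolding val_def by metis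
  have below: "q dvd lookup (a + b) l" if "wt l < wt (lm a)" for l
    using dvd_below[OF ab(1), of l] dvd_below[OF ab(2), of l] that by (simp add: lookup_add)
  {
    assume "\<not> q dvd lc a + lc b"
    hence "\<not> q dvd lookup (a + b) (lm a)" by (simp add: lc_def lookup_add)
    from lmI[OF this below] have "a + b \<notin> null q \<and> lm (a + b) = lm a" .
    thus "a + b \<notin> null q \<and> val (a + b) = val a \<and> [lc (a + b) = lc a + lc b] (mod q)"
      by (simp add: val_def lc_def lookup_add)
  next
    assume "q dvd lc a + lc b"
    hence "q dvd lookup (a + b) l" if "wt l \<le> wt (lm a)" for l
      using below[of l] that wt_inj[of l "lm a"] by (auto simp: lc_def lookup_add le_less)
    hence "wt (lm a) < wt l" if "l \<in> qkeys q (a + b)" for l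
      using that by (auto simp: qkeys_def not_le[symmetric])
    thus "a + b \<in> null q \<or> val a < val (a + b)" using lm(1) unfolding val_def by blast
  }
next
  fix n assume n: "\<not> q dvd n"
  have "(of_int n :: 'i mpoly) \<notin> null q \<and> lm (of_int n) = 0"
  proof (rule lmI)
    fix l assume "wt l < wt 0"
    thus "q dvd lookup (of_int n) l" by (auto simp: lookup_of_int)
  qed (use n in \<open>simp add: lookup_of_int\<close>)
  moreover have "wt 0 = 0" using wt_add[of 0 0] by simp
  ultimately show "(of_int n :: 'i mpoly) \<notin> null q \<and> val (of_int n) = 0 \<and> [lc (of_int n) = n] (mod q)"
    using n by (auto simp: val_def lc_def lookup_of_int)
qed (auto simp: char null_add null_mult lc_nonzero)

lemma mono:
  assumes "\<not> q dvd n"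
  shows "single k n \<notin> null q" "lm (single k n) = k" "val (single k n) = wt k" "lc (single k n) = n"
proof -
  have *: "lookup (single k n) l = (if l = k then n else 0)" for l by (auto simp: lookup_single when_def)
  have "single k n \<notin> null q \<and> lm (single k n) = k" using assms by (intro lmI) (auto simp: *)
  thus "single k n \<notin> null q" "lm (single k n) = k" "val (single k n) = wt k" "lc (single k n) = n"
    by (auto simp: val_def lc_def)
qed

lemma mvar_notin [simp]: "mvar i \<notin> null q" and val_mvar: "val (mvar i) = wt (unit_exp i)"
  and lc_mvar: "lc (mvar i) = 1"
  using mono[OF char_not_dvd_1[OF char], of "unit_exp i"] by (auto simp: mvar_def)

text \<open>Gaussian elimination, one monomial at a time. The least possible leading monomial \<open>t\<close> is
  removed with a pivot \<open>f e0\<close>; the elimination is fraction free, because the coefficients are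
  integers and only their reduction modulo \<open>q\<close> matters.\<close>

lemma more_elements_than_leading_monomials:
  fixes f :: "'e \<Rightarrow> 'i mpoly"
  assumes "finite E" "finite T" "card T < card E"
    and "\<And>c :: 'e \<Rightarrow> int. (\<Sum>e\<in>E. of_int (c e) * f e) \<in> null q \<or> lm (\<Sum>e\<in>E. of_int (c e) * f e) \<in> T"
  shows "\<exists>c :: 'e \<Rightarrow> int. (\<exists>e\<in>E. \<not> q dvd c e) \<and> (\<Sum>e\<in>E. of_int (c e) * f e) \<in> null q"
  using assms
proof (induction "card T" arbitrary: T E f)
  case 0
  hence "T = {}" by simp
  moreover from 0 have "E \<noteq> {}" by auto
  ultimately show ?case using 0(5)[of "\<lambda>_. 1"] char_not_dvd_1[OF char]
    by (intro exI[of _ "\<lambda>_. 1"]) auto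
next
  case (Suc n)
  have "T \<noteq> {}" using Suc.hyps(2) by auto
  then obtain t where t: "t \<in> T" "\<And>t'. t' \<in> T \<Longrightarrow> wt t \<le> wt t'"
    using ex_min_if_finite[of "wt ` T"] Suc.prems(2)
    by (auto simp: not_less)
  have cT: "card (T - {t}) = n" using Suc.hyps(2) t(1) Suc.prems(2) by simp
  define k where "k e = lookup (f e) t" for e
  define comb where "comb c = (\<Sum>e\<in>E. of_int (c e) * f e)" for c :: "'e \<Rightarrow> int"
  have lookup_comb: "lookup (comb c) t = (\<Sum>e\<in>E. c e * k e)" for c
    by (simp add: comb_def lookup_sum k_def)
  have lm_comb: "comb c \<in> null q \<or> lm (comb c) \<in> T - {t}" if "q dvd lookup (comb c) t" for c
    using Suc.prems(4)[of c] lm(1)[of "comb c"] that unfolding comb_def[symmetric]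
    by (auto simp: qkeys_def)
  show ?case
  proof (cases "\<forall>e\<in>E. q dvd k e")
    case True
    hence "q dvd lookup (comb c) t" for c unfolding lookup_comb by (intro dvd_sum) auto
    with lm_comb have "comb c \<in> null q \<or> lm (comb c) \<in> T - {t}" for c by blast
    thus ?thesis using cT Suc.hyps Suc.prems
      by (intro Suc.hyps(1)[of "T - {t}"]) (auto simp: comb_def)
  next
    case False
    then obtain e0 where e0: "e0 \<in> E" "\<not> q dvd k e0" by blast
    define g where "g e = of_int (k e0) * f e - of_int (k e) * f e0" for e
    \<comment> \<open>\<open>C c\<close> rewrites a combination of the reduced elements \<open>g\<close> in terms of the original \<open>f\<close>.\<close>
    define C where "C c e = (if e = e0 then - (\<Sum>e\<in>E - {e0}. c e * k e) else c e * k e0)"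
      for c :: "'e \<Rightarrow> int" and e
    have comb: "(\<Sum>e\<in>E - {e0}. of_int (c e) * g e) = comb (C c)" for c
    proof -
      have "(\<Sum>e\<in>E - {e0}. of_int (c e) * g e) = (\<Sum>e\<in>E - {e0}. of_int (c e * k e0) * f e)
         - (\<Sum>e\<in>E - {e0}. of_int (c e * k e)) * f e0"
        by (simp add: g_def right_diff_distrib sum_subtractf sum_distrib_right mult.assoc)
      also have "\<dots> = of_int (C c e0) * f e0 + (\<Sum>e\<in>E - {e0}. of_int (C c e) * f e)"
        by (simp add: C_def)
      also have "\<dots> = comb (C c)"
        unfolding comb_def using e0(1) Suc.prems(1) by (simp add: sum.remove[of E e0])
      finally show ?thesis .
    qed
    have "lookup (comb (C c)) t = 0" for c
    proof -
      have "lookup (comb (C c)) t = C c e0 * k e0 + (\<Sum>e\<in>E - {e0}. C c e * k e)"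
        unfolding lookup_comb using e0(1) Suc.prems(1) by (simp add: sum.remove[of E e0])
      also have "(\<Sum>e\<in>E - {e0}. C c e * k e) = (\<Sum>e\<in>E - {e0}. c e * k e) * k e0"
        unfolding sum_distrib_right by (intro sum.cong) (auto simp: C_def)
      finally have "lookup (comb (C c)) t = C c e0 * k e0 + (\<Sum>e\<in>E - {e0}. c e * k e) * k e0" .
      moreover have "C c e0 = - (\<Sum>e\<in>E - {e0}. c e * k e)" by (simp add: C_def)
      ultimately show ?thesis by simp
    qed
    hence "comb (C c) \<in> null q \<or> lm (comb (C c)) \<in> T - {t}" for c using lm_comb by simp
    moreover have "card (T - {t}) < card (E - {e0})"
      using cT e0(1) Suc.prems(1,3) Suc.hyps(2) by simp
    ultimately have "\<exists>c :: 'e \<Rightarrow> int. (\<exists>e\<in>E - {e0}. \<not> q dvd c e) \<and> (\<Sum>e\<in>E - {e0}. of_int (c e) * g e) \<in> null q"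
      using cT Suc.prems by (intro Suc.hyps(1)[of "T - {t}"]) (auto simp: comb)
    then obtain c e where c: "e \<in> E - {e0}" "\<not> q dvd c e" "comb (C c) \<in> null q"
      unfolding comb by blast
    hence "\<not> q dvd C c e" using e0(2) char_dvd_mult[OF char] by (simp add: C_def)
    thus ?thesis using c unfolding comb_def by blast
  qed
qed

lemma more_elements_than_monomials:
  fixes f :: "'e \<Rightarrow> 'i mpoly"
  assumes "finite E" "finite T" "card T < card E" "\<And>e. e \<in> E \<Longrightarrow> qkeys q (f e) \<subseteq> T"
  shows "\<exists>c :: 'e \<Rightarrow> int. (\<exists>e\<in>E. \<not> q dvd c e) \<and> (\<Sum>e\<in>E. of_int (c e) * f e) \<in> null q"
proof (rule more_elements_than_leading_monomials[OF assms(1,2,3)])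
  fix c :: "'e \<Rightarrow> int"
  have "qkeys q (\<Sum>e\<in>E. of_int (c e) * f e) \<subseteq> T"
    using assms(4) by (force simp: qkeys_def lookup_sum intro!: dvd_sum)
  thus "(\<Sum>e\<in>E. of_int (c e) * f e) \<in> null q \<or> lm (\<Sum>e\<in>E. of_int (c e) * f e) \<in> T"
    using lm(1) by blast
qed

end

section \<open>The tower\<close>

text \<open>The order of \<^typ>\<open>nat \<Rightarrow>\<^sub>0 rat\<close> is lexicographic, the coordinate \<open>0\<close> first.\<close>

type_synonym lex_vector = "nat \<Rightarrow>\<^sub>0 rat"

lemma lex_less_iff: "f < g \<longleftrightarrow> (\<exists>k. lookup f k < lookup g k \<and> (\<forall>l<k. lookup f l = lookup g l))"
  for f g :: lex_vector
  by (simp add: less_poly_mapping.rep_eq less_fun_def)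

lemma lex_eq_iff: "f = g \<longleftrightarrow> (\<forall>k. lookup f k = lookup g k)" for f g :: lex_vector
  by (metis poly_mapping_eqI)

lemma funpow_swap: "(f ^^ m) ((f ^^ n) x) = (f ^^ (n + m)) x"
  by (simp add: funpow_add add.commute[of n m])

text \<open>The variables stand for \<open>x\<close>, for two consecutive elements \<open>z\<^sub>n, z\<^sub>n\<^sub>+\<^sub>1\<close> of the tower (\<open>u\<close> and \<open>w\<close>),
  and for at most one further variable. Which level \<open>n\<close> is meant depends on the place where a
  polynomial is used; level \<open>0\<close> gives the generators of the function field.\<close>

locale tower =
  fixes q :: int and x u w :: "'i::finite" and S :: "'i set"
  assumes char: "char_zero_or_prime q"
    and vars_distinct: "x \<noteq> u" "x \<noteq> w" "u \<noteq> w" "x \<notin> S" "u \<notin> S" "w \<notin> S"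
    and vars_UNIV: "UNIV = insert x (insert u (insert w S))"
    and card_S: "card S \<le> 1"
begin

abbreviation "X \<equiv> mvar x"
abbreviation "U \<equiv> mvar u"
abbreviation "W \<equiv> mvar w"

text \<open>The coordinates are the orders in \<open>x\<close>, in \<open>u\<close>, in the further variable, and \<open>\<alpha>\<close> times the
  order in \<open>w\<close>. The coordinate of \<open>u\<close> is always zero on residues; it makes the weight injective on
  all monomials.\<close>

definition wt :: "rat \<Rightarrow> ('i \<Rightarrow> nat) \<Rightarrow> lex_vector" where
  "wt \<alpha> k = single 0 (of_nat (k x)) + single 1 (of_nat (k u)) + single 2 (of_nat (\<Sum>i\<in>S. k i))
     + single 3 (\<alpha> * of_nat (k w))"

lemma lookup_wt: "lookup (wt \<alpha> k) j = (if j = 0 then of_nat (k x) else if j = 1 then of_nat (k u)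
    else if j = 2 then of_nat (\<Sum>i\<in>S. k i) else if j = 3 then \<alpha> * of_nat (k w) else 0)"
  by (auto simp: wt_def lookup_add lookup_single when_def simp del: single_of_nat of_nat_sum)

lemma S_cases: obtains "S = {}" | s where "S = {s}"
proof -
  have "finite S" by simp
  hence "card S = 0 \<longleftrightarrow> S = {}" by simp
  moreover have "card S = 0 \<or> card S = 1" using card_S by linarith
  ultimately show thesis using that by (auto simp: card_1_singleton_iff)
qed

lemma exp_eqI:
  assumes "k x = l x" "k u = l u" "k w = l w" "(\<Sum>i\<in>S. k i) = (\<Sum>i\<in>S. l i)"
  shows "k = (l :: 'i \<Rightarrow> nat)"
proof
  fix i
  have "i = x \<or> i = u \<or> i = w \<or> i \<in> S" using vars_UNIV by blast
  moreover have "k i = l i" if "i \<in> S" using that assms(4) by (cases rule: S_cases) auto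
  ultimately show "k i = l i" using assms by auto
qed

lemma wt_valuation: "\<alpha> \<noteq> 0 \<Longrightarrow> monomial_valuation q (wt \<alpha>)"
proof
  show "char_zero_or_prime q" by (rule char)
  show "wt \<alpha> (k + l) = wt \<alpha> k + wt \<alpha> l" for k l
    by (auto simp: lex_eq_iff lookup_wt lookup_add sum.distrib algebra_simps)
  assume \<alpha>: "\<alpha> \<noteq> 0"
  fix k l :: "'i \<Rightarrow> nat" assume "wt \<alpha> k = wt \<alpha> l"
  hence *: "lookup (wt \<alpha> k) j = lookup (wt \<alpha> l) j" for j by simp
  show "k = l"
    using *[of 0] *[of 1] *[of 2] *[of 3] \<alpha> by (intro exp_eqI) (auto simp: lookup_wt simp del: of_nat_sum)
qed

abbreviation "mval \<alpha> \<equiv> monomial_valuation.val q (wt \<alpha>)"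
abbreviation "mlc \<alpha> \<equiv> monomial_valuation.lc q (wt \<alpha>)"
abbreviation "mlm \<equiv> monomial_valuation.lm q (wt 1)"

sublocale M: monomial_valuation q "wt 1"
  by (rule wt_valuation) simp

text \<open>A substitution in which every variable is replaced by an element of the same value as its own
  weight, with leading coefficient \<open>1\<close>, keeps the monomials apart.\<close>

lemma subst_val:
  assumes "\<alpha> \<noteq> 0" "\<alpha>' \<noteq> 0" and f: "f \<notin> null q"
    and a: "\<And>i. a i \<notin> null q" "\<And>i. mval \<alpha>' (a i) = wt \<alpha> (unit_exp i)"
      "\<And>i. [mlc \<alpha>' (a i) = 1] (mod q)"
  shows "subst a f \<notin> null q \<and> mval \<alpha>' (subst a f) = mval \<alpha> f \<and> [mlc \<alpha>' (subst a f) = mlc \<alpha> f] (mod q)"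
proof -
  interpret A: monomial_valuation q "wt \<alpha>" by (rule wt_valuation) fact
  interpret B: monomial_valuation q "wt \<alpha>'" by (rule wt_valuation) fact
  have pow: "B.val (a i ^ n) = A.val (mvar i ^ n) \<and> [B.lc (a i ^ n) = 1] (mod q)" for i n
  proof (induction n)
    case (Suc n)
    have "[B.lc (a i * a i ^ n) = B.lc (a i) * B.lc (a i ^ n)] (mod q)"
      by (intro B.lc_mult a B.power_notin)
    also have "[B.lc (a i) * B.lc (a i ^ n) = 1 * 1] (mod q)"
      using Suc a by (intro cong_mult) auto
    finally show ?case using Suc a(2)[of i]
      by (simp add: B.val_power_Suc[OF a(1)] A.val_power_Suc A.val_mvar del: power_Suc)
         (simp add: power_Suc)
  qed (use B.lc_1 in auto)
  let ?m = "\<lambda>k. \<Prod>i\<in>UNIV. a i ^ k i"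
  have mnot: "?m k \<notin> null q" for k by (intro B.prod_notin B.power_notin a)
  have mval: "B.val (?m k) = wt \<alpha> k" for k
  proof -
    have "B.val (?m k) = (\<Sum>i\<in>UNIV. A.val (mvar i ^ k i))"
      using pow by (simp add: B.val_prod B.power_notin a)
    also have "\<dots> = A.val (\<Prod>i\<in>UNIV. mvar i ^ k i)"
      by (simp add: A.val_prod A.power_notin)
    also have "(\<Prod>i\<in>UNIV. mvar i ^ k i) = single k 1" by (simp add: single_eq_prod)
    finally show ?thesis using char_not_dvd_1[OF char] by (simp add: A.mono)
  qed
  have mlc: "[B.lc (prod (\<lambda>i. a i ^ k i) I) = 1] (mod q)" for I :: "'i set" and k
  proof (induction I rule: infinite_finite_induct)
    case (insert i I)
    have "[B.lc (a i ^ k i * prod (\<lambda>i. a i ^ k i) I) = B.lc (a i ^ k i) * B.lc (prod (\<lambda>i. a i ^ k i) I)] (mod q)"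
      by (intro B.lc_mult B.power_notin B.prod_notin a)
    also have "[B.lc (a i ^ k i) * B.lc (prod (\<lambda>i. a i ^ k i) I) = 1 * 1] (mod q)"
      using pow insert by (intro cong_mult) auto
    finally show ?case using insert by simp
  qed (use B.lc_1 in auto)
  have lmk: "A.lm f \<in> keys f" "\<not> q dvd lookup f (A.lm f)"
    using A.lm(1)[OF f] qkeys_subset by (auto simp: qkeys_def in_keys_iff)
  have inj: "inj_on (\<lambda>k. B.val (?m k)) (keys f)"
    by (auto simp: inj_on_def mval A.wt_inj)
  obtain k where k: "k \<in> keys f" "\<not> q dvd lookup f k"
    "\<forall>l\<in>keys f. \<not> q dvd lookup f l \<longrightarrow> B.val (?m k) \<le> B.val (?m l)"
    "subst a f \<notin> null q" "B.val (subst a f) = B.val (?m k)"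
    "[B.lc (subst a f) = lookup f k * B.lc (?m k)] (mod q)"
    using B.combination_distinct_values[where c = "lookup f", OF finite_keys mnot inj lmk]
    unfolding subst_def[symmetric] by blast
  have "wt \<alpha> k \<le> wt \<alpha> (A.lm f)" using k(3) lmk by (simp add: mval)
  moreover have "wt \<alpha> (A.lm f) \<le> wt \<alpha> k" using A.lm(2)[OF f, of k] k(2) by (simp add: qkeys_def)
  ultimately have "k = A.lm f" using A.wt_inj by (simp add: order_antisym)
  moreover have "[lookup f k * B.lc (?m k) = lookup f k * 1] (mod q)"
    by (intro cong_mult mlc cong_refl)
  ultimately show ?thesis using k(4,5) cong_trans[OF k(6)] by (simp add: A.val_def A.lc_def mval)
qed

text \<open>The relation \<open>z\<^sub>n = z\<^sub>n\<^sub>+\<^sub>1 + z\<^sub>n\<^sub>+\<^sub>1\<^sup>2 - x z\<^sub>n\<^sub>+\<^sub>2\<close>: from a polynomial in \<open>z\<^sub>n, z\<^sub>n\<^sub>+\<^sub>1\<close> to the same element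
  as a polynomial in \<open>z\<^sub>n\<^sub>+\<^sub>1, z\<^sub>n\<^sub>+\<^sub>2\<close>.\<close>

definition T :: "'i mpoly \<Rightarrow> 'i mpoly" where
  "T = subst (\<lambda>i. if i = u then U + U\<^sup>2 - X * W else if i = w then U else mvar i)"

text \<open>The residue modulo \<open>x\<close>, a polynomial in \<open>w = c\<^sub>n\<^sub>+\<^sub>1\<close> and the further variable: \<open>u = c\<^sub>n\<close> is
  \<open>c\<^sub>n\<^sub>+\<^sub>1 + c\<^sub>n\<^sub>+\<^sub>1\<^sup>2\<close>.\<close>

definition Res :: "'i mpoly \<Rightarrow> 'i mpoly" where
  "Res = subst (\<lambda>i. if i = x then 0 else if i = u then W + W\<^sup>2 else mvar i)"

text \<open>The change of level on residues.\<close>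

definition \<sigma> :: "'i mpoly \<Rightarrow> 'i mpoly" where
  "\<sigma> = subst (\<lambda>i. if i = w then W + W\<^sup>2 else mvar i)"

lemma T_mvar: "T X = X" "T U = U + U\<^sup>2 - X * W" "T W = U" "i \<in> S \<Longrightarrow> T (mvar i) = mvar i"
  using vars_distinct by (auto simp: T_def)

lemma Res_mvar: "Res X = 0" "Res U = W + W\<^sup>2" "Res W = W" "i \<in> S \<Longrightarrow> Res (mvar i) = mvar i"
  using vars_distinct by (auto simp: Res_def)

lemma \<sigma>_mvar: "\<sigma> X = X" "\<sigma> U = U" "\<sigma> W = W + W\<^sup>2" "i \<in> S \<Longrightarrow> \<sigma> (mvar i) = mvar i"
  using vars_distinct by (auto simp: \<sigma>_def)

lemma T_hom: "T (f + g) = T f + T g" "T (f * g) = T f * T g" "T (f - g) = T f - T g" "T (of_int n) = of_int n"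
  "T (f ^ m) = T f ^ m" "T 0 = 0" "T 1 = 1" "T (\<Sum>i\<in>I. F i) = (\<Sum>i\<in>I. T (F i))" "T (\<Prod>i\<in>I'. G i) = (\<Prod>i\<in>I'. T (G i))"
  by (simp_all add: T_def subst_simps)

lemma Res_hom: "Res (f + g) = Res f + Res g" "Res (f * g) = Res f * Res g" "Res (f - g) = Res f - Res g" "Res (of_int n) = of_int n"
  "Res (f ^ m) = Res f ^ m" "Res 0 = 0" "Res 1 = 1" "Res (\<Sum>i\<in>I. F i) = (\<Sum>i\<in>I. Res (F i))" "Res (\<Prod>i\<in>I'. G i) = (\<Prod>i\<in>I'. Res (G i))"
  by (simp_all add: Res_def subst_simps)

lemma \<sigma>_hom: "\<sigma> (f + g) = \<sigma> f + \<sigma> g" "\<sigma> (f * g) = \<sigma> f * \<sigma> g" "\<sigma> (f - g) = \<sigma> f - \<sigma> g" "\<sigma> (of_int n) = of_int n"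
  "\<sigma> (f ^ m) = \<sigma> f ^ m" "\<sigma> 0 = 0" "\<sigma> 1 = 1"
  by (simp_all add: \<sigma>_def subst_simps)

lemma Tn_hom: "(T ^^ n) (f + g) = (T ^^ n) f + (T ^^ n) g" "(T ^^ n) (f * g) = (T ^^ n) f * (T ^^ n) g"
  "(T ^^ n) (f - g) = (T ^^ n) f - (T ^^ n) g" "(T ^^ n) (of_int c) = of_int c"
  "(T ^^ n) (f ^ m) = (T ^^ n) f ^ m" "(T ^^ n) 0 = 0" "(T ^^ n) 1 = 1"
  "(T ^^ n) (\<Sum>i\<in>I. F i) = (\<Sum>i\<in>I. (T ^^ n) (F i))" "(T ^^ n) (\<Prod>i\<in>I'. G i) = (\<Prod>i\<in>I'. (T ^^ n) (G i))"
  by (induction n) (simp_all add: T_hom)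

lemma Tn_mvar: "(T ^^ n) X = X" "i \<in> S \<Longrightarrow> (T ^^ n) (mvar i) = mvar i"
  by (induction n) (simp_all add: T_mvar)

lemma null_T: "f \<in> null q \<Longrightarrow> T f \<in> null q" by (simp add: T_def null_subst)
lemma null_Tn: "f \<in> null q \<Longrightarrow> (T ^^ n) f \<in> null q" by (induction n) (auto intro: null_T)
lemma null_Res: "f \<in> null q \<Longrightarrow> Res f \<in> null q" by (simp add: Res_def null_subst)
lemma null_\<sigma>: "f \<in> null q \<Longrightarrow> \<sigma> f \<in> null q" by (simp add: \<sigma>_def null_subst)
lemma null_\<sigma>n: "f \<in> null q \<Longrightarrow> (\<sigma> ^^ n) f \<in> null q" by (induction n) (auto intro: null_\<sigma>)

lemma Res_T: "Res (T f) = \<sigma> (Res f)"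
proof (induction f rule: mpoly_induct)
  case (var i)
  have "i = x \<or> i = u \<or> i = w \<or> i \<in> S" using vars_UNIV by blast
  thus ?case by (auto simp: T_mvar Res_mvar \<sigma>_mvar Res_hom \<sigma>_hom)
qed (simp_all add: T_hom Res_hom \<sigma>_hom)

lemma Res_Tn: "Res ((T ^^ n) f) = (\<sigma> ^^ n) (Res f)"
  by (induction n) (simp_all add: Res_T)

lemma Res_decomposition: "\<exists>a b. f = Res f + X * a + (U - W - W\<^sup>2) * b"
proof (induction f rule: mpoly_induct)
  case (const n)
  show ?case by (intro exI[of _ 0]) (simp add: Res_hom)
next
  case (var i)
  consider "i = x" | "i = u" | "i = w \<or> i \<in> S" using vars_UNIV by blast
  thus ?case
  proof cases
    case 1 thus ?thesis by (intro exI[of _ 1] exI[of _ 0]) (simp add: Res_mvar)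
  next
    case 2 thus ?thesis by (intro exI[of _ 0] exI[of _ 1]) (simp add: Res_mvar)
  next
    case 3 thus ?thesis by (intro exI[of _ 0]) (auto simp: Res_mvar)
  qed
next
  case (add f g)
  then obtain a b c d where *: "f = Res f + X * a + (U - W - W\<^sup>2) * b"
    "g = Res g + X * c + (U - W - W\<^sup>2) * d" by blast
  have "f + g = Res f + Res g + X * (a + c) + (U - W - W\<^sup>2) * (b + d)"
    by (subst *(1), subst *(2)) (simp add: algebra_simps)
  thus ?case unfolding Res_hom by blast
next
  case (mult f g)
  then obtain a b c d where *: "f = Res f + X * a + (U - W - W\<^sup>2) * b"
    "g = Res g + X * c + (U - W - W\<^sup>2) * d" by blast
  let ?R = "U - W - W\<^sup>2"
  have "f * g = (Res f + X * a + ?R * b) * (Res g + X * c + ?R * d)"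
    using * by presburger
  also have "\<dots> = Res f * Res g + X * (a * (Res g + X * c + ?R * d) + Res f * c)
    + ?R * (b * (Res g + X * c + ?R * d) + Res f * d)"
    by (simp only: distrib_left distrib_right mult.assoc mult.commute mult.left_commute add.assoc add.commute add.left_commute)
  finally show ?case unfolding Res_hom by blast
qed

text \<open>The kernel of \<open>Res\<close> is generated by \<open>X\<close> and \<open>U - W - W\<^sup>2\<close>, and \<open>T\<close> maps the latter to \<open>- X * W\<close>. So
  every polynomial with residue zero becomes divisible by \<open>X\<close> at the next level.\<close>

lemma Res_null_imp_X_dvd_T:
  assumes "Res f \<in> null q" obtains g where "T f - X * g \<in> null q"
proof -
  obtain a b where f: "f = Res f + X * a + (U - W - W\<^sup>2) * b" using Res_decomposition by blast
  have "T f = T (Res f) + T X * T a + T (U - W - W\<^sup>2) * T b"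
    by (subst f) (simp only: T_hom)
  also have "T (U - W - W\<^sup>2) = - X * W" by (simp add: T_hom T_mvar)
  finally have "T f - X * (T a - W * T b) = T (Res f)" by (simp add: T_mvar algebra_simps)
  thus thesis using that null_T[OF assms] by metis
qed

lemma X_cancel: "X ^ e * a - X ^ e * b \<in> null q \<longleftrightarrow> a - b \<in> null q"
  unfolding right_diff_distrib[symmetric] M.mult_in_iff using M.power_notin[of X] by simp

lemma X_cancel_0: "X ^ e * a \<in> null q \<longleftrightarrow> a \<in> null q"
  using X_cancel[of e a 0] by simp

text \<open>Of \<open>W\<close> and \<open>W\<^sup>2\<close> the term of smaller value counts. This is where the recursion
  \<open>\<alpha>\<^sub>n = min \<alpha>\<^sub>n\<^sub>+\<^sub>1 (2 * \<alpha>\<^sub>n\<^sub>+\<^sub>1)\<close> of the values comes from.\<close>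

lemma W_poly_val:
  assumes "\<alpha>' \<noteq> 0" "\<alpha> = min \<alpha>' (2 * \<alpha>')"
  shows "W + W\<^sup>2 \<notin> null q \<and> mval \<alpha>' (W + W\<^sup>2) = wt \<alpha> (unit_exp w) \<and> [mlc \<alpha>' (W + W\<^sup>2) = 1] (mod q)"
proof -
  interpret A: monomial_valuation q "wt \<alpha>'" by (rule wt_valuation) fact
  have v1: "A.val W = wt \<alpha>' (unit_exp w)" by (simp add: A.val_mvar)
  have "A.val (W\<^sup>2) = wt \<alpha>' (unit_exp w) + wt \<alpha>' (unit_exp w)"
    unfolding power2_eq_square by (simp only: A.val_mult A.mvar_notin A.val_mvar not_False_eq_True)
  also have "\<dots> = wt (2 * \<alpha>') (unit_exp w)"
    using vars_distinct by (auto simp only: lex_eq_iff lookup_wt lookup_add unit_exp_def) (auto split: if_splits)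
  finally have v2: "A.val (W\<^sup>2) = wt (2 * \<alpha>') (unit_exp w)" .
  have l1: "A.lc W = 1" "[A.lc (W\<^sup>2) = 1] (mod q)"
    using A.lc_mult[of W W] by (simp_all add: A.lc_mvar power2_eq_square)
  have W2: "W\<^sup>2 \<notin> null q" by (simp add: A.power_notin)
  have less: "wt \<beta> (unit_exp w) < wt \<gamma> (unit_exp w)" if "\<beta> < \<gamma>" for \<beta> \<gamma>
    unfolding lex_less_iff by (rule exI[of _ 3]) (use that vars_distinct in \<open>auto simp: lookup_wt unit_exp_def\<close>)
  show ?thesis
  proof (cases "\<alpha>' > 0")
    case True
    hence "\<alpha> = \<alpha>'" using assms(2) by auto
    thus ?thesis using A.add_less[of W "W\<^sup>2"] less[of "\<alpha>'" "2 * \<alpha>'"] True v1 v2 l1 by auto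
  next
    case False
    hence "\<alpha>' < 0" using assms(1) by auto
    moreover from this have "\<alpha> = 2 * \<alpha>'" using assms(2) by auto
    ultimately show ?thesis using A.add_less[of "W\<^sup>2" W] less[of "2 * \<alpha>'" "\<alpha>'"] v1 v2 l1 W2
      by (auto simp: add.commute intro: cong_trans)
  qed
qed

lemma \<sigma>_val:
  assumes "\<alpha>' \<noteq> 0" "\<alpha> = min \<alpha>' (2 * \<alpha>')" "f \<notin> null q"
  shows "\<sigma> f \<notin> null q \<and> mval \<alpha>' (\<sigma> f) = mval \<alpha> f \<and> [mlc \<alpha>' (\<sigma> f) = mlc \<alpha> f] (mod q)"
proof -
  interpret A: monomial_valuation q "wt \<alpha>'" by (rule wt_valuation) fact
  have "wt \<alpha>' (unit_exp i) = wt \<alpha> (unit_exp i)" if "i \<noteq> w" for i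
    using that by (auto simp: lex_eq_iff lookup_wt unit_exp_def)
  thus ?thesis unfolding \<sigma>_def using assms W_poly_val[OF assms(1,2)]
    by (intro subst_val) (auto simp: A.val_mvar A.lc_mvar)
qed

lemma \<sigma>_notin: "f \<notin> null q \<Longrightarrow> \<sigma> f \<notin> null q"
  using \<sigma>_val[of 1 1 f] by simp

lemma \<sigma>n_notin: "f \<notin> null q \<Longrightarrow> (\<sigma> ^^ n) f \<notin> null q"
  by (induction n) (simp_all add: \<sigma>_notin)

lemma \<sigma>_null_iff: "(\<sigma> ^^ n) f \<in> null q \<longleftrightarrow> f \<in> null q"
  using null_\<sigma>n \<sigma>n_notin by blast

text \<open>With respect to the order at infinity, \<open>n\<close> steps of the tower multiply degrees by \<open>2 ^ n\<close>.\<close>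

lemma \<sigma>n_val_neg: "f \<notin> null q \<Longrightarrow> mval (-1) ((\<sigma> ^^ n) f) = mval (-(2 ^ n)) f"
proof (induction n arbitrary: f)
  case (Suc n)
  have "mval (-1) ((\<sigma> ^^ Suc n) f) = mval (-(2 ^ n)) (\<sigma> f)"
    using Suc.IH[OF \<sigma>_notin[OF Suc.prems]] by (simp add: funpow_swap1)
  also have "\<dots> = mval (- (2 ^ Suc n)) f" using \<sigma>_val[of "-(2 ^ n)" "- (2 ^ Suc n)" f] Suc.prems by simp
  finally show ?case .
qed simp

end

section \<open>Separatedness for the coarse valuation\<close>

lemma power_add_le: "(t + d) ^ m \<le> t ^ m + m * d * (t + d) ^ (m - 1)" for t d m :: nat
proof (induction m)
  case (Suc m)
  have "(t + d) ^ Suc m = t * (t + d) ^ m + d * (t + d) ^ m" by (simp add: algebra_simps)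
  also have "t * (t + d) ^ m \<le> t * (t ^ m + m * d * (t + d) ^ (m - 1))" using Suc by simp
  also have "t * (m * d * (t + d) ^ (m - 1)) \<le> (t + d) * (m * d * (t + d) ^ (m - 1))" by simp
  hence "t * (t ^ m + m * d * (t + d) ^ (m - 1)) \<le> t ^ Suc m + m * d * (t + d) ^ m"
    by (cases m) (simp_all add: algebra_simps)
  finally show ?case by (simp add: algebra_simps)
qed simp

lemma card_box: "card (PiE (UNIV :: 'i::finite set) (\<lambda>i. {..<B i})) = (\<Prod>i\<in>UNIV. B i :: nat)"
  by (simp add: card_PiE)

lemma mem_box: "k \<in> PiE (UNIV :: 'i::finite set) (\<lambda>i. {..<B i}) \<longleftrightarrow> (\<forall>i. k i < B i)"
  by (auto simp: PiE_UNIV_domain)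

context tower
begin

text \<open>At level \<open>n\<close> the element \<open>f\<close> is \<open>X ^ e\<close> times a unit, represented by \<open>h\<close>, of the coarse
  valuation ring.\<close>

definition rep :: "'i mpoly \<Rightarrow> nat \<Rightarrow> nat \<Rightarrow> 'i mpoly \<Rightarrow> bool" where
  "rep f n e h \<longleftrightarrow> (T ^^ n) f - X ^ e * h \<in> null q \<and> Res h \<notin> null q"

text \<open>Divisibility by all powers of \<open>X\<close> in the union of the polynomial rings of all levels.\<close>

definition inf_div :: "'i mpoly \<Rightarrow> bool" where
  "inf_div f \<longleftrightarrow> (\<forall>j. \<exists>n h. (T ^^ n) f - X ^ j * h \<in> null q)"

lemma inf_div_mult: "inf_div f \<Longrightarrow> inf_div (f * g)"
  unfolding inf_div_def
proof
  fix j assume "\<forall>j. \<exists>n h. (T ^^ n) f - X ^ j * h \<in> null q"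
  then obtain n h where "(T ^^ n) f - X ^ j * h \<in> null q" by blast
  hence "((T ^^ n) f - X ^ j * h) * (T ^^ n) g \<in> null q" by (rule null_mult)
  hence "(T ^^ n) (f * g) - X ^ j * (h * (T ^^ n) g) \<in> null q"
    by (simp add: Tn_hom algebra_simps)
  thus "\<exists>n h. (T ^^ n) (f * g) - X ^ j * h \<in> null q" by blast
qed

lemma inf_div_cong: "f - g \<in> null q \<Longrightarrow> inf_div f \<Longrightarrow> inf_div g"
  unfolding inf_div_def
proof
  fix j assume fg: "f - g \<in> null q" and "\<forall>j. \<exists>n h. (T ^^ n) f - X ^ j * h \<in> null q"
  then obtain n h where 1: "(T ^^ n) f - X ^ j * h \<in> null q" by blast
  have "(T ^^ n) g - (T ^^ n) f \<in> null q" using null_Tn[OF fg, of n] null_diff_commute[of "(T ^^ n) f"] by (simp add: Tn_hom)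
  from null_trans[OF this 1] show "\<exists>n h. (T ^^ n) g - X ^ j * h \<in> null q" by blast
qed

lemma inf_div_Tn: "inf_div f \<Longrightarrow> inf_div ((T ^^ m) f)"
  unfolding inf_div_def
proof
  fix j assume "\<forall>j. \<exists>n h. (T ^^ n) f - X ^ j * h \<in> null q"
  then obtain n h where "(T ^^ n) f - X ^ j * h \<in> null q" by blast
  from null_Tn[OF this, of m] have "(T ^^ n) ((T ^^ m) f) - X ^ j * (T ^^ m) h \<in> null q"
    by (simp add: Tn_hom Tn_mvar funpow_swap) (simp add: add.commute)
  thus "\<exists>n h. (T ^^ n) ((T ^^ m) f) - X ^ j * h \<in> null q" by blast
qed

lemma inf_div_X_cancel: "inf_div (X ^ e * f) \<Longrightarrow> inf_div f"
  unfolding inf_div_def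
proof
  fix j assume "\<forall>j. \<exists>n h. (T ^^ n) (X ^ e * f) - X ^ j * h \<in> null q"
  then obtain n h where "(T ^^ n) (X ^ e * f) - X ^ (e + j) * h \<in> null q" by blast
  hence "X ^ e * (T ^^ n) f - X ^ e * (X ^ j * h) \<in> null q"
    by (simp add: Tn_hom Tn_mvar power_add mult.assoc)
  thus "\<exists>n h. (T ^^ n) f - X ^ j * h \<in> null q" unfolding X_cancel by blast
qed

lemma inf_div_Res: "inf_div f \<Longrightarrow> Res f \<in> null q"
proof -
  assume "inf_div f"
  then obtain n h where "(T ^^ n) f - X ^ 1 * h \<in> null q" unfolding inf_div_def by blast
  from null_Res[OF this] have "(\<sigma> ^^ n) (Res f) \<in> null q" by (simp add: Res_hom Res_mvar Res_Tn)
  thus ?thesis by (simp add: \<sigma>_null_iff)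
qed

text \<open>As long as the residue is zero, one more level yields one more factor \<open>X\<close>.\<close>

lemma not_rep_imp_inf_div:
  assumes "\<And>n e h. \<not> rep f n e h" shows "inf_div f"
proof -
  have "\<exists>h. (T ^^ j) f - X ^ j * h \<in> null q" for j
  proof (induction j)
    case 0
    show ?case by (intro exI[of _ f]) simp
  next
    case (Suc j)
    then obtain h where h: "(T ^^ j) f - X ^ j * h \<in> null q" by blast
    hence "Res h \<in> null q" using assms unfolding rep_def by blast
    then obtain g where g: "T h - X * g \<in> null q" by (rule Res_null_imp_X_dvd_T)
    have "T ((T ^^ j) f) - X ^ j * T h \<in> null q" using null_T[OF h] by (simp add: T_hom T_mvar)
    moreover have "X ^ j * T h - X ^ j * (X * g) \<in> null q" using g by (simp only: X_cancel)
    ultimately have "T ((T ^^ j) f) - X ^ j * (X * g) \<in> null q" by (rule null_trans)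
    thus ?case by (intro exI[of _ g]) (simp add: mult_ac)
  qed
  thus ?thesis unfolding inf_div_def by blast
qed

text \<open>The witnesses are \<open>Z = X ^ e * z\<^sub>n\<close> and \<open>Z = X ^ e * z\<^sub>n\<^sub>+\<^sub>1\<close>, where the power of \<open>X\<close> clears the
  denominators in \<open>z\<^sub>n\<^sub>+\<^sub>2 = (z\<^sub>n\<^sub>+\<^sub>1 + z\<^sub>n\<^sub>+\<^sub>1\<^sup>2 - z\<^sub>n) / x\<close>.\<close>

lemma orbit_exists:
  "(\<exists>Z e. (T ^^ n) Z = X ^ e * U) \<and> (\<exists>Z e. (T ^^ n) Z = X ^ e * W)"
proof (induction n)
  case 0
  have "(T ^^ 0) U = X ^ 0 * U" "(T ^^ 0) W = X ^ 0 * W" by simp_all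
  thus ?case by blast
next
  case (Suc n)
  then obtain f e f' e' where *: "(T ^^ n) f = X ^ e * U" "(T ^^ n) f' = X ^ e' * W" by blast
  have 1: "(T ^^ Suc n) f' = X ^ e' * U" by (simp add: * T_hom T_mvar)
  have 2: "(T ^^ Suc n) f = X ^ e * (U + U\<^sup>2 - X * W)" by (simp add: * T_hom T_mvar)
  have "(T ^^ Suc n) (X ^ (e + e') * f' + X ^ e * f'\<^sup>2 - X ^ (e' + e') * f) =
    X ^ (e + e') * (X ^ e' * U) + X ^ e * (X ^ e' * U)\<^sup>2 - X ^ (e' + e') * (X ^ e * (U + U\<^sup>2 - X * W))"
    unfolding Tn_hom Tn_mvar 1 2 ..
  also have "\<dots> = X ^ (e + e' + e' + 1) * W"
    by (simp add: algebra_simps power_add power_mult_distrib power2_eq_square)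
  finally show ?case using 1 by blast
qed

lemma prod_vars:
  "(\<Prod>i\<in>UNIV. F i) = F x * F u * F w * (\<Prod>i\<in>S. F i)" for F :: "'i \<Rightarrow> 'a::comm_monoid_mult"
  unfolding vars_UNIV using vars_distinct by (simp add: mult_ac)

lemma lookup_mval_power:
  assumes "\<alpha> \<noteq> 0" "f \<notin> null q"
  shows "lookup (mval \<alpha> (f ^ n)) j = of_nat n * lookup (mval \<alpha> f) j"
proof -
  interpret A: monomial_valuation q "wt \<alpha>" by (rule wt_valuation) fact
  show ?thesis using assms by (induction n) (simp_all add: A.val_power_Suc lookup_add algebra_simps del: power_Suc)
qed

text \<open>Boxes of exponents in which the exponent of \<open>w\<close> has its own bound.\<close>

definition cyl :: "nat \<Rightarrow> nat \<Rightarrow> ('i \<Rightarrow> nat) set" where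
  "cyl N A = PiE UNIV (\<lambda>i. {..<if i = w then N else A})"

lemma mem_cyl: "k \<in> cyl N A \<longleftrightarrow> k w < N \<and> (\<forall>i. i \<noteq> w \<longrightarrow> k i < A)"
  unfolding cyl_def mem_box by auto

lemma finite_cyl [simp]: "finite (cyl N A)"
  unfolding cyl_def by (intro finite_PiE) auto

lemma card_cyl: "card (cyl N A) = N * A ^ (card (UNIV :: 'i set) - 1)"
proof -
  have "card (cyl N A) = (\<Prod>i\<in>UNIV. if i = w then N else A)" unfolding cyl_def by (rule card_box)
  also have "\<dots> = N * (\<Prod>i\<in>UNIV - {w}. A)" by (subst prod.remove[of _ w]) auto
  finally show ?thesis by (simp add: card_Diff_singleton)
qed

text \<open>At level \<open>n\<close>, \<open>(T ^^ n) U\<close> is \<open>z\<^sub>0\<close> and \<open>U\<close> is \<open>z\<^sub>n\<close>. Their residues satisfy a polynomial equation of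
  degree \<open>2 ^ n\<close>, and no smaller one: with respect to the order at infinity the values of
  \<open>c\<^sub>0 ^ i * c\<^sub>n ^ j\<close> for \<open>j < 2 ^ n\<close> are distinct.\<close>

lemma residues_independent:
  fixes c :: "('i \<Rightarrow> nat) \<Rightarrow> int"
  assumes c: "k0 \<in> cyl (2 ^ n) A" "\<not> q dvd c k0"
  defines "\<mu> \<equiv> \<lambda>k. X ^ k x * ((T ^^ n) U ^ k u * (\<Prod>i\<in>S. mvar i ^ k i) * U ^ k w)"
  shows "\<not> inf_div (\<Sum>k\<in>cyl (2 ^ n) A. of_int (c k) * \<mu> k)"
proof
  let ?E = "cyl (2 ^ n) A"
  assume inf: "inf_div (\<Sum>k\<in>?E. of_int (c k) * \<mu> k)"
  define \<nu> where "\<nu> k = (T ^^ n) U ^ k u * (\<Prod>i\<in>S. mvar i ^ k i) * U ^ k w" for k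
  define D where "D = {k \<in> ?E. \<not> q dvd c k}"
  define a where "a = Min ((\<lambda>k. k x) ` D)"
  have D: "finite D" "k0 \<in> D" using c unfolding D_def by (auto intro: finite_subset[OF _ finite_cyl])
  have aD: "a \<le> k x" if "k \<in> D" for k unfolding a_def using D that by (intro Min_le) auto
  obtain k1 where k1: "k1 \<in> D" "k1 x = a"
    using Min_in[of "(\<lambda>k. k x) ` D"] D unfolding a_def by fastforce
  \<comment> \<open>Cancelling the smallest power of \<open>X\<close> leaves a sum whose residue comes from \<open>D0\<close>, defined below.\<close>
  define \<Psi> where "\<Psi> = (\<Sum>k\<in>D. of_int (c k) * (X ^ (k x - a) * \<nu> k))"
  have "(\<Sum>k\<in>?E. of_int (c k) * \<mu> k) - (\<Sum>k\<in>D. of_int (c k) * \<mu> k) = (\<Sum>k\<in>?E - D. of_int (c k) * \<mu> k)"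
    unfolding D_def by (subst sum_diff) auto
  also have "\<dots> \<in> null q" by (intro null_sum null_mult) (auto simp: D_def)
  also have "(\<Sum>k\<in>D. of_int (c k) * \<mu> k) = X ^ a * \<Psi>"
    unfolding \<Psi>_def sum_distrib_left
  proof (intro sum.cong refl)
    fix k assume "k \<in> D"
    hence "X ^ k x = X ^ a * X ^ (k x - a)" using aD by (simp flip: power_add)
    thus "of_int (c k) * \<mu> k = X ^ a * (of_int (c k) * (X ^ (k x - a) * \<nu> k))"
      by (simp add: \<mu>_def \<nu>_def mult_ac)
  qed
  finally have "inf_div (X ^ a * \<Psi>)" using inf inf_div_cong by blast
  hence "Res \<Psi> \<in> null q" by (rule inf_div_Res[OF inf_div_X_cancel])
  define D0 where "D0 = {k \<in> D. k x = a}"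
  have "Res \<Psi> = (\<Sum>k\<in>D. if k x = a then of_int (c k) * Res (\<nu> k) else 0)"
    unfolding \<Psi>_def Res_hom
    by (intro sum.cong refl) (use aD in \<open>auto simp: Res_mvar power_0_left dest!: aD\<close>)
  also have "\<dots> = (\<Sum>k\<in>D0. of_int (c k) * Res (\<nu> k))"
    unfolding D0_def using D(1) by (intro sum.mono_neutral_cong_right) auto
  finally have null: "(\<Sum>k\<in>D0. of_int (c k) * Res (\<nu> k)) \<in> null q" using \<open>Res \<Psi> \<in> null q\<close> by simp
  interpret A: monomial_valuation q "wt (-1)" by (rule wt_valuation) simp
  define V where "V = (\<sigma> ^^ n) (W + W\<^sup>2)"
  have P: "(\<Prod>i\<in>S. mvar i ^ k i) = single (\<lambda>i. if i \<in> S then k i else 0) 1" for k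
    by (simp add: prod_mvar)
  have Res\<nu>: "Res (\<nu> k) = V ^ k u * single (\<lambda>i. if i \<in> S then k i else 0) 1 * (W + W\<^sup>2) ^ k w" for k
    by (simp add: \<nu>_def Res_hom Res_mvar Res_Tn V_def flip: P)
  have W2: "W + W\<^sup>2 \<notin> null q" "A.val (W + W\<^sup>2) = wt (-2) (unit_exp w)"
    using W_poly_val[of "-1" "-2"] by auto
  have V: "V \<notin> null q" "A.val V = wt (- (2 ^ Suc n)) (unit_exp w)"
    unfolding V_def using \<sigma>n_notin[OF W2(1)] \<sigma>n_val_neg[OF W2(1)]
      W_poly_val[of "- (2 ^ n)" "- (2 ^ Suc n)"] by auto
  have notin: "Res (\<nu> k) \<notin> null q" for k
    unfolding Res\<nu> using W2(1) V(1) A.mono(1)[OF char_not_dvd_1[OF char]]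
    by (simp add: A.mult_in_iff A.power_notin)
  have val: "A.val (Res (\<nu> k)) = A.val (V ^ k u) + wt (-1) (\<lambda>i. if i \<in> S then k i else 0) + A.val ((W + W\<^sup>2) ^ k w)" for k
    unfolding Res\<nu> using W2(1) V(1) A.mono(1,3)[OF char_not_dvd_1[OF char]]
    by (simp add: A.mult_in_iff A.power_notin A.val_mult)
  have lookup2: "lookup (A.val (Res (\<nu> k))) 2 = of_nat (\<Sum>i\<in>S. k i)" for k
    unfolding val by (simp add: lookup_add lookup_mval_power W2 V lookup_wt unit_exp_def vars_distinct)
  have lookup3: "lookup (A.val (Res (\<nu> k))) 3 = - of_nat (2 * (2 ^ n * k u + k w))" for k
    unfolding val using vars_distinct by (simp add: lookup_add lookup_mval_power W2 V lookup_wt unit_exp_def algebra_simps)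
  \<comment> \<open>The coordinate \<open>3\<close> determines \<open>k u\<close> and \<open>k w\<close>, by division with remainder by \<open>2 ^ n\<close>.\<close>
  have "inj_on (\<lambda>k. A.val (Res (\<nu> k))) D0"
  proof (rule inj_onI)
    fix k l assume kl: "k \<in> D0" "l \<in> D0" "A.val (Res (\<nu> k)) = A.val (Res (\<nu> l))"
    have "2 * (2 ^ n * k u + k w) = 2 * (2 ^ n * l u + l w)"
      using lookup3[of k] lookup3[of l] kl(3) by (metis neg_equal_iff_equal of_nat_eq_iff)
    hence eq: "2 ^ n * k u + k w = 2 ^ n * l u + l w" by simp
    have lt: "k w < 2 ^ n" "l w < 2 ^ n" using kl unfolding D0_def D_def mem_cyl by auto
    have "k w = l w" "k u = l u"
      using arg_cong[OF eq, of "\<lambda>t. t mod 2 ^ n"] arg_cong[OF eq, of "\<lambda>t. t div 2 ^ n"] lt by auto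
    moreover have "(\<Sum>i\<in>S. k i) = (\<Sum>i\<in>S. l i)"
      using lookup2[of k] lookup2[of l] kl(3) by (metis of_nat_eq_iff)
    moreover have "k x = l x" using kl by (simp add: D0_def)
    ultimately show "k = l" by (intro exp_eqI)
  qed
  from A.combination_distinct_values[OF _ notin this, of k1 c] null D(1) k1
  show False by (auto simp: D0_def D_def)
qed

text \<open>The argument counts monomials. In the space of polynomials with all degrees at most \<open>Y\<close> take the
  multiples of \<open>f\<close>, of codimension \<open>O(Y ^ (m - 1))\<close> with a constant that depends on \<open>f\<close> only, and the
  products of monomials with powers \<open>z\<^sub>n ^ j\<close>, \<open>j < N = 2 ^ n\<close>. The latter number about
  \<open>N * Y ^ (m - 1)\<close>. For large \<open>n\<close> a combination of them is a multiple of \<open>f\<close>, hence divisible by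
  all powers of \<open>X\<close>, in contradiction to \<open>residues_independent\<close>.\<close>

theorem inf_div_imp_null:
  assumes inf: "inf_div f" shows "f \<in> null q"
proof (rule ccontr)
  assume f: "f \<notin> null q"
  obtain d where d: "f \<in> deg_le d" using deg_le_exists by blast
  define m where "m = card (UNIV :: 'i set)"
  have m: "m > 0" unfolding m_def by (simp add: card_gt_0_iff)
  \<comment> \<open>With \<open>Y < 2 * A\<close> below, the codimension is at most \<open>m * d * (2 * A) ^ (m - 1) < N * A ^ (m - 1)\<close>.\<close>
  define n where "n = m * d * 2 ^ (m - 1)"
  define N :: nat where "N = 2 ^ n"
  have N: "m * d * 2 ^ (m - 1) < N" unfolding N_def n_def[symmetric] by (rule less_exp)
  obtain Z e where Z: "(T ^^ n) Z = X ^ e * U" using orbit_exists[of n] by blast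
  obtain \<delta> where \<delta>: "Z \<in> deg_le \<delta>" using deg_le_exists by blast
  define C where "C = e * N + N * \<delta>"
  define A where "A = C + d + 1"
  define Y where "Y = A + C"
  \<comment> \<open>The first factor \<open>X\<close> gives all \<open>g k\<close> the same power of \<open>X\<close> at level \<open>n\<close>, see \<open>Tg\<close>.\<close>
  define g where "g k = single (k(w := 0)) 1 * (X ^ (e * (N - 1 - k w)) * Z ^ k w)" for k
  have g_deg: "g k \<in> deg_le Y" if "k \<in> cyl N A" for k
  proof -
    have "single (k(w := 0)) 1 \<in> deg_le A" using that by (auto simp: deg_le_def mem_cyl less_imp_le)
    moreover have "X ^ (e * (N - 1 - k w)) \<in> deg_le (e * N)"
      using deg_le_power[OF deg_le_mvar[of x], of "e * (N - 1 - k w)"] by (rule deg_le_mono[rotated]) simp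
    moreover have "Z ^ k w \<in> deg_le (N * \<delta>)"
      using deg_le_power[OF \<delta>, of "k w"] by (rule deg_le_mono[rotated]) (use that in \<open>auto simp: mem_cyl\<close>)
    ultimately show ?thesis unfolding g_def Y_def C_def by (intro deg_le_mult)
  qed
  define B where "B = PiE (UNIV :: 'i set) (\<lambda>i. {..<Y - d + 1})"
  define F where "F = case_sum g (\<lambda>k. f * single k 1)"
  have "F e \<in> deg_le Y" if "e \<in> cyl N A <+> B" for e
  proof (cases e)
    case (Inl k) thus ?thesis using that g_deg by (auto simp: F_def)
  next
    case (Inr k)
    hence "single k 1 \<in> deg_le (Y - d)" using that by (auto simp: B_def mem_box deg_le_def less_Suc_eq_le)
    from deg_le_mult[OF d this] show ?thesis using Inr by (simp add: F_def Y_def A_def add_ac)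
  qed
  hence keys: "qkeys q (F e) \<subseteq> PiE UNIV (\<lambda>i. {..<Y + 1})" if "e \<in> cyl N A <+> B" for e
    using that qkeys_subset unfolding deg_le_def by (fastforce simp: mem_box less_Suc_eq_le)
  have "card (PiE (UNIV :: 'i set) (\<lambda>i. {..<Y + 1})) = (Y + 1) ^ m"
    unfolding card_box m_def by simp
  also have "\<dots> < N * A ^ (m - 1) + (Y - d + 1) ^ m"
  proof -
    have Y: "Y + 1 = (Y - d + 1) + d" unfolding Y_def A_def by simp
    have "(Y + 1) ^ m \<le> (Y - d + 1) ^ m + m * d * (Y + 1) ^ (m - 1)"
      unfolding Y by (rule power_add_le)
    also have "m * d * (Y + 1) ^ (m - 1) \<le> m * d * (2 * A) ^ (m - 1)"
      unfolding Y_def A_def by (intro mult_left_mono power_mono) auto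
    also have "\<dots> = m * d * 2 ^ (m - 1) * A ^ (m - 1)" by (simp add: power_mult_distrib)
    also have "\<dots> < N * A ^ (m - 1)" using N by (simp add: A_def)
    finally show ?thesis by simp
  qed
  also have "\<dots> = card (cyl N A <+> B)"
    by (subst card_Plus) (auto simp: B_def card_cyl card_box m_def intro!: finite_PiE)
  finally have card: "card (PiE (UNIV :: 'i set) (\<lambda>i. {..<Y + 1})) < card (cyl N A <+> B)" .
  have fin: "finite (cyl N A <+> B)" "finite (PiE (UNIV :: 'i set) (\<lambda>i. {..<Y + 1}))"
    by (auto simp: B_def intro!: finite_PiE)
  have "\<exists>c :: ('i \<Rightarrow> nat) + ('i \<Rightarrow> nat) \<Rightarrow> int. (\<exists>e\<in>cyl N A <+> B. \<not> q dvd c e) \<and>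
      (\<Sum>e\<in>cyl N A <+> B. of_int (c e) * F e) \<in> null q"
    by (rule M.more_elements_than_monomials[OF fin card keys])
  then obtain c e0 where c: "e0 \<in> cyl N A <+> B" "\<not> q dvd c e0"
    "(\<Sum>e\<in>cyl N A <+> B. of_int (c e) * F e) \<in> null q" by (elim exE conjE bexE)
  define G where "G = (\<Sum>k\<in>B. of_int (c (Inr k)) * single k (1 :: int))"
  define \<Phi> where "\<Phi> = (\<Sum>k\<in>cyl N A. of_int (c (Inl k)) * g k)"
  have finB: "finite B" unfolding B_def by (intro finite_PiE) auto
  have "(\<Sum>e\<in>cyl N A <+> B. of_int (c e) * F e) = \<Phi> + f * G"
    unfolding \<Phi>_def G_def F_def sum_distrib_left
    by (subst sum.Plus) (auto simp: finB mult_ac intro!: sum.cong)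
  hence sum: "\<Phi> + f * G \<in> null q" using c(3) by simp
  \<comment> \<open>The multiples of \<open>f\<close> alone are independent, so the relation involves some \<open>g k\<close>.\<close>
  have "\<exists>k\<in>cyl N A. \<not> q dvd c (Inl k)"
  proof (rule ccontr)
    assume no: "\<not> ?thesis"
    hence "\<Phi> \<in> null q" unfolding \<Phi>_def by (intro null_sum null_mult) auto
    hence "f * G \<in> null q" using sum null_diff[of "\<Phi> + f * G" q \<Phi>] by simp
    hence G: "G \<in> null q" using f by (simp add: M.mult_in_iff)
    obtain k where k: "e0 = Inr k" "k \<in> B" using c(1,2) no by blast
    have "lookup G k = (\<Sum>l\<in>B. if l = k then c (Inr l) else 0)"
      unfolding G_def lookup_sum by (intro sum.cong) (auto simp: lookup_single when_def)
    also have "\<dots> = c e0" using k finB by simp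
    finally show False using G c(2) by (metis (mono_tags, lifting) mem_Collect_eq null_def)
  qed
  then obtain k where k: "k \<in> cyl N A" "\<not> q dvd c (Inl k)" by blast
  have "inf_div (f * (- G))" using inf by (rule inf_div_mult)
  moreover have "f * (- G) - \<Phi> = - (\<Phi> + f * G)" by (simp add: algebra_simps)
  hence "f * (- G) - \<Phi> \<in> null q" using sum null_uminus[of "\<Phi> + f * G" q] by metis
  ultimately have "inf_div ((T ^^ n) \<Phi>)" using inf_div_cong inf_div_Tn by blast
  define \<mu> where "\<mu> = (\<lambda>k. X ^ k x * ((T ^^ n) U ^ k u * (\<Prod>i\<in>S. mvar i ^ k i) * U ^ k w))"
  have Tg: "(T ^^ n) (g k) = X ^ (e * (N - 1)) * \<mu> k" if "k \<in> cyl N A" for k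
  proof -
    have s: "single (k(w := 0)) 1 = X ^ k x * U ^ k u * (\<Prod>i\<in>S. mvar i ^ k i)"
    proof -
      have "(\<Prod>i\<in>S. mvar i ^ (k(w := 0)) i) = (\<Prod>i\<in>S. mvar i ^ k i)"
        using vars_distinct by (intro prod.cong) auto
      thus ?thesis using vars_distinct
        unfolding single_eq_prod prod_vars by simp
    qed
    have "(T ^^ n) (g k) = X ^ k x * (T ^^ n) U ^ k u * (\<Prod>i\<in>S. mvar i ^ k i) *
      (X ^ (e * (N - 1 - k w)) * (X ^ e * U) ^ k w)"
      unfolding g_def s by (simp add: Tn_hom Tn_mvar Z)
    also have "X ^ (e * (N - 1 - k w)) * (X ^ e * U) ^ k w = X ^ (e * (N - 1)) * U ^ k w"
    proof -
      have "e * (N - 1 - k w) + e * k w = e * (N - 1)"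
        using that unfolding mem_cyl by (simp flip: add_mult_distrib2)
      hence "X ^ (e * (N - 1)) = X ^ (e * (N - 1 - k w)) * X ^ (e * k w)" by (metis power_add)
      thus ?thesis by (simp add: power_mult_distrib power_mult mult_ac)
    qed
    finally show ?thesis by (simp add: \<mu>_def mult_ac)
  qed
  have "(T ^^ n) \<Phi> = X ^ (e * (N - 1)) * (\<Sum>k\<in>cyl N A. of_int (c (Inl k)) * \<mu> k)"
    unfolding \<Phi>_def Tn_hom sum_distrib_left
    by (intro sum.cong refl) (simp add: Tg mult_ac)
  with \<open>inf_div ((T ^^ n) \<Phi>)\<close> have "inf_div (X ^ (e * (N - 1)) * (\<Sum>k\<in>cyl N A. of_int (c (Inl k)) * \<mu> k))"
    by (simp only:)
  hence "inf_div (\<Sum>k\<in>cyl N A. of_int (c (Inl k)) * \<mu> k)" by (rule inf_div_X_cancel)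
  thus False using residues_independent[of k n A "\<lambda>k. c (Inl k)"] k unfolding N_def \<mu>_def by blast
qed

corollary rep_exists: "f \<notin> null q \<Longrightarrow> \<exists>n e h. rep f n e h"
  using not_rep_imp_inf_div inf_div_imp_null by blast

end

section \<open>The composite valuation\<close>

context tower
begin

lemma Res_keys: "k \<in> keys (Res f) \<Longrightarrow> k x = 0 \<and> k u = 0"
proof (induction f arbitrary: k rule: mpoly_induct)
  case (const n)
  thus ?case by (auto simp: Res_hom in_keys_iff lookup_of_int split: if_splits)
next
  case (var i)
  have W: "keys (W + W\<^sup>2) \<subseteq> {unit_exp w, unit_exp w + unit_exp w}"
    using keys_add[of W "W\<^sup>2"] by (auto simp: power2_eq_square mvar_def mult_single)
  consider "i = x" | "i = u" | "i = w \<or> i \<in> S" using vars_UNIV by blast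
  thus ?case
  proof cases
    case 1 thus ?thesis using var by (simp add: Res_mvar)
  next
    case 2 thus ?thesis using var W vars_distinct by (auto simp: Res_mvar unit_exp_def)
  next
    case 3
    hence "Res (mvar i) = mvar i" by (auto simp: Res_mvar)
    thus ?thesis using var vars_distinct 3 by (auto simp: mvar_def unit_exp_def)
  qed
next
  case (add f g)
  thus ?case using keys_add[of "Res f" "Res g"] by (auto simp: Res_hom)
next
  case (mult f g)
  thus ?case using keys_mult[of "Res f" "Res g"] by (fastforce simp: Res_hom)
qed

lemma mval_Res:
  assumes "\<alpha> \<noteq> 0" "Res f \<notin> null q"
  obtains k where "mval \<alpha> (Res f) = wt \<alpha> k" "k \<in> qkeys q (Res f)" "k x = 0" "k u = 0"
proof -
  interpret A: monomial_valuation q "wt \<alpha>" by (rule wt_valuation) fact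
  have "A.lm (Res f) \<in> qkeys q (Res f)" using A.lm(1) assms by blast
  moreover from this have "A.lm (Res f) \<in> keys (Res f)" using qkeys_subset by blast
  ultimately show thesis using that[of "A.lm (Res f)"] Res_keys by (auto simp: A.val_def)
qed

lemma lookup_mval_Res:
  assumes "\<alpha> \<noteq> 0" "Res f \<notin> null q"
  shows "lookup (mval \<alpha> (Res f)) 0 = 0"
  using mval_Res[OF assms] by (metis lookup_wt of_nat_0)

lemma rep_shift: "rep f n e h \<Longrightarrow> rep f (n + j) e ((T ^^ j) h)"
proof -
  assume r: "rep f n e h"
  from r have "(T ^^ j) ((T ^^ n) f - X ^ e * h) \<in> null q" unfolding rep_def by (blast intro: null_Tn)
  hence "(T ^^ (n + j)) f - X ^ e * (T ^^ j) h \<in> null q"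
    by (simp add: Tn_hom Tn_mvar funpow_swap)
  moreover have "Res ((T ^^ j) h) \<notin> null q" using r by (simp add: Res_Tn \<sigma>_null_iff rep_def)
  ultimately show ?thesis by (simp add: rep_def)
qed

lemma X_power_le:
  assumes "X ^ e * h - X ^ e' * h' \<in> null q" "Res h' \<notin> null q"
  shows "e \<le> e'"
proof (rule ccontr)
  assume "\<not> e \<le> e'"
  then obtain d where d: "e = e' + Suc d" using less_imp_Suc_add by fastforce
  have "X ^ e' * (X ^ Suc d * h) - X ^ e' * h' \<in> null q"
    using assms(1) by (simp add: d power_add mult_ac)
  hence "X ^ Suc d * h - h' \<in> null q" by (simp only: X_cancel)
  from null_Res[OF this] show False using assms(2) by (simp add: Res_hom Res_mvar)
qed

text \<open>The exponent is the coarse value.\<close>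

lemma rep_unique:
  assumes "rep f n e h" "rep f n e' h'" shows "e = e'" "h - h' \<in> null q"
proof -
  have 1: "X ^ e * h - X ^ e' * h' \<in> null q"
    using assms null_trans null_diff_commute unfolding rep_def by blast
  hence 2: "X ^ e' * h' - X ^ e * h \<in> null q" using null_diff_commute by blast
  show "e = e'" using X_power_le[OF 1] X_power_le[OF 2] assms unfolding rep_def by simp
  thus "h - h' \<in> null q" using 1 X_cancel by blast
qed

lemma rep_cong: "rep f n e h \<Longrightarrow> f - g \<in> null q \<Longrightarrow> rep g n e h"
  using null_Tn[of "f - g" n] null_trans null_diff_commute unfolding rep_def Tn_hom by blast

lemma rep_mult: "rep f n e h \<Longrightarrow> rep g n e' h' \<Longrightarrow> rep (f * g) n (e + e') (h * h')"
  using null_cong_mult[of "(T ^^ n) f" "X ^ e * h" q "(T ^^ n) g" "X ^ e' * h'"]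
  unfolding rep_def by (simp add: Tn_hom Res_hom power_add mult_ac M.mult_in_iff)

lemma rep_add_eq:
  "rep f n e h \<Longrightarrow> rep g n e h' \<Longrightarrow> Res h + Res h' \<notin> null q \<Longrightarrow> rep (f + g) n e (h + h')"
  using null_cong_add[of "(T ^^ n) f" "X ^ e * h" q "(T ^^ n) g" "X ^ e * h'"]
  unfolding rep_def by (simp add: Tn_hom Res_hom distrib_left)

lemma rep_add_less:
  assumes "rep f n e h" "rep g n e' h'" "e < e'"
  shows "rep (f + g) n e (h + X ^ (e' - e) * h')" "Res (h + X ^ (e' - e) * h') = Res h"
proof -
  have "X ^ e' * h' = X ^ e * (X ^ (e' - e) * h')"
    using assms(3) by (simp flip: power_add mult.assoc)
  thus "rep (f + g) n e (h + X ^ (e' - e) * h')" "Res (h + X ^ (e' - e) * h') = Res h"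
    using assms null_cong_add[of "(T ^^ n) f" "X ^ e * h" q "(T ^^ n) g" "X ^ e' * h'"]
    unfolding rep_def by (simp_all add: Tn_hom Res_hom Res_mvar distrib_left power_0_left)
qed

text \<open>Cancellation in the residue increases the coarse value.\<close>

lemma rep_greater:
  assumes "(T ^^ n) f - X ^ e * g \<in> null q" "Res g \<in> null q" "rep f n' e' h"
  shows "e < e'"
proof -
  from null_Tn[OF assms(1), of n'] have 1: "(T ^^ (n + n')) f - X ^ e * (T ^^ n') g \<in> null q"
    by (simp add: Tn_hom Tn_mvar funpow_swap)
  from rep_shift[OF assms(3), of n] have 2: "rep f (n + n') e' ((T ^^ n) h)" by (simp add: add.commute)
  have 3: "X ^ e * (T ^^ n') g - X ^ e' * (T ^^ n) h \<in> null q"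
    using 1 2 null_trans null_diff_commute unfolding rep_def by blast
  hence "e \<le> e'" using 2 X_power_le unfolding rep_def by blast
  moreover have "e \<noteq> e'"
  proof
    assume "e = e'"
    hence "(T ^^ n') g - (T ^^ n) h \<in> null q" using 3 X_cancel by blast
    from null_Res[OF this] have "Res ((T ^^ n') g) - Res ((T ^^ n) h) \<in> null q" by (simp only: Res_hom)
    moreover have "Res ((T ^^ n') g) \<in> null q" using assms(2) by (simp only: Res_Tn \<sigma>_null_iff)
    ultimately show False using 2 null_cong unfolding rep_def by blast
  qed
  ultimately show ?thesis by simp
qed

lemma rep_common:
  assumes "f \<notin> null q" "g \<notin> null q"
  obtains n e h e' h' where "rep f n e h" "rep g n e' h'"
proof -
  obtain n e h where 1: "rep f n e h" using rep_exists assms by blast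
  obtain m e' h' where 2: "rep g m e' h'" using rep_exists assms by blast
  have "rep g (n + m) e' ((T ^^ n) h')" using rep_shift[OF 2, of n] by (simp add: add.commute)
  with rep_shift[OF 1, of m] show thesis by (rule that)
qed

definition xpart :: "nat \<Rightarrow> lex_vector" where "xpart e = single 0 (of_nat e)"

lemma lookup_xpart: "lookup (xpart e) k = (if k = 0 then of_nat e else 0)"
  by (auto simp: xpart_def lookup_single when_def simp del: single_of_nat)

lemma xpart_less:
  assumes "lookup a 0 = 0" "lookup b 0 = 0"
  shows "xpart e + a < xpart e' + b \<longleftrightarrow> e < e' \<or> e = e' \<and> a < b"
proof
  assume "xpart e + a < xpart e' + b"
  then obtain k where k: "lookup (xpart e + a) k < lookup (xpart e' + b) k"
    "\<forall>l<k. lookup (xpart e + a) l = lookup (xpart e' + b) l" unfolding lex_less_iff by blast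
  show "e < e' \<or> e = e' \<and> a < b"
  proof (cases "k = 0")
    case True thus ?thesis using k(1) assms by (simp add: lookup_add lookup_xpart)
  next
    case False
    hence "e = e'" using k(2)[rule_format, of 0] assms by (simp add: lookup_add lookup_xpart)
    moreover have "a < b" unfolding lex_less_iff using k False \<open>e = e'\<close>
      by (intro exI[of _ k]) (simp add: lookup_add lookup_xpart)
    ultimately show ?thesis by blast
  qed
next
  assume "e < e' \<or> e = e' \<and> a < b"
  thus "xpart e + a < xpart e' + b"
  proof
    assume "e < e'"
    thus ?thesis unfolding lex_less_iff using assms
      by (intro exI[of _ 0]) (simp add: lookup_add lookup_xpart)
  qed auto
qed

lemma xpart_eq:
  assumes "lookup a 0 = 0" "lookup b 0 = 0" "xpart e + a = xpart e' + b"
  shows "e = e' \<and> a = b"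
proof -
  have "lookup (xpart e + a) 0 = lookup (xpart e' + b) 0" by (simp only: assms(3))
  hence "e = e'" using assms(1,2) by (simp add: lookup_add lookup_xpart)
  thus ?thesis using assms by simp
qed

end

text \<open>The slope \<open>\<alpha> n\<close> is the value of \<open>c\<^sub>n\<^sub>+\<^sub>1\<close>. The recursion makes the values of a residue at consecutive
  levels agree, and so defines a valuation of the whole residue field.\<close>

locale tower_valuation = tower q x u w S for q x u w and S :: "'i::finite set" +
  fixes \<alpha> :: "nat \<Rightarrow> rat"
  assumes \<alpha>_nonzero: "\<alpha> n \<noteq> 0" and \<alpha>_step: "\<alpha> n = min (\<alpha> (Suc n)) (2 * \<alpha> (Suc n))"
begin

text \<open>The choice of the level does not matter, by \<open>v_rep\<close>.\<close>

definition lead :: "'i mpoly \<Rightarrow> nat \<times> nat \<times> 'i mpoly" where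
  "lead f = (SOME p. rep f (fst p) (fst (snd p)) (snd (snd p)))"

definition v :: "'i mpoly \<Rightarrow> lex_vector" where
  "v f = (case lead f of (n, e, h) \<Rightarrow> xpart e + mval (\<alpha> n) (Res h))"

definition vlc :: "'i mpoly \<Rightarrow> int" where
  "vlc f = (case lead f of (n, e, h) \<Rightarrow> mlc (\<alpha> n) (Res h))"

lemma Res_shift_val:
  "Res h \<notin> null q \<Longrightarrow> mval (\<alpha> (n + j)) (Res ((T ^^ j) h)) = mval (\<alpha> n) (Res h) \<and>
     [mlc (\<alpha> (n + j)) (Res ((T ^^ j) h)) = mlc (\<alpha> n) (Res h)] (mod q)"
proof (induction j)
  case (Suc j)
  have "Res ((T ^^ j) h) \<notin> null q" using Suc.prems by (simp add: Res_Tn \<sigma>_null_iff)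
  from \<sigma>_val[OF \<alpha>_nonzero \<alpha>_step this, of "n + j"] Suc show ?case
    by (auto simp: Res_T intro: cong_trans)
qed simp

lemma v_rep:
  assumes "rep f n e h"
  shows "v f = xpart e + mval (\<alpha> n) (Res h)" "[vlc f = mlc (\<alpha> n) (Res h)] (mod q)"
proof -
  obtain n' e' h' where l: "lead f = (n', e', h')" by (cases "lead f") auto
  have "rep f (fst (lead f)) (fst (snd (lead f))) (snd (snd (lead f)))"
    unfolding lead_def by (rule someI[of _ "(n, e, h)"]) (simp add: assms)
  hence r: "rep f n' e' h'" by (simp add: l)
  have 1: "rep f (n + n') e ((T ^^ n') h)" by (rule rep_shift) fact
  have 2: "rep f (n + n') e' ((T ^^ n) h')" using rep_shift[OF r, of n] by (simp add: add.commute)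
  have ee: "e = e'" and hh: "(T ^^ n') h - (T ^^ n) h' \<in> null q" using rep_unique[OF 1 2] .
  interpret A: monomial_valuation q "wt (\<alpha> (n + n'))" by (rule wt_valuation) (rule \<alpha>_nonzero)
  have nh: "Res h \<notin> null q" "Res h' \<notin> null q" using assms r by (auto simp: rep_def)
  have "Res ((T ^^ n') h) \<notin> null q" using 1 by (simp add: rep_def)
  from A.val_cong[OF this, of "Res ((T ^^ n) h')"] null_Res[OF hh]
  have "A.val (Res ((T ^^ n) h')) = A.val (Res ((T ^^ n') h))"
    "[A.lc (Res ((T ^^ n) h')) = A.lc (Res ((T ^^ n') h))] (mod q)" by (auto simp: Res_hom)
  moreover note Res_shift_val[OF nh(1), of n n'] Res_shift_val[OF nh(2), of n' n, unfolded add.commute[of n' n]]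
  ultimately have "mval (\<alpha> n') (Res h') = mval (\<alpha> n) (Res h)" "[mlc (\<alpha> n') (Res h') = mlc (\<alpha> n) (Res h)] (mod q)"
    by (auto intro: cong_trans cong_sym)
  thus "v f = xpart e + mval (\<alpha> n) (Res h)" "[vlc f = mlc (\<alpha> n) (Res h)] (mod q)"
    by (simp_all add: v_def vlc_def l ee)
qed

sublocale V: leading_valuation q "null q" v vlc
proof
  fix a :: "'i mpoly" assume a: "a \<notin> null q"
  then obtain n e h where r: "rep a n e h" using rep_exists by blast
  interpret A: monomial_valuation q "wt (\<alpha> n)" by (rule wt_valuation) (rule \<alpha>_nonzero)
  show "\<not> q dvd vlc a" using v_rep(2)[OF r] A.lc_nonzero[of "Res h"] r cong_dvd_iff unfolding rep_def by blast
next
  fix a b :: "'i mpoly" assume "a \<notin> null q" "b \<notin> null q"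
  then obtain n e h e' h' where r: "rep a n e h" "rep b n e' h'" by (rule rep_common)
  interpret A: monomial_valuation q "wt (\<alpha> n)" by (rule wt_valuation) (rule \<alpha>_nonzero)
  note m = rep_mult[OF r]
  have nh: "Res h \<notin> null q" "Res h' \<notin> null q" using r by (auto simp: rep_def)
  note v = v_rep[OF r(1)] v_rep[OF r(2)] v_rep[OF m]
  show "v (a * b) = v a + v b" using nh
    by (simp add: v Res_hom A.val_mult) (simp add: xpart_def single_add[symmetric] del: single_of_nat add: algebra_simps)
  have "[vlc (a * b) = A.lc (Res h) * A.lc (Res h')] (mod q)"
    using v(6) A.lc_mult[OF nh] by (auto simp: Res_hom intro: cong_trans)
  moreover have "[vlc a * vlc b = A.lc (Res h) * A.lc (Res h')] (mod q)"
    by (intro cong_mult v)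
  ultimately show "[vlc (a * b) = vlc a * vlc b] (mod q)" by (metis cong_sym cong_trans)
next
  fix a b :: "'i mpoly" assume a: "a \<notin> null q" and b: "b \<in> null q \<or> v a < v b"
  show "a + b \<notin> null q \<and> v (a + b) = v a \<and> [vlc (a + b) = vlc a] (mod q)"
  proof (cases "b \<in> null q")
    case True
    obtain n e h where r: "rep a n e h" using rep_exists a by blast
    hence r': "rep (a + b) n e h" by (rule rep_cong) (use True in simp)
    from v_rep[OF r] v_rep[OF r'] show ?thesis
      using M.N_diff[of "a + b" b] True a by (auto intro: cong_trans cong_sym)
  next
    case False
    then obtain n e h e' h' where r: "rep a n e h" "rep b n e' h'" using rep_common a by blast
    interpret A: monomial_valuation q "wt (\<alpha> n)" by (rule wt_valuation) (rule \<alpha>_nonzero)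
    have nh: "Res h \<notin> null q" "Res h' \<notin> null q" using r by (auto simp: rep_def)
    note v = v_rep[OF r(1)] v_rep[OF r(2)]
    have "e < e' \<or> e = e' \<and> A.val (Res h) < A.val (Res h')"
      using b False unfolding v by (simp add: xpart_less lookup_mval_Res nh \<alpha>_nonzero)
    hence "\<exists>H. rep (a + b) n e H \<and> A.val (Res H) = A.val (Res h) \<and> [A.lc (Res H) = A.lc (Res h)] (mod q)"
    proof
      assume "e < e'"
      thus ?thesis using rep_add_less[OF r] by (metis cong_refl)
    next
      assume e: "e = e' \<and> A.val (Res h) < A.val (Res h')"
      hence *: "Res h + Res h' \<notin> null q \<and> A.val (Res h + Res h') = A.val (Res h) \<and>
        [A.lc (Res h + Res h') = A.lc (Res h)] (mod q)" using A.add_less nh by blast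
      hence "rep (a + b) n e (h + h')" using rep_add_eq[of a n e h b h'] r e by simp
      thus ?thesis using * by (intro exI[of _ "h + h'"]) (simp add: Res_hom)
    qed
    then obtain H where H: "rep (a + b) n e H" "A.val (Res H) = A.val (Res h)" "[A.lc (Res H) = A.lc (Res h)] (mod q)"
      by blast
    have "a + b \<notin> null q"
    proof
      assume "a + b \<in> null q"
      hence "(T ^^ n) (a + b) \<in> null q" by (rule null_Tn)
      hence "X ^ e * H \<in> null q" using H(1) null_cong unfolding rep_def by blast
      hence "Res H \<in> null q" unfolding X_cancel_0 by (rule null_Res)
      thus False using H(1) by (simp add: rep_def)
    qed
    thus ?thesis using v_rep[OF H(1)] v H by (auto intro: cong_trans cong_sym)
  qed
next
  fix a b :: "'i mpoly" assume ab: "a \<notin> null q" "b \<notin> null q" "v a = v b"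
  then obtain n e h e' h' where r: "rep a n e h" "rep b n e' h'" using rep_common by blast
  interpret A: monomial_valuation q "wt (\<alpha> n)" by (rule wt_valuation) (rule \<alpha>_nonzero)
  have nh: "Res h \<notin> null q" "Res h' \<notin> null q" using r by (auto simp: rep_def)
  note v = v_rep[OF r(1)] v_rep[OF r(2)]
  have e: "e' = e" "A.val (Res h') = A.val (Res h)"
    using xpart_eq[of "A.val (Res h)" "A.val (Res h')" e e'] ab(3) lookup_mval_Res nh \<alpha>_nonzero
    unfolding v by auto
  have lc: "[vlc a + vlc b = A.lc (Res h) + A.lc (Res h')] (mod q)"
    by (intro cong_add v)
  have notin: "a + b \<notin> null q" if "rep (a + b) n e (h + h')"
  proof
    assume "a + b \<in> null q"
    hence "(T ^^ n) (a + b) \<in> null q" by (rule null_Tn)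
    hence "X ^ e * (h + h') \<in> null q" using that null_cong unfolding rep_def by blast
    hence "Res (h + h') \<in> null q" unfolding X_cancel_0 by (rule null_Res)
    thus False using that by (simp add: rep_def)
  qed
  {
    assume "\<not> q dvd vlc a + vlc b"
    hence "\<not> q dvd A.lc (Res h) + A.lc (Res h')" using lc cong_dvd_iff by blast
    from A.add_eq[OF nh _ this] e have *: "Res h + Res h' \<notin> null q" "A.val (Res h + Res h') = A.val (Res h)"
      "[A.lc (Res h + Res h') = A.lc (Res h) + A.lc (Res h')] (mod q)" by auto
    have r': "rep (a + b) n e (h + h')" using rep_add_eq[of a n e h b h'] r e * by simp
    show "a + b \<notin> null q \<and> v (a + b) = v a \<and> [vlc (a + b) = vlc a + vlc b] (mod q)"
      using notin[OF r'] v_rep[OF r'] v * lc by (auto simp: Res_hom intro: cong_trans cong_sym)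
  next
    assume q: "q dvd vlc a + vlc b"
    have "q dvd A.lc (Res h) + A.lc (Res h')" using q lc cong_dvd_iff by blast
    from A.add_cancel[OF nh _ this] e consider "a + b \<in> null q"
      | "a + b \<notin> null q" "Res h + Res h' \<in> null q"
      | "Res h + Res h' \<notin> null q" "A.val (Res h) < A.val (Res h + Res h')" by auto
    thus "a + b \<in> null q \<or> v a < v (a + b)"
    proof cases
      case 2
      obtain n' e'' H where H: "rep (a + b) n' e'' H" using 2 rep_exists by blast
      from null_cong_add[of "(T ^^ n) a" "X ^ e * h" q "(T ^^ n) b" "X ^ e * h'"] r
      have "(T ^^ n) (a + b) - X ^ e * (h + h') \<in> null q"
        unfolding rep_def by (simp add: e Tn_hom distrib_left)
      from rep_greater[OF this _ H] have "e < e''" using 2 by (simp add: Res_hom)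
      thus ?thesis unfolding v v_rep[OF H]
        using H nh by (subst xpart_less) (auto simp: lookup_mval_Res \<alpha>_nonzero rep_def)
    next
      case 3
      have r': "rep (a + b) n e (h + h')" using rep_add_eq[of a n e h b h'] r e 3 by simp
      show ?thesis unfolding v v_rep[OF r'] using 3 by (simp add: Res_hom)
    qed simp
  }
next
  fix n assume n: "\<not> q dvd n"
  interpret A: monomial_valuation q "wt (\<alpha> 0)" by (rule wt_valuation) (rule \<alpha>_nonzero)
  have r: "rep (of_int n) 0 0 (of_int n)" using n by (simp add: rep_def Res_hom)
  have x0: "xpart 0 = 0" by (simp add: xpart_def)
  show "(of_int n :: 'i mpoly) \<notin> null q \<and> v (of_int n) = 0 \<and> [vlc (of_int n) = n] (mod q)"
    using v_rep[OF r] A.val_of_int[OF n] n by (auto simp: Res_hom x0 intro: cong_trans)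
qed (auto simp: null_add null_mult M.mult_notin char)

end

section \<open>Subrings of the fraction field\<close>

text \<open>Fractions are written as pairs of a numerator and a denominator, and a subring as a set of pairs
  closed under change of representatives. All estimates of degrees take place on such pairs.\<close>

context leading_valuation
begin

definition pair_ring :: "('a \<times> 'a) set \<Rightarrow> bool" where
  "pair_ring R \<longleftrightarrow> (\<forall>a b. (a, b) \<in> R \<longrightarrow> b \<notin> N) \<and> (0, 1) \<in> R \<and>
     (\<forall>a b c d. (a, b) \<in> R \<longrightarrow> (c, d) \<in> R \<longrightarrow> (a * d + b * c, b * d) \<in> R \<and> (a * c, b * d) \<in> R) \<and>
     (\<forall>a b. (a, b) \<in> R \<longrightarrow> (- a, b) \<in> R) \<and>
     (\<forall>a b c d. (a, b) \<in> R \<longrightarrow> d \<notin> N \<longrightarrow> a * d - b * c \<in> N \<longrightarrow> (c, d) \<in> R)"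

lemma pair_ringI:
  assumes "\<And>a b. (a, b) \<in> R \<Longrightarrow> b \<notin> N" "(0, 1) \<in> R"
    "\<And>a b c d. (a, b) \<in> R \<Longrightarrow> (c, d) \<in> R \<Longrightarrow> (a * d + b * c, b * d) \<in> R"
    "\<And>a b c d. (a, b) \<in> R \<Longrightarrow> (c, d) \<in> R \<Longrightarrow> (a * c, b * d) \<in> R"
    "\<And>a b. (a, b) \<in> R \<Longrightarrow> (- a, b) \<in> R"
    "\<And>a b c d. (a, b) \<in> R \<Longrightarrow> d \<notin> N \<Longrightarrow> a * d - b * c \<in> N \<Longrightarrow> (c, d) \<in> R"
  shows "pair_ring R"
  unfolding pair_ring_def
  by (intro conjI allI impI)
    (erule assms(1) | rule assms(2) | erule (1) assms(3) | erule (1) assms(4) | erule assms(5) | erule (2) assms(6))+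

context
  fixes R assumes R: "pair_ring R"
begin

lemma pair_den: "(a, b) \<in> R \<Longrightarrow> b \<notin> N"
  using R unfolding pair_ring_def by blast

lemma pair_cong: "(a, b) \<in> R \<Longrightarrow> d \<notin> N \<Longrightarrow> a * d - b * c \<in> N \<Longrightarrow> (c, d) \<in> R"
  using R unfolding pair_ring_def by blast

lemma pair_zero: "b \<notin> N \<Longrightarrow> (0, b) \<in> R"
proof -
  assume b: "b \<notin> N"
  have "(0, 1) \<in> R" using R unfolding pair_ring_def by blast
  from pair_cong[OF this b, of 0] show ?thesis by (simp add: N_0)
qed

lemma pair_mult: "(a, b) \<in> R \<Longrightarrow> (c, d) \<in> R \<Longrightarrow> (a * c, b * d) \<in> R"
  using R unfolding pair_ring_def by blast

lemma pair_add: "(a, b) \<in> R \<Longrightarrow> (c, b) \<in> R \<Longrightarrow> (a + c, b) \<in> R"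
proof -
  assume *: "(a, b) \<in> R" "(c, b) \<in> R"
  hence "(a * b + b * c, b * b) \<in> R" using R unfolding pair_ring_def by blast
  from pair_cong[OF this pair_den[OF *(1)], of "a + c"] show ?thesis by (simp add: algebra_simps N_0)
qed

lemma pair_neg: "(a, b) \<in> R \<Longrightarrow> (- a, b) \<in> R"
  using R unfolding pair_ring_def by blast

lemma pair_scale: "(a, b) \<in> R \<Longrightarrow> (of_int n * a, b) \<in> R"
proof -
  assume ab: "(a, b) \<in> R"
  have nat: "(of_nat m * a, b) \<in> R" for m
  proof (induction m)
    case 0 thus ?case using pair_zero pair_den[OF ab] by simp
  next
    case (Suc m) thus ?case using pair_add[OF ab Suc] by (simp add: algebra_simps)
  qed
  show ?thesis using nat[of "nat n"] pair_neg[OF nat[of "nat (- n)"]]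
    by (cases "n \<ge> 0") simp_all
qed

lemma pair_sum:
  assumes "b \<notin> N" "\<And>i. i \<in> I \<Longrightarrow> (a i, b) \<in> R"
  shows "(sum a I, b) \<in> R"
  using assms(2)
proof (induction I rule: infinite_finite_induct)
  case (insert i I)
  have "(a i + sum a I, b) \<in> R" by (rule pair_add) (use insert in auto)
  thus ?case using insert.hyps by simp
qed (simp_all add: pair_zero[OF assms(1)])

lemma pair_power_Suc: "(a, b) \<in> R \<Longrightarrow> (a ^ Suc n, b ^ Suc n) \<in> R"
proof (induction n)
  case (Suc n)
  show ?case using pair_mult[OF Suc.prems Suc.IH[OF Suc.prems]] by (simp only: power_Suc)
qed simp

lemma pair_prod:
  assumes "finite I" "I \<noteq> {}" "\<And>i. i \<in> I \<Longrightarrow> (a i, b i) \<in> R"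
  shows "(prod a I, prod b I) \<in> R"
  using assms
proof (induction I rule: finite_ne_induct)
  case (insert i I)
  hence "(a i * prod a I, b i * prod b I) \<in> R" by (intro pair_mult) auto
  thus ?case using insert.hyps by simp
qed simp

text \<open>Since \<open>1\<close> need not be in the subring, only polynomials without constant term can be evaluated.\<close>

lemma pair_polynomial:
  fixes a b :: "nat \<Rightarrow> 'a"
  assumes "\<And>i. i < l \<Longrightarrow> (a i, b i) \<in> R"
    and E: "\<And>e. e \<in> E \<Longrightarrow> (\<exists>i<l. e i > 0) \<and> (\<forall>i<l. e i \<le> B i)"
  shows "(\<Sum>e\<in>E. of_int (c e) * (\<Prod>i<l. a i ^ e i * b i ^ (B i - e i)), \<Prod>i<l. b i ^ B i) \<in> R"
proof (rule pair_sum)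
  show den: "(\<Prod>i<l. b i ^ B i) \<notin> N"
    using assms(1) pair_den by (intro prod_notin power_notin) blast
  fix e assume "e \<in> E"
  note e = E[OF this]
  let ?I = "{i. i < l \<and> e i > 0}"
  have 1: "(\<Prod>i\<in>?I. a i ^ e i, \<Prod>i\<in>?I. b i ^ e i) \<in> R"
  proof (rule pair_prod)
    show "(a i ^ e i, b i ^ e i) \<in> R" if "i \<in> ?I" for i
      using that pair_power_Suc[of "a i" "b i" "e i - 1"] assms(1)[of i] by simp
  qed (use e in auto)
  have 2: "(\<Prod>i\<in>?I. f i ^ e i) = (\<Prod>i<l. f i ^ e i)" for f :: "nat \<Rightarrow> 'a"
    by (rule prod.mono_neutral_left) auto
  have 3: "(\<Prod>i<l. b i ^ B i) = (\<Prod>i<l. b i ^ e i) * (\<Prod>i<l. b i ^ (B i - e i))"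
    unfolding prod.distrib[symmetric] using e by (intro prod.cong) (auto simp flip: power_add)
  have "(\<Prod>i<l. a i ^ e i * b i ^ (B i - e i), \<Prod>i<l. b i ^ B i) \<in> R"
    by (rule pair_cong[OF 1[unfolded 2] den]) (simp add: 3 prod.distrib N_0 mult_ac)
  thus "(of_int (c e) * (\<Prod>i<l. a i ^ e i * b i ^ (B i - e i)), \<Prod>i<l. b i ^ B i) \<in> R"
    by (rule pair_scale)
qed

end

text \<open>Otherwise the term of least value would survive.\<close>

lemma null_combination_repeats_value:
  assumes "finite E" "\<And>e. e \<in> E \<Longrightarrow> f e \<notin> N" "e0 \<in> E" "\<not> q dvd c e0"
    "(\<Sum>e\<in>E. of_int (c e) * f e) \<in> N"
  shows "\<exists>e\<in>E. \<exists>e'\<in>E. e \<noteq> e' \<and> val (f e) = val (f e')"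
  using combination_distinct_values[of E f e0 c] assms unfolding inj_on_def by blast

end

lemma (in monomial_valuation) lm_prod:
  assumes "finite I" "\<And>i. i \<in> I \<Longrightarrow> a i \<notin> null q"
  shows "lm (prod a I) j = (\<Sum>i\<in>I. lm (a i) j)"
  using assms
proof (induction I rule: finite_induct)
  case empty
  have "lm 1 = 0" using mono(2)[OF char_not_dvd_1[OF char], of 0] by simp
  thus ?case by simp
qed (simp add: mult prod_notin)

lemma (in monomial_valuation) lm_power: "a \<notin> null q \<Longrightarrow> lm (a ^ n) j = n * lm a j"
proof (induction n)
  case 0
  have "lm 1 = 0" using mono(2)[OF char_not_dvd_1[OF char], of 0] by simp
  thus ?case by simp
qed (simp add: mult power_notin)

text \<open>The row rank of a matrix is its column rank, in a form that bounds the number of vectors by their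
  values on \<open>h\<close> coordinates. By induction: a pivot \<open>a i0 \<noteq> 0\<close> is used to project the coordinate
  \<open>i0\<close> away, which lowers the rank by one.\<close>

lemma coordinates_of_bounded_rank:
  fixes V :: "('i \<Rightarrow> int) set"
  assumes "\<And>s :: nat \<Rightarrow> 'i \<Rightarrow> int. (\<And>j. j < Suc h \<Longrightarrow> s j \<in> V) \<Longrightarrow>
     \<exists>z. (\<exists>j<Suc h. z j \<noteq> 0) \<and> (\<forall>i. (\<Sum>j<Suc h. z j * s j i) = 0)"
  shows "\<exists>I. finite I \<and> card I \<le> h \<and> (\<forall>a\<in>V. \<forall>b\<in>V. (\<forall>i\<in>I. a i = b i) \<longrightarrow> a = b)"
  using assms
proof (induction h arbitrary: V)
  case 0
  have "a i = 0" if "a \<in> V" for a i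
    using "0.prems"[of "\<lambda>_. a"] that by auto
  hence "a = b" if "a \<in> V" "b \<in> V" for a b using that by (intro ext) (metis that)
  thus ?case by (intro exI[of _ "{}"]) auto
next
  case (Suc h)
  show ?case
  proof (cases "\<exists>a\<in>V. \<exists>i. a i \<noteq> 0")
    case False
    hence "a = b" if "a \<in> V" "b \<in> V" for a b using that by (intro ext) (metis that)
    thus ?thesis by (intro exI[of _ "{}"]) auto
  next
    case True
    then obtain a i0 where a: "a \<in> V" "a i0 \<noteq> 0" by blast
    define p where "p s = (\<lambda>i. a i0 * s i - s i0 * a i)" for s :: "'i \<Rightarrow> int"
    have dependent: "\<exists>z. (\<exists>j<Suc h. z j \<noteq> 0) \<and> (\<forall>i. (\<Sum>j<Suc h. z j * s j i) = 0)"
      if s: "\<And>j. j < Suc h \<Longrightarrow> s j \<in> p ` V" for s :: "nat \<Rightarrow> 'i \<Rightarrow> int"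
    proof -
      have "\<exists>t. \<forall>j<Suc h. t j \<in> V \<and> s j = p (t j)" using s by (intro choice) auto
      then obtain t where t: "\<And>j. j < Suc h \<Longrightarrow> t j \<in> V \<and> s j = p (t j)" by blast
      define t' where "t' j = (if j < Suc h then t j else a)" for j
      have "t' j \<in> V" for j using t a by (auto simp: t'_def)
      from Suc.prems[of t', OF this] obtain z where z: "\<exists>j<Suc (Suc h). z j \<noteq> 0"
        "\<And>i. (\<Sum>j<Suc (Suc h). z j * t' j i) = 0" by blast
      have sum: "(\<Sum>j<Suc h. z j * t j i) = - z (Suc h) * a i" for i
      proof -
        have "(\<Sum>j<Suc (Suc h). z j * t' j i) = (\<Sum>j<Suc h. z j * t' j i) + z (Suc h) * a i"
          by (simp add: t'_def)
        also have "(\<Sum>j<Suc h. z j * t' j i) = (\<Sum>j<Suc h. z j * t j i)"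
          by (intro sum.cong) (auto simp: t'_def)
        finally show ?thesis using z(2)[of i] by simp
      qed
      have "\<exists>j<Suc h. z j \<noteq> 0"
      proof (rule ccontr)
        assume no: "\<not> ?thesis"
        hence "z (Suc h) \<noteq> 0" using z(1) less_antisym by blast
        moreover have "z (Suc h) * a i0 = 0" using sum[of i0] no by simp
        ultimately show False using a(2) by simp
      qed
      moreover have "(\<Sum>j<Suc h. z j * s j i) = 0" for i
      proof -
        have "(\<Sum>j<Suc h. z j * s j i) = (\<Sum>j<Suc h. a i0 * (z j * t j i) - a i * (z j * t j i0))"
          using t by (intro sum.cong) (auto simp: p_def algebra_simps)
        also have "\<dots> = a i0 * (\<Sum>j<Suc h. z j * t j i) - a i * (\<Sum>j<Suc h. z j * t j i0)"
          by (simp only: sum_subtractf sum_distrib_left)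
        finally show ?thesis by (simp only: sum) simp
      qed
      ultimately show ?thesis by blast
    qed
    have "\<exists>I. finite I \<and> card I \<le> h \<and> (\<forall>a\<in>p ` V. \<forall>b\<in>p ` V. (\<forall>i\<in>I. a i = b i) \<longrightarrow> a = b)"
    proof (rule Suc.IH)
      fix s :: "nat \<Rightarrow> 'i \<Rightarrow> int" assume "\<And>j. j < Suc h \<Longrightarrow> s j \<in> p ` V"
      thus "\<exists>z. (\<exists>j<Suc h. z j \<noteq> 0) \<and> (\<forall>i. (\<Sum>j<Suc h. z j * s j i) = 0)" by (rule dependent)
    qed
    then obtain I where I: "finite I" "card I \<le> h"
      "\<forall>a\<in>p ` V. \<forall>b\<in>p ` V. (\<forall>i\<in>I. a i = b i) \<longrightarrow> a = b" by (elim exE conjE)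
    have "b = c" if bc: "b \<in> V" "c \<in> V" "\<forall>i\<in>insert i0 I. b i = c i" for b c
    proof
      fix i
      have "p b = p c" using bc I(3) by (simp add: p_def)
      hence "p b i = p c i" by simp
      thus "b i = c i" using bc(3) a(2) by (simp add: p_def)
    qed
    moreover have "card (insert i0 I) \<le> Suc h" using I(1,2) by (simp add: card_insert_if)
    ultimately show ?thesis using I(1) by (intro exI[of _ "insert i0 I"]) blast
  qed
qed

section \<open>Weak complements and algebraic dependence\<close>

text \<open>The place of \<open>k(c\<^sub>0)\<close> at infinity: the value of \<open>c\<^sub>n\<^sub>+\<^sub>1\<close> is negative and is halved at each level, so
  all powers of \<open>1/2\<close> occur.\<close>

definition inf_slope :: "nat \<Rightarrow> rat" where
  "inf_slope n = - (1 / 2 ^ n)"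

context tower
begin

sublocale I: tower_valuation q x u w S inf_slope
  by unfold_locales (auto simp: inf_slope_def min_def divide_simps)

text \<open>The value at infinity of \<open>X ^ e * z\<^sub>n\<close>: the residue of \<open>z\<^sub>n\<close> is \<open>c\<^sub>n\<close>, which is quadratic in \<open>c\<^sub>n\<^sub>+\<^sub>1\<close>, so its
  order at infinity halves at each step.\<close>

lemma orbit_value:
  assumes "(T ^^ n) Z = X ^ e * U"
  shows "Z \<notin> null q"
    "lookup (I.v Z) k = (if k = 0 then of_nat e else if k = 3 then - 2 / 2 ^ n else 0)"
proof -
  have r: "rep Z n e U" using assms W_poly_val[of 1 1] by (simp add: rep_def Res_mvar)
  have "Z \<in> null q \<Longrightarrow> X ^ e * U \<in> null q" using null_Tn[of Z n] assms by simp
  thus "Z \<notin> null q" by (auto simp: M.mult_in_iff M.power_notin)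
  have I: "min (inf_slope n) (2 * inf_slope n) = - 2 / 2 ^ n"
    by (auto simp: inf_slope_def min_def divide_simps)
  show "lookup (I.v Z) k = (if k = 0 then of_nat e else if k = 3 then - 2 / 2 ^ n else 0)"
    using W_poly_val[OF I.\<alpha>_nonzero[of n] refl] vars_distinct I
    by (auto simp: I.v_rep(1)[OF r] Res_mvar lookup_add lookup_xpart lookup_wt unit_exp_def)
qed

end

context tower_valuation
begin

text \<open>The place of the residue field matters only for the last coordinate.\<close>

lemma lookup_mval_indep:
  assumes "\<gamma> \<noteq> 0" "\<beta> \<noteq> 0" "f \<notin> null q" "j < 3"
  shows "lookup (mval \<gamma> f) j = lookup (mval \<beta> f) j"
proof (rule ccontr)
  interpret A: monomial_valuation q "wt \<gamma>" by (rule wt_valuation) fact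
  interpret B: monomial_valuation q "wt \<beta>" by (rule wt_valuation) fact
  define k where "k = A.lm f"
  define l where "l = B.lm f"
  define d where "d = (LEAST j. lookup (wt \<gamma> k) j \<noteq> lookup (wt \<beta> l) j)"
  have indep: "lookup (wt \<gamma> m) i = lookup (wt \<beta> m) i" if "i < 3" for i m
    using that by (auto simp: lookup_wt)
  assume "lookup (mval \<gamma> f) j \<noteq> lookup (mval \<beta> f) j"
  hence j: "lookup (wt \<gamma> k) j \<noteq> lookup (wt \<beta> l) j" by (simp add: k_def l_def A.val_def B.val_def)
  hence d: "lookup (wt \<gamma> k) d \<noteq> lookup (wt \<beta> l) d" unfolding d_def by (rule LeastI)
  have "d \<le> j" unfolding d_def using j by (rule Least_le)
  hence d3: "d < 3" using assms(4) by simp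
  have below: "lookup (wt \<gamma> k) i = lookup (wt \<beta> l) i" if "i < d" for i
    using that not_less_Least unfolding d_def by blast
  have kl: "k \<in> qkeys q f" "l \<in> qkeys q f" using A.lm(1) B.lm(1) assms by (auto simp: k_def l_def)
  have "\<not> wt \<gamma> l < wt \<gamma> k" using A.lm(2)[OF assms(3) kl(2)] by (simp add: k_def not_less)
  moreover have "\<not> wt \<beta> k < wt \<beta> l" using B.lm(2)[OF assms(3) kl(1)] by (simp add: l_def not_less)
  moreover have "wt \<gamma> l < wt \<gamma> k" if "lookup (wt \<beta> l) d < lookup (wt \<gamma> k) d"
    unfolding lex_less_iff using that below d3 by (intro exI[of _ d]) (simp add: indep)
  moreover have "wt \<beta> k < wt \<beta> l" if "lookup (wt \<gamma> k) d < lookup (wt \<beta> l) d"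
    unfolding lex_less_iff using that below d3 by (intro exI[of _ d]) (simp flip: indep)
  ultimately show False using d by linarith
qed

lemma lookup_v_indep:
  assumes "f \<notin> null q" "j < 3" shows "lookup (v f) j = lookup (I.v f) j"
proof -
  obtain n e h where r: "rep f n e h" using rep_exists assms by blast
  have "lookup (mval (\<alpha> n) (Res h)) j = lookup (mval (inf_slope n) (Res h)) j"
    by (rule lookup_mval_indep) (use r assms \<alpha>_nonzero I.\<alpha>_nonzero in \<open>auto simp: rep_def\<close>)
  thus ?thesis using v_rep(1)[OF r] I.v_rep(1)[OF r] by (simp add: lookup_add)
qed

definition xval :: "'i mpoly \<Rightarrow> rat" where "xval f = lookup (v f) 0"

lemma xval_mult: "a \<notin> null q \<Longrightarrow> b \<notin> null q \<Longrightarrow> xval (a * b) = xval a + xval b"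
  by (simp add: xval_def V.val_mult lookup_add)

lemma xval_rep:
  assumes "rep f n e h" shows "xval f = of_nat e"
  using assms unfolding xval_def v_rep(1)[OF assms]
  by (simp add: lookup_add lookup_xpart lookup_mval_Res \<alpha>_nonzero rep_def)

lemma lex_le_lookup0: "a \<le> b \<Longrightarrow> lookup a 0 \<le> lookup b 0" for a b :: lex_vector
  unfolding le_less lex_less_iff by (metis less_imp_le neq0_conv order_refl)

text \<open>Membership of \<open>a / b\<close> in the coarse valuation ring, with uniformizer \<open>X\<close>.\<close>

definition x_integral :: "'i mpoly \<Rightarrow> 'i mpoly \<Rightarrow> bool" where
  "x_integral a b \<longleftrightarrow> a \<in> null q \<or> xval b \<le> xval a"

lemma x_integral_mult:
  assumes "x_integral a b" "x_integral c d" "b \<notin> null q" "d \<notin> null q"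
  shows "x_integral (a * c) (b * d)"
proof (cases "a \<in> null q \<or> c \<in> null q")
  case False
  thus ?thesis using assms by (simp add: x_integral_def xval_mult add_mono)
qed (auto simp: x_integral_def null_mult null_mult')

lemma x_integral_add:
  assumes "x_integral a b" "x_integral c b" shows "x_integral (a + c) b"
proof (cases "a \<in> null q \<or> c \<in> null q \<or> a + c \<in> null q")
  case True
  moreover have "xval (a + c) = xval c" if "a \<in> null q" "c \<notin> null q"
    using V.add_less[of c a] that by (simp add: xval_def add.commute)
  moreover have "xval (a + c) = xval a" if "c \<in> null q" "a \<notin> null q"
    using V.add_less[of a c] that by (simp add: xval_def)
  ultimately show ?thesis using assms null_add[of a q c] unfolding x_integral_def
    by (cases "a \<in> null q"; cases "c \<in> null q"; simp)
next
  case False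
  hence "v a \<le> v (a + c) \<or> v c \<le> v (a + c)" using V.val_add_ge[of a c] by simp
  hence "xval a \<le> xval (a + c) \<or> xval c \<le> xval (a + c)"
    using lex_le_lookup0[of "v a"] lex_le_lookup0[of "v c"] unfolding xval_def by auto
  thus ?thesis using assms False unfolding x_integral_def by auto
qed

lemma x_integral_cong:
  assumes "x_integral a b" "b \<notin> null q" "d \<notin> null q" "a * d - b * c \<in> null q"
  shows "x_integral c d"
proof (cases "c \<in> null q")
  case False
  hence bc: "b * c \<notin> null q" using assms(2) by (simp add: V.mult_in_iff)
  from V.val_cong[OF this, of "a * d"] assms(4) V.N_diff_commute[of "a * d" "b * c"]
  have "v (a * d) = v (b * c)" "a * d \<notin> null q" by auto
  hence "v a + v d = v b + v c" "a \<notin> null q"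
    using assms(2,3) False by (auto simp: V.mult_in_iff V.val_mult)
  hence "lookup (v a + v d) 0 = lookup (v b + v c) 0" by simp
  hence "xval a + xval d = xval b + xval c" by (simp add: xval_def lookup_add)
  moreover have "xval b \<le> xval a" using assms(1) \<open>a \<notin> null q\<close> by (simp add: x_integral_def)
  ultimately show ?thesis by (simp add: x_integral_def)
qed (simp add: x_integral_def)

lemma x_integral_pair_ring:
  assumes R: "V.pair_ring R"
  shows "V.pair_ring {(a, b). (a, b) \<in> R \<and> x_integral a b}" (is "V.pair_ring ?Q")
proof (rule V.pair_ringI)
  note den = V.pair_den[OF R]
  show "b \<notin> null q" if "(a, b) \<in> ?Q" for a b using that den by auto
  show "(0, 1) \<in> ?Q" using V.pair_zero[OF R V.one_notin] by (simp add: x_integral_def)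
  show "(- a, b) \<in> ?Q" if "(a, b) \<in> ?Q" for a b
    using that V.pair_neg[OF R] V.val_uminus[of a] by (cases "a \<in> null q") (auto simp: x_integral_def xval_def)
  show "(a * c, b * d) \<in> ?Q" if "(a, b) \<in> ?Q" "(c, d) \<in> ?Q" for a b c d
    using that V.pair_mult[OF R, of a b c d] den[of a b] den[of c d] x_integral_mult[of a b c d] by simp
  show "(c, d) \<in> ?Q" if "(a, b) \<in> ?Q" "d \<notin> null q" "a * d - b * c \<in> null q" for a b c d
    using that V.pair_cong[OF R, of a b d c] den[of a b] x_integral_cong[of a b d c] by simp
  show "(a * d + b * c, b * d) \<in> ?Q" if *: "(a, b) \<in> ?Q" "(c, d) \<in> ?Q" for a b c d
  proof -
    have bd: "b \<notin> null q" "d \<notin> null q" using * den by auto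
    have one: "x_integral d d" "x_integral b b" by (simp_all add: x_integral_def)
    have "x_integral a b" "x_integral c d" using * by auto
    from x_integral_add[OF x_integral_mult[OF this(1) one(1) bd] x_integral_mult[OF one(2) this(2) bd]]
    have "x_integral (a * d + b * c) (b * d)" .
    moreover have "(a * d, b * d) \<in> R" "(b * c, b * d) \<in> R"
      using * bd V.pair_cong[OF R, of a b "b * d" "a * d"] V.pair_cong[OF R, of c d "b * d" "b * c"]
      by (simp_all add: V.mult_in_iff mult_ac)
    hence "(a * d + b * c, b * d) \<in> R" by (rule V.pair_add[OF R])
    ultimately show ?thesis by simp
  qed
qed

lemma x_integral_representation:
  assumes "b \<notin> null q" "x_integral a b"
  shows "\<exists>n e a' b'. (T ^^ n) a - X ^ e * a' \<in> null q \<and> rep b n e b'"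
proof (cases "a \<in> null q")
  case True
  obtain n e h where "rep b n e h" using rep_exists assms by blast
  moreover have "(T ^^ n) a - X ^ e * 0 \<in> null q" using null_Tn[OF True] by simp
  ultimately show ?thesis by blast
next
  case False
  then obtain n e h e' h' where r: "rep b n e h" "rep a n e' h'" using rep_common assms(1) by blast
  have "e \<le> e'" using assms(2) False xval_rep[OF r(1)] xval_rep[OF r(2)] by (simp add: x_integral_def)
  hence "X ^ e' * h' = X ^ e * (X ^ (e' - e) * h')" by (simp flip: power_add mult.assoc)
  thus ?thesis using r unfolding rep_def by metis
qed

end

text \<open>A weak complement of a valued fraction field, given by pairs.\<close>

locale pair_complement = tower_valuation q x u w S \<alpha>
  for q x u w and S :: "'i::finite set" and \<alpha> +
  fixes R :: "('i mpoly \<times> 'i mpoly) set"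
  assumes R_ring: "V.pair_ring R"
    and R_val: "(a, b) \<in> R \<Longrightarrow> a \<notin> null q \<Longrightarrow> v a \<le> v b"
    and R_approx: "b \<notin> null q \<Longrightarrow>
      \<exists>c d. (c, d) \<in> R \<and> (a * d - b * c \<in> null q \<or> v (b * d) \<le> v (a * d - b * c))"
begin

text \<open>The elements of the complement on which the residue map modulo \<open>x\<close> is defined.\<close>

definition R0 where "R0 = {(a, b). (a, b) \<in> R \<and> x_integral a b}"

lemma R0_ring: "V.pair_ring R0"
  unfolding R0_def by (rule x_integral_pair_ring) (rule R_ring)

text \<open>The transcendence degree of the coarse residue field.\<close>

abbreviation "h \<equiv> Suc (card S)"

lemma prod_vars_if: "(\<Prod>i\<in>UNIV. if i = x \<or> i = u then 1 else (c :: nat)) = c ^ h"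
proof -
  have "(\<Prod>i\<in>S. if i = x \<or> i = u then 1 else c) = (\<Prod>i\<in>S. c)"
    using vars_distinct by (intro prod.cong) auto
  thus ?thesis unfolding prod_vars using vars_distinct by simp
qed

text \<open>The coarse residue field has transcendence degree \<open>h\<close>. The residue map is injective on \<open>R0\<close>: an
  element with residue zero has positive coarse value, hence positive value, and in a weak
  complement only zero is like that. So a relation between residues lifts to a relation between the
  elements. The relation between residues is found by counting: polynomials in \<open>h\<close> variables have
  fewer monomials than there are products of \<open>h + 1\<close> elements.\<close>

lemma algebraic_dependence:
  assumes R: "\<And>i. i < Suc h \<Longrightarrow> (a i, b i) \<in> R0"
  shows "\<exists>A E c. finite E \<and> E \<subseteq> {..<Suc h} \<rightarrow>\<^sub>E {..A} \<and> (\<exists>e\<in>E. \<not> q dvd c e) \<and>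
    (\<Sum>e\<in>E. of_int (c e) * (\<Prod>i<Suc h. a i ^ e i * b i ^ (A - e i))) \<in> null q"
proof -
  have den: "b i \<notin> null q" if "i < Suc h" for i using V.pair_den[OF R0_ring] R that by blast
  have "\<exists>n e a' b'. (T ^^ n) (a i) - X ^ e * a' \<in> null q \<and> rep (b i) n e b'" if "i < Suc h" for i
    using x_integral_representation den[OF that] R[OF that] by (auto simp: R0_def)
  then obtain n0 e0 f0 g0 where 0: "\<And>i. i < Suc h \<Longrightarrow>
      (T ^^ n0 i) (a i) - X ^ e0 i * f0 i \<in> null q \<and> rep (b i) (n0 i) (e0 i) (g0 i)" by metis
  define n where "n = (\<Sum>i<Suc h. n0 i)"
  define f where "f i = (T ^^ (n - n0 i)) (f0 i)" for i
  define g where "g i = (T ^^ (n - n0 i)) (g0 i)" for i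
  have n: "n0 i + (n - n0 i) = n" if "i < Suc h" for i
    using member_le_sum[of i "{..<Suc h}" n0] that unfolding n_def by simp
  have f: "(T ^^ n) (a i) - X ^ e0 i * f i \<in> null q" if "i < Suc h" for i
  proof -
    from null_Tn[of _ "n - n0 i"] 0[OF that]
    have "(T ^^ (n - n0 i)) ((T ^^ n0 i) (a i) - X ^ e0 i * f0 i) \<in> null q" by blast
    thus ?thesis by (simp add: Tn_hom Tn_mvar funpow_swap n[OF that] f_def)
  qed
  have g: "rep (b i) n (e0 i) (g i)" if "i < Suc h" for i
    using rep_shift[of "b i" "n0 i" "e0 i" "g0 i" "n - n0 i"] 0[OF that] by (simp add: n[OF that] g_def)
  have "\<exists>D. Res (f i) \<in> deg_le D \<and> Res (g i) \<in> deg_le D" for i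
  proof -
    obtain D1 D2 where "Res (f i) \<in> deg_le D1" "Res (g i) \<in> deg_le D2" using deg_le_exists by metis
    thus ?thesis by (intro exI[of _ "max D1 D2"]) (auto intro: deg_le_mono[rotated])
  qed
  then obtain D0 where D0: "\<And>i. Res (f i) \<in> deg_le (D0 i) \<and> Res (g i) \<in> deg_le (D0 i)" by metis
  define D where "D = (\<Sum>i<Suc h. D0 i)"
  have D: "Res (f i) \<in> deg_le D" "Res (g i) \<in> deg_le D" if "i < Suc h" for i
  proof -
    have "D0 i \<le> D" unfolding D_def using that by (intro member_le_sum) auto
    thus "Res (f i) \<in> deg_le D" "Res (g i) \<in> deg_le D" using D0[of i] deg_le_mono by blast+
  qed
  \<comment> \<open>The residues of the products have degree at most \<open>Suc h * A * D\<close>, hence at most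
    \<open>(A - 1) * (A + 1) ^ h\<close> monomials, against \<open>(A + 1) ^ Suc h - 1\<close> products.\<close>
  define A where "A = (Suc h * D + 1) ^ h + 1"
  define z where "z = (\<lambda>i\<in>{..<Suc h}. 0 :: nat)"
  \<comment> \<open>The exponent zero is left out, because \<open>1\<close> need not belong to \<open>R0\<close>.\<close>
  define E where "E = ({..<Suc h} \<rightarrow>\<^sub>E {..A}) - {z}"
  define G where "G e = (\<Prod>i<Suc h. f i ^ e i * g i ^ (A - e i))" for e :: "nat \<Rightarrow> nat"
  define Y where "Y = Suc h * (A * D)"
  have finE: "finite E" unfolding E_def by (intro finite_Diff finite_PiE) auto
  have "z \<in> {..<Suc h} \<rightarrow>\<^sub>E {..A}" by (auto simp: z_def)
  hence card_E: "card E = Suc A ^ Suc h - 1"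
    unfolding E_def by (simp add: card_Diff_singleton card_PiE)
  have eA: "e i \<le> A" if "e \<in> E" "i < Suc h" for e i using that by (auto simp: E_def)
  have ResG: "Res (G e) = (\<Prod>i<Suc h. Res (f i) ^ e i * Res (g i) ^ (A - e i))" for e
    by (simp only: G_def Res_hom)
  have keys: "qkeys q (Res (G e)) \<subseteq> PiE UNIV (\<lambda>i. {..<if i = x \<or> i = u then 1 else Y + 1})"
    if "e \<in> E" for e
  proof -
    have "Res (G e) \<in> deg_le (\<Sum>i<Suc h. A * D)"
      unfolding ResG
    proof (rule deg_le_prod)
      fix i assume i: "i \<in> {..<Suc h}"
      have "Res (f i) ^ e i * Res (g i) ^ (A - e i) \<in> deg_le (e i * D + (A - e i) * D)"
        using i by (intro deg_le_mult deg_le_power D) auto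
      moreover have "e i * D + (A - e i) * D = A * D"
        using eA[OF that, of i] i by (simp flip: add_mult_distrib)
      ultimately show "Res (f i) ^ e i * Res (g i) ^ (A - e i) \<in> deg_le (A * D)" by simp
    qed
    hence "Res (G e) \<in> deg_le Y" by (simp add: Y_def)
    thus ?thesis using qkeys_subset[of q "Res (G e)"] Res_keys[of _ "G e"]
      unfolding deg_le_def by (fastforce simp: mem_box less_Suc_eq_le)
  qed
  have "card (PiE (UNIV :: 'i set) (\<lambda>i. {..<if i = x \<or> i = u then 1 else Y + 1})) = (Y + 1) ^ h"
    unfolding card_box by (rule prod_vars_if)
  also have "\<dots> \<le> ((Suc h * D + 1) * (A + 1)) ^ h"
    unfolding Y_def by (intro power_mono) (auto simp: algebra_simps)
  also have "\<dots> = (A - 1) * (A + 1) ^ h" by (simp only: power_mult_distrib A_def diff_add_inverse2)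
  also have "\<dots> < Suc A ^ Suc h - 1"
  proof -
    obtain B where A: "A = Suc B" unfolding A_def by simp
    have "1 \<le> (A + 1) ^ h" by (rule one_le_power) simp
    thus ?thesis by (simp add: A algebra_simps)
  qed
  also have "\<dots> = card E" using card_E by (rule sym)
  finally have card: "card (PiE (UNIV :: 'i set) (\<lambda>i. {..<if i = x \<or> i = u then 1 else Y + 1})) < card E" .
  have "\<exists>c. (\<exists>e\<in>E. \<not> q dvd c e) \<and> (\<Sum>e\<in>E. of_int (c e) * Res (G e)) \<in> null q"
    by (rule M.more_elements_than_monomials[OF finE _ card keys]) (auto intro!: finite_PiE)
  then obtain c where c: "\<exists>e\<in>E. \<not> q dvd c e" "(\<Sum>e\<in>E. of_int (c e) * Res (G e)) \<in> null q" by blast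
  define F where "F e = (\<Prod>i<Suc h. a i ^ e i * b i ^ (A - e i))" for e :: "nat \<Rightarrow> nat"
  define B where "B = (\<Prod>i<Suc h. b i ^ A)"
  define M where "M = (\<Sum>i<Suc h. e0 i * A)"
  have cong_pow: "(T ^^ n) p - X ^ e * p' \<in> null q \<Longrightarrow> ((T ^^ n) p) ^ m - X ^ (e * m) * p' ^ m \<in> null q"
    for p p' e m
  proof (induction m)
    case (Suc m)
    from null_cong_mult[OF Suc.prems Suc.IH[OF Suc.prems]] show ?case
      by (simp add: power_add mult_ac)
  qed simp
  have cong_prod: "(\<Prod>i<l. (T ^^ n) (p i)) - X ^ (\<Sum>i<l. m i) * (\<Prod>i<l. p' i) \<in> null q"
    if "\<And>i. i < l \<Longrightarrow> (T ^^ n) (p i) - X ^ m i * p' i \<in> null q" for l :: nat and p p' m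
    using that
  proof (induction l)
    case (Suc l)
    from null_cong_mult[OF Suc.IH Suc.prems[of l]] Suc.prems show ?case
      by (simp add: power_add mult_ac)
  qed simp
  have TF: "(T ^^ n) (F e) - X ^ M * G e \<in> null q" if "e \<in> E" for e
    unfolding F_def M_def G_def Tn_hom(9)
  proof (rule cong_prod)
    fix i assume i: "i < Suc h"
    have "(T ^^ n) (a i) ^ e i * (T ^^ n) (b i) ^ (A - e i) -
      (X ^ (e0 i * e i) * f i ^ e i) * (X ^ (e0 i * (A - e i)) * g i ^ (A - e i)) \<in> null q"
      using f[OF i] g[OF i] unfolding rep_def by (intro null_cong_mult cong_pow) auto
    moreover have "X ^ (e0 i * A) = X ^ (e0 i * e i) * X ^ (e0 i * (A - e i))"
      using eA[OF that i] by (simp flip: power_add add_mult_distrib2)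
    ultimately show "(T ^^ n) (a i ^ e i * b i ^ (A - e i)) - X ^ (e0 i * A) * (f i ^ e i * g i ^ (A - e i)) \<in> null q"
      by (simp add: Tn_hom mult_ac)
  qed
  have TB: "rep B n M (\<Prod>i<Suc h. g i ^ A)"
  proof -
    have "(T ^^ n) B - X ^ M * (\<Prod>i<Suc h. g i ^ A) \<in> null q"
      unfolding B_def M_def Tn_hom(9)
    proof (rule cong_prod)
      fix i assume i: "i < Suc h"
      show "(T ^^ n) (b i ^ A) - X ^ (e0 i * A) * g i ^ A \<in> null q"
        using g[OF i] unfolding rep_def Tn_hom(5) by (intro cong_pow) auto
    qed
    moreover have "Res (\<Prod>i<Suc h. g i ^ A) \<notin> null q"
      unfolding Res_hom using g by (intro M.prod_notin M.power_notin) (auto simp: rep_def)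
    ultimately show ?thesis by (simp add: rep_def)
  qed
  define \<Phi> where "\<Phi> = (\<Sum>e\<in>E. of_int (c e) * F e)"
  have "(T ^^ n) \<Phi> - X ^ M * (\<Sum>e\<in>E. of_int (c e) * G e) = (\<Sum>e\<in>E. of_int (c e) * ((T ^^ n) (F e) - X ^ M * G e))"
    by (simp only: \<Phi>_def Tn_hom sum_distrib_left sum_subtractf[symmetric] right_diff_distrib mult.left_commute)
  also have "\<dots> \<in> null q" by (intro null_sum null_mult' TF)
  finally have T\<Phi>: "(T ^^ n) \<Phi> - X ^ M * (\<Sum>e\<in>E. of_int (c e) * G e) \<in> null q" .
  have Res0: "Res (\<Sum>e\<in>E. of_int (c e) * G e) \<in> null q" using c(2) by (simp only: Res_hom)
  have "\<Phi> \<in> null q"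
  proof (rule ccontr)
    assume nn: "\<Phi> \<notin> null q"
    then obtain n' e' H where H: "rep \<Phi> n' e' H" using rep_exists by blast
    have "M < e'" by (rule rep_greater[OF T\<Phi> Res0 H])
    hence "xval B < xval \<Phi>" by (simp add: xval_rep[OF TB] xval_rep[OF H])
    moreover have "(\<Phi>, B) \<in> R0"
      unfolding \<Phi>_def F_def B_def
    proof (rule V.pair_polynomial[OF R0_ring R])
      fix e assume e: "e \<in> E"
      show "(\<exists>i<Suc h. 0 < e i) \<and> (\<forall>i<Suc h. e i \<le> A)"
      proof (rule conjI)
        show "\<exists>i<Suc h. 0 < e i"
        proof (rule ccontr)
          assume "\<not> ?thesis"
          hence "e = z" using e by (intro ext) (auto simp: E_def z_def PiE_def extensional_def)
          thus False using e by (simp add: E_def)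
        qed
      qed (use eA e in blast)
    qed
    hence "v \<Phi> \<le> v B" using R_val nn by (auto simp: R0_def)
    ultimately show False using lex_le_lookup0 unfolding xval_def by fastforce
  qed
  thus ?thesis using finE c(1) unfolding \<Phi>_def F_def E_def by blast
qed

end

section \<open>The degree bound\<close>

context pair_complement
begin

text \<open>The value of \<open>a / b\<close> for the monomial valuation \<open>M\<close>, as a vector of exponents.\<close>

definition lm_diff :: "'i mpoly \<Rightarrow> 'i mpoly \<Rightarrow> 'i \<Rightarrow> int" where
  "lm_diff a b = (\<lambda>i. int (mlm a i) - int (mlm b i))"

definition lm_diffs :: "('i \<Rightarrow> int) set" where
  "lm_diffs = {lm_diff a b | a b. (a, b) \<in> R0 \<and> a \<notin> null q}"

text \<open>The rational rank of the value group is at most the transcendence degree.\<close>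

lemma lm_diffs_dependent:
  assumes s: "\<And>j. j < Suc h \<Longrightarrow> s j \<in> lm_diffs"
  shows "\<exists>z. (\<exists>j<Suc h. z j \<noteq> 0) \<and> (\<forall>i. (\<Sum>j<Suc h. z j * s j i) = 0)"
proof -
  have "\<forall>j\<in>{..<Suc h}. \<exists>p. p \<in> R0 \<and> fst p \<notin> null q \<and> s j = lm_diff (fst p) (snd p)"
  proof
    fix j assume "j \<in> {..<Suc h}"
    hence "s j \<in> lm_diffs" using s by simp
    then obtain a b where "(a, b) \<in> R0" "a \<notin> null q" "s j = lm_diff a b" by (auto simp: lm_diffs_def)
    thus "\<exists>p. p \<in> R0 \<and> fst p \<notin> null q \<and> s j = lm_diff (fst p) (snd p)" by (intro exI[of _ "(a, b)"]) simp
  qed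
  from bchoice[OF this] obtain p where p: "\<forall>j\<in>{..<Suc h}. p j \<in> R0 \<and> fst (p j) \<notin> null q \<and>
    s j = lm_diff (fst (p j)) (snd (p j))" by (elim exE)
  define a where "a j = fst (p j)" for j
  define b where "b j = snd (p j)" for j
  have ab: "(a j, b j) \<in> R0 \<and> a j \<notin> null q \<and> s j = lm_diff (a j) (b j)" if "j < Suc h" for j
    using p that by (simp add: a_def b_def)
  have den: "b j \<notin> null q" if "j < Suc h" for j using ab[OF that] V.pair_den[OF R0_ring] by blast
  have "\<exists>A E c. finite E \<and> E \<subseteq> {..<Suc h} \<rightarrow>\<^sub>E {..A} \<and> (\<exists>e\<in>E. \<not> q dvd c e) \<and>
    (\<Sum>e\<in>E. of_int (c e) * (\<Prod>i<Suc h. a i ^ e i * b i ^ (A - e i))) \<in> null q"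
    by (rule algebraic_dependence) (use ab in blast)
  then obtain A E c where E: "finite E" "E \<subseteq> {..<Suc h} \<rightarrow>\<^sub>E {..A}" "\<exists>e\<in>E. \<not> q dvd c e"
    "(\<Sum>e\<in>E. of_int (c e) * (\<Prod>i<Suc h. a i ^ e i * b i ^ (A - e i))) \<in> null q"
    by (elim exE conjE)
  define F where "F e = (\<Prod>i<Suc h. a i ^ e i * b i ^ (A - e i))" for e :: "nat \<Rightarrow> nat"
  have F: "F e \<notin> null q" for e
    unfolding F_def by (intro M.prod_notin) (use ab den in \<open>auto simp: M.mult_in_iff M.power_notin\<close>)
  obtain e0 where e0: "e0 \<in> E" "\<not> q dvd c e0" using E(3) by blast
  from M.null_combination_repeats_value[OF E(1) F e0 E(4)[folded F_def]]
  obtain e e' where e: "e \<in> E" "e' \<in> E" "e \<noteq> e'" "M.val (F e) = M.val (F e')" by blast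
  have "mlm (F e) = mlm (F e')" using e(4) M.wt_inj by (simp add: M.val_def)
  have lmF: "int (mlm (F e) i) = (\<Sum>j<Suc h. int (e j) * s j i) + (\<Sum>j<Suc h. int A * int (mlm (b j) i))"
    if "e \<in> E" for e i
  proof -
    have "int (mlm (F e) i) = (\<Sum>j<Suc h. int (mlm (a j ^ e j * b j ^ (A - e j)) i))"
      unfolding F_def
      by (subst M.lm_prod) (use ab den in \<open>auto simp: M.mult_in_iff M.power_notin simp del: prod.lessThan_Suc sum.lessThan_Suc\<close>)
    also have "\<dots> = (\<Sum>j<Suc h. int (e j) * s j i + int A * int (mlm (b j) i))"
    proof (intro sum.cong refl)
      fix j assume "j \<in> {..<Suc h}"
      hence j: "j < Suc h" by simp
      have "e \<in> {..<Suc h} \<rightarrow>\<^sub>E {..A}" using that E(2) by blast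
      hence "e j \<le> A" using j by (auto dest: PiE_mem)
      hence "int (mlm (a j ^ e j * b j ^ (A - e j)) i) = int (e j) * int (mlm (a j) i) + (int A - int (e j)) * int (mlm (b j) i)"
        using ab[OF j] den[OF j] by (simp add: M.mult M.power_notin M.lm_power of_nat_diff)
      thus "int (mlm (a j ^ e j * b j ^ (A - e j)) i) = int (e j) * s j i + int A * int (mlm (b j) i)"
        using ab[OF j] by (simp add: lm_diff_def algebra_simps)
    qed
    finally show ?thesis by (simp add: sum.distrib del: sum.lessThan_Suc)
  qed
  define z where "z j = int (e j) - int (e' j)" for j
  have "(\<Sum>j<Suc h. z j * s j i) = 0" for i
  proof -
    have "(\<Sum>j<Suc h. int (e j) * s j i) = (\<Sum>j<Suc h. int (e' j) * s j i)"
      using lmF[OF e(1), of i] lmF[OF e(2), of i] \<open>mlm (F e) = mlm (F e')\<close> by simp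
    thus ?thesis by (simp add: z_def left_diff_distrib sum_subtractf del: sum.lessThan_Suc)
  qed
  moreover have "\<exists>j<Suc h. z j \<noteq> 0"
  proof (rule ccontr)
    assume "\<not> ?thesis"
    hence "e j = e' j" if "j < Suc h" for j using that by (auto simp: z_def)
    moreover have "e \<in> {..<Suc h} \<rightarrow>\<^sub>E {..A}" "e' \<in> {..<Suc h} \<rightarrow>\<^sub>E {..A}" using e E(2) by blast+
    ultimately have "e = e'" by (intro PiE_ext) auto
    thus False using e(3) by simp
  qed
  ultimately show ?thesis by blast
qed

text \<open>Let \<open>L\<close> be the field generated by \<open>R0\<close>. It has transcendence degree at most \<open>h\<close> and sits in a
  finitely generated field, so it has finite degree over the subfield generated by \<open>h\<close> independent
  elements \<open>a j / b j\<close>. The hypothesis \<open>independent\<close> makes the powers of \<open>p n / r n\<close> below \<open>2 ^ n\<close>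
  independent over this subfield, which contradicts a bound on the degree for large \<open>n\<close>.

  The bound comes from leading monomials: those of the polynomials of degree at most \<open>Y\<close> that are
  numerators of elements of \<open>R0\<close> with a fixed denominator are determined by \<open>h\<close> of their
  coordinates, so there are at most \<open>(Y + 1) ^ h\<close> of them.\<close>

lemma bounded_degree:
  assumes ab: "\<And>j. j < h \<Longrightarrow> (a j, b j) \<in> R0 \<and> a j \<notin> null q"
    and pr: "\<And>n. (p n, r n) \<in> R0 \<and> p n \<notin> null q"
    and independent: "\<And>n e e'. e h < 2 ^ n \<Longrightarrow> e' h < 2 ^ n \<Longrightarrow>
      (\<And>k. (\<Sum>j<h. of_nat (e j) * (lookup (I.v (a j)) k - lookup (I.v (b j)) k))
            + of_nat (e h) * (lookup (I.v (p n)) k - lookup (I.v (r n)) k) =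
          (\<Sum>j<h. of_nat (e' j) * (lookup (I.v (a j)) k - lookup (I.v (b j)) k))
            + of_nat (e' h) * (lookup (I.v (p n)) k - lookup (I.v (r n)) k)) \<Longrightarrow>
      \<forall>j<Suc h. e j = e' j"
  shows False
proof -
  have "\<exists>D. a j \<in> deg_le D \<and> b j \<in> deg_le D" for j
  proof -
    obtain D1 D2 where "a j \<in> deg_le D1" "b j \<in> deg_le D2" using deg_le_exists by metis
    thus ?thesis by (intro exI[of _ "max D1 D2"]) (auto intro: deg_le_mono[rotated])
  qed
  then obtain D0 where D0: "\<And>i. a i \<in> deg_le (D0 i) \<and> b i \<in> deg_le (D0 i)" by metis
  define D where "D = (\<Sum>i<h. D0 i)"
  \<comment> \<open>\<open>D\<close> depends on the \<open>h\<close> fixed elements only; so \<open>n\<close> can be chosen before \<open>p n\<close> and its degree \<open>D'\<close>.\<close>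
  define n where "n = (h * D + 1) ^ h + 2"
  define N :: nat where "N = 2 ^ n"
  have N: "(h * D + 1) ^ h + 2 < N" unfolding N_def n_def[symmetric] by (rule less_exp)
  define a' where "a' = a(h := p n)"
  define b' where "b' = b(h := r n)"
  have ab': "(a' j, b' j) \<in> R0" "a' j \<notin> null q" if "j < Suc h" for j
    using ab[of j] pr[of n] that by (auto simp: a'_def b'_def less_Suc_eq)
  have den: "b' j \<notin> null q" if "j < Suc h" for j using ab'(1)[OF that] V.pair_den[OF R0_ring] by blast
  obtain D' where D': "p n \<in> deg_le D'" "r n \<in> deg_le D'"
  proof -
    obtain D1 D2 where "p n \<in> deg_le D1" "r n \<in> deg_le D2" using deg_le_exists by metis
    thus thesis by (intro that[of "max D1 D2"]) (auto intro: deg_le_mono[rotated])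
  qed
  \<comment> \<open>Large enough for the degree \<open>N * D'\<close> of the powers of \<open>p n\<close> to be negligible: \<open>Y + 1 = (h * D + 1) * A\<close>.\<close>
  define A where "A = N * D' + 1"
  define B where "B j = (if j = h then N else A)" for j
  define d where "d j = (if j = h then D' else D)" for j
  define z where "z = (\<lambda>j\<in>{..<Suc h}. 0 :: nat)"
  define E where "E = PiE {..<Suc h} (\<lambda>j. {..<B j}) - {z}"
  define F where "F e = (\<Prod>j<Suc h. a' j ^ e j * b' j ^ (B j - e j))" for e :: "nat \<Rightarrow> nat"
  define Q where "Q = (\<Prod>j<Suc h. b' j ^ B j)"
  define comb where "comb c = (\<Sum>e\<in>E. of_int (c e) * F e)" for c :: "(nat \<Rightarrow> nat) \<Rightarrow> int"
  define Y where "Y = h * A * D + N * D'"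
  have deg: "a' j \<in> deg_le (d j)" "b' j \<in> deg_le (d j)" if "j < Suc h" for j
  proof -
    have "D0 j \<le> D" if "j < h" unfolding D_def using that by (intro member_le_sum) auto
    thus "a' j \<in> deg_le (d j)" "b' j \<in> deg_le (d j)"
      using D0[of j] D' deg_le_mono that by (auto simp: a'_def b'_def d_def less_Suc_eq)
  qed
  have finE: "finite E" unfolding E_def by (intro finite_Diff finite_PiE) auto
  have eB: "e j < B j" if "e \<in> E" "j < Suc h" for e j using that by (auto simp: E_def dest: PiE_mem)
  have "N > 0" by (simp add: N_def)
  hence "z \<in> PiE {..<Suc h} (\<lambda>j. {..<B j})" by (auto simp: z_def B_def A_def)
  hence "card E = (\<Prod>j<Suc h. B j) - 1" unfolding E_def by (simp only: card_Diff_singleton card_PiE finite_lessThan card_lessThan)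
  also have "(\<Prod>j<Suc h. B j) = A ^ h * N"
  proof -
    have "(\<Prod>j<h. B j) = (\<Prod>j<h. A)" by (intro prod.cong) (auto simp: B_def)
    thus ?thesis by (subst prod.lessThan_Suc) (simp add: B_def)
  qed
  finally have card_E: "card E = A ^ h * N - 1" .
  have F_deg: "F e \<in> deg_le Y" if "e \<in> E" for e
  proof -
    have "F e \<in> deg_le (\<Sum>j<Suc h. B j * d j)"
      unfolding F_def
    proof (rule deg_le_prod)
      fix j assume j: "j \<in> {..<Suc h}"
      have "a' j ^ e j * b' j ^ (B j - e j) \<in> deg_le (e j * d j + (B j - e j) * d j)"
        using j by (intro deg_le_mult deg_le_power deg) auto
      moreover have "e j * d j + (B j - e j) * d j = B j * d j"
        using eB[OF that, of j] j by (simp flip: add_mult_distrib)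
      ultimately show "a' j ^ e j * b' j ^ (B j - e j) \<in> deg_le (B j * d j)" by simp
    qed
    moreover have "(\<Sum>j<h. B j * d j) = (\<Sum>j<h. A * D)"
      by (intro sum.cong) (auto simp: B_def d_def)
    hence "(\<Sum>j<Suc h. B j * d j) = Y" by (subst sum.lessThan_Suc) (simp add: Y_def B_def d_def algebra_simps)
    ultimately show ?thesis by simp
  qed
  have comb_deg: "comb c \<in> deg_le Y" for c
    unfolding comb_def using deg_le_mult[OF deg_le_of_int[of _ 0] F_deg] by (intro deg_le_sum) simp
  have comb_R0: "(comb c, Q) \<in> R0" for c
    unfolding comb_def F_def Q_def
  proof (rule V.pair_polynomial[OF R0_ring ab'(1)])
    fix e assume e: "e \<in> E"
    show "(\<exists>i<Suc h. 0 < e i) \<and> (\<forall>i<Suc h. e i \<le> B i)"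
    proof (rule conjI)
      show "\<exists>i<Suc h. 0 < e i"
      proof (rule ccontr)
        assume "\<not> ?thesis"
        hence "e = z" using e by (intro ext) (auto simp: E_def z_def PiE_def extensional_def)
        thus False using e by (simp add: E_def)
      qed
    qed (use eB[OF e] less_imp_le in blast)
  qed
  have "\<exists>J. finite J \<and> card J \<le> h \<and> (\<forall>a\<in>lm_diffs. \<forall>b\<in>lm_diffs. (\<forall>i\<in>J. a i = b i) \<longrightarrow> a = b)"
    by (rule coordinates_of_bounded_rank) (rule lm_diffs_dependent)
  then obtain J where J: "finite J" "card J \<le> h"
    "\<forall>a\<in>lm_diffs. \<forall>b\<in>lm_diffs. (\<forall>i\<in>J. a i = b i) \<longrightarrow> a = b" by (elim exE conjE)
  define L where "L = {mlm (comb c) | c. comb c \<notin> null q}"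
  have L_le: "k i \<le> Y" if "k \<in> L" for k i
  proof -
    obtain c where c: "k = mlm (comb c)" "comb c \<notin> null q" using \<open>k \<in> L\<close> by (auto simp: L_def)
    hence "k \<in> keys (comb c)" using M.lm(1)[OF c(2)] qkeys_subset by blast
    thus ?thesis using comb_deg[of c] by (simp add: deg_le_def)
  qed
  have inj: "inj_on (\<lambda>k. restrict k J) L"
  proof (rule inj_onI)
    fix k l assume kl: "k \<in> L" "l \<in> L" "restrict k J = restrict l J"
    then obtain c c' where c: "k = mlm (comb c)" "comb c \<notin> null q" "l = mlm (comb c')" "comb c' \<notin> null q"
      by (auto simp: L_def)
    have "lm_diff (comb c) Q \<in> lm_diffs" "lm_diff (comb c') Q \<in> lm_diffs"
      using comb_R0 c unfolding lm_diffs_def by blast+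
    moreover have "\<forall>i\<in>J. lm_diff (comb c) Q i = lm_diff (comb c') Q i"
      using kl(3) c by (simp add: lm_diff_def) (metis restrict_apply')
    ultimately have "lm_diff (comb c) Q = lm_diff (comb c') Q" using J(3) by blast
    hence "int (k i) = int (l i)" for i using c by (simp add: lm_diff_def fun_eq_iff)
    thus "k = l" by (intro ext) simp
  qed
  have sub: "(\<lambda>k. restrict k J) ` L \<subseteq> PiE J (\<lambda>_. {..Y})" using L_le by auto
  have finP: "finite (PiE J (\<lambda>_. {..Y}))" using J(1) by (intro finite_PiE) auto
  have finL: "finite L" by (rule finite_imageD[OF finite_subset[OF sub finP] inj])
  have "card L \<le> card (PiE J (\<lambda>_. {..Y}))" by (rule card_inj_on_le[OF inj sub finP])
  also have "card (PiE J (\<lambda>_. {..Y})) = (Y + 1) ^ card J" using J(1) by (simp add: card_PiE)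
  also have "\<dots> \<le> (Y + 1) ^ h" using J(2) by (intro power_increasing) auto
  also have "Y + 1 = (h * D + 1) * A" by (simp add: Y_def A_def algebra_simps)
  also have "((h * D + 1) * A) ^ h = (h * D + 1) ^ h * A ^ h" by (rule power_mult_distrib)
  also have "\<dots> < A ^ h * N - 1"
  proof -
    have "1 \<le> A ^ h" unfolding A_def by (rule one_le_power) simp
    have "((h * D + 1) ^ h + 2) * A ^ h \<le> N * A ^ h" using N by (intro mult_right_mono) auto
    hence "(h * D + 1) ^ h * A ^ h + 2 * A ^ h \<le> A ^ h * N" by (simp only: add_mult_distrib mult.commute[of N])
    thus ?thesis using \<open>1 \<le> A ^ h\<close> by linarith
  qed
  finally have card: "card L < card E" by (simp only: card_E)
  have "\<exists>c. (\<exists>e\<in>E. \<not> q dvd c e) \<and> (\<Sum>e\<in>E. of_int (c e) * F e) \<in> null q"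
    by (rule M.more_elements_than_leading_monomials[OF finE finL card])
      (auto simp: L_def comb_def[symmetric])
  then obtain c e0 where c: "e0 \<in> E" "\<not> q dvd c e0" "(\<Sum>e\<in>E. of_int (c e) * F e) \<in> null q" by blast
  have F: "F e \<notin> null q" for e
    unfolding F_def by (intro M.prod_notin) (use ab' den in \<open>auto simp: M.mult_in_iff M.power_notin\<close>)
  from I.V.null_combination_repeats_value[OF finE F c]
  obtain e e' where e: "e \<in> E" "e' \<in> E" "e \<noteq> e'" "I.v (F e) = I.v (F e')" by blast
  have lpow: "lookup (I.v (f ^ m)) k = of_nat m * lookup (I.v f) k" if "f \<notin> null q" for f m k
    using that by (induction m) (simp_all add: I.V.val_power_Suc lookup_add algebra_simps del: power_Suc)
  have lookup_F: "lookup (I.v (F e)) k = (\<Sum>j<h. of_nat (e j) * (lookup (I.v (a j)) k - lookup (I.v (b j)) k))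
      + of_nat (e h) * (lookup (I.v (p n)) k - lookup (I.v (r n)) k) + (\<Sum>j<Suc h. of_nat (B j) * lookup (I.v (b' j)) k)"
    if "e \<in> E" for e k
  proof -
    have "lookup (I.v (F e)) k = (\<Sum>j<Suc h. lookup (I.v (a' j ^ e j * b' j ^ (B j - e j))) k)"
      unfolding F_def using ab' den
      by (subst I.V.val_prod) (auto simp: M.mult_in_iff M.power_notin lookup_sum simp del: sum.lessThan_Suc)
    also have "\<dots> = (\<Sum>j<Suc h. of_nat (e j) * (lookup (I.v (a' j)) k - lookup (I.v (b' j)) k) + of_nat (B j) * lookup (I.v (b' j)) k)"
    proof (intro sum.cong refl)
      fix j assume "j \<in> {..<Suc h}"
      hence j: "j < Suc h" by simp
      have "e j \<le> B j" using eB[OF that j] by simp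
      hence "lookup (I.v (a' j ^ e j * b' j ^ (B j - e j))) k =
        of_nat (e j) * lookup (I.v (a' j)) k + (of_nat (B j) - of_nat (e j)) * lookup (I.v (b' j)) k"
        using ab'(2)[OF j] den[OF j] by (simp add: I.V.val_mult M.power_notin lookup_add lpow of_nat_diff)
      thus "lookup (I.v (a' j ^ e j * b' j ^ (B j - e j))) k =
        of_nat (e j) * (lookup (I.v (a' j)) k - lookup (I.v (b' j)) k) + of_nat (B j) * lookup (I.v (b' j)) k"
        by (simp add: algebra_simps)
    qed
    also have "\<dots> = (\<Sum>j<Suc h. of_nat (e j) * (lookup (I.v (a' j)) k - lookup (I.v (b' j)) k)) + (\<Sum>j<Suc h. of_nat (B j) * lookup (I.v (b' j)) k)"
      by (rule sum.distrib)
    also have "(\<Sum>j<Suc h. of_nat (e j) * (lookup (I.v (a' j)) k - lookup (I.v (b' j)) k)) =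
      (\<Sum>j<h. of_nat (e j) * (lookup (I.v (a' j)) k - lookup (I.v (b' j)) k)) + of_nat (e h) * (lookup (I.v (p n)) k - lookup (I.v (r n)) k)"
      by (subst sum.lessThan_Suc) (simp add: a'_def b'_def)
    also have "(\<Sum>j<h. of_nat (e j) * (lookup (I.v (a' j)) k - lookup (I.v (b' j)) k)) =
      (\<Sum>j<h. of_nat (e j) * (lookup (I.v (a j)) k - lookup (I.v (b j)) k))"
      by (intro sum.cong) (auto simp: a'_def b'_def)
    finally show ?thesis .
  qed
  have "\<forall>j<Suc h. e j = e' j"
  proof (rule independent)
    show "e h < 2 ^ n" "e' h < 2 ^ n" using eB[OF e(1), of h] eB[OF e(2), of h] by (auto simp: B_def N_def)
    show "(\<Sum>j<h. of_nat (e j) * (lookup (I.v (a j)) k - lookup (I.v (b j)) k))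
            + of_nat (e h) * (lookup (I.v (p n)) k - lookup (I.v (r n)) k) =
          (\<Sum>j<h. of_nat (e' j) * (lookup (I.v (a j)) k - lookup (I.v (b j)) k))
            + of_nat (e' h) * (lookup (I.v (p n)) k - lookup (I.v (r n)) k)" for k
    proof -
      have "lookup (I.v (F e)) k = lookup (I.v (F e')) k" by (simp only: e(4))
      thus ?thesis unfolding lookup_F[OF e(1)] lookup_F[OF e(2)] by (simp only: add_right_cancel)
    qed
  qed
  hence "e = e'" using e(1,2) unfolding E_def
    by (intro PiE_ext[of e "{..<Suc h}" "\<lambda>j. {..<B j}" e']) auto
  thus False using e(3) by simp
qed

end

section \<open>Valuations without weak complement\<close>

context tower_valuation
begin

lemma v_X_power: "X ^ e \<notin> null q" "v (X ^ e) = xpart e"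
proof -
  have r: "rep (X ^ e) 0 e 1" by (simp add: rep_def Res_hom)
  interpret A: monomial_valuation q "wt (\<alpha> 0)" by (rule wt_valuation) (rule \<alpha>_nonzero)
  show "v (X ^ e) = xpart e" using v_rep(1)[OF r] by (simp add: Res_hom A.val_1)
  show "X ^ e \<notin> null q" by (simp add: M.power_notin)
qed

lemma v_S_var:
  assumes "s \<in> S" shows "lookup (v (mvar s)) k = (if k = 2 then 1 else 0)"
proof -
  have S: "S = {s}" using assms by (cases rule: S_cases) auto
  have r: "rep (mvar s) 0 0 (mvar s)" using assms by (simp add: rep_def Res_mvar)
  interpret A: monomial_valuation q "wt (\<alpha> 0)" by (rule wt_valuation) (rule \<alpha>_nonzero)
  have 1: "(\<Sum>i\<in>S. unit_exp s i) = 1" by (simp add: S unit_exp_def)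
  have "s \<noteq> x" "s \<noteq> u" "s \<noteq> w" using assms vars_distinct by auto
  hence 2: "unit_exp s x = 0" "unit_exp s u = 0" "unit_exp s w = 0" by (simp_all add: unit_exp_def)
  show ?thesis unfolding v_rep(1)[OF r]
    using assms by (simp add: Res_mvar A.val_mvar lookup_add lookup_xpart lookup_wt 1 2 del: of_nat_sum)
qed

end

context pair_complement
begin

text \<open>The approximation \<open>c / d\<close> of \<open>a / b\<close> in the complement is close for \<open>v\<close>. If every \<open>v\<close>-integral element
  has larger value at infinity than \<open>a / b\<close>, then \<open>c / d\<close> and \<open>a / b\<close> have the same value at infinity.\<close>

lemma R0_approximation:
  assumes ab: "a \<notin> null q" "b \<notin> null q" "lookup (I.v a) 0 = lookup (I.v b) 0"
    and dominates: "\<And>f d. f \<notin> null q \<Longrightarrow> d \<notin> null q \<Longrightarrow> v (b * d) \<le> v f \<Longrightarrow> I.v (a * d) < I.v f"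
  shows "\<exists>c d. (c, d) \<in> R0 \<and> c \<notin> null q \<and>
    (\<forall>k. lookup (I.v c) k - lookup (I.v d) k = lookup (I.v a) k - lookup (I.v b) k)"
proof -
  obtain c d where cd: "(c, d) \<in> R" "a * d - b * c \<in> null q \<or> v (b * d) \<le> v (a * d - b * c)"
    using R_approx[OF ab(2), of a] by blast
  have d: "d \<notin> null q" using V.pair_den[OF R_ring cd(1)] .
  have ad: "a * d \<notin> null q" using ab(1) d by (simp add: M.mult_in_iff)
  define f where "f = a * d - b * c"
  have "b * c \<notin> null q \<and> I.v (b * c) = I.v (a * d)"
  proof (cases "f \<in> null q")
    case True
    thus ?thesis using I.V.val_cong[OF ad, of "b * c"] by (simp add: f_def)
  next
    case False
    hence "I.v (a * d) < I.v f" using dominates[OF False d] cd(2) by (simp add: f_def)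
    hence "I.v (a * d) < I.v (- f)" using I.V.val_uminus[OF False] by simp
    from I.V.add_less[OF ad disjI2[OF this]] show ?thesis by (simp add: f_def)
  qed
  hence c: "c \<notin> null q" "I.v b + I.v c = I.v a + I.v d"
    using ab d by (auto simp: M.mult_in_iff I.V.val_mult)
  have eq: "lookup (I.v c) k - lookup (I.v d) k = lookup (I.v a) k - lookup (I.v b) k" for k
  proof -
    have "lookup (I.v b + I.v c) k = lookup (I.v a + I.v d) k" by (simp only: c(2))
    thus ?thesis unfolding lookup_add by linarith
  qed
  have "xval d = xval c" using eq[of 0] ab(3) lookup_v_indep[of c 0] lookup_v_indep[of d 0] c d
    by (simp add: xval_def)
  hence "(c, d) \<in> R0" using cd(1) by (simp add: R0_def x_integral_def)
  thus ?thesis using c(1) eq by blast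
qed

end

text \<open>Here \<open>z\<^sub>n\<close> has negative value, so the complement has elements of the same value as \<open>z\<^sub>n\<close>. By these
  values they have degree at least \<open>2 ^ n\<close> over the field generated by the one for \<open>n = 0\<close>.\<close>

theorem (in tower) no_pair_complement_at_infinity:
  assumes S: "S = {}"
  shows "\<not> pair_complement q x u w S inf_slope R"
proof
  assume "pair_complement q x u w S inf_slope R"
  then interpret C: pair_complement q x u w S inf_slope R .
  have approx: "\<exists>c d. (c, d) \<in> C.R0 \<and> c \<notin> null q \<and>
    (\<forall>k. lookup (I.v c) k - lookup (I.v d) k = (if k = 3 then - 2 / 2 ^ n else 0))" for n
  proof -
    obtain Z e where Z: "(T ^^ n) Z = X ^ e * U" using orbit_exists[of n] by blast
    note z = orbit_value[OF Z]
    have less: "I.v Z < I.v (X ^ e)"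
      unfolding lex_less_iff by (intro exI[of _ 3]) (auto simp: z I.v_X_power lookup_xpart)
    have "\<exists>c d. (c, d) \<in> C.R0 \<and> c \<notin> null q \<and>
      (\<forall>k. lookup (I.v c) k - lookup (I.v d) k = lookup (I.v Z) k - lookup (I.v (X ^ e)) k)"
    proof (rule C.R0_approximation)
      fix f d assume "f \<notin> null q" "d \<notin> null q" "I.v (X ^ e * d) \<le> I.v f"
      moreover from this have "I.v (Z * d) < I.v (X ^ e * d)"
        using less z(1) I.v_X_power(1) by (simp add: I.V.val_mult)
      ultimately show "I.v (Z * d) < I.v f" by simp
    qed (simp_all add: z I.v_X_power lookup_xpart)
    moreover have "lookup (I.v Z) k - lookup (I.v (X ^ e)) k = (if k = 3 then - 2 / 2 ^ n else 0)" for k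
      by (simp add: z I.v_X_power lookup_xpart)
    ultimately show ?thesis by simp
  qed
  obtain a0 b0 where 0: "(a0, b0) \<in> C.R0 \<and> a0 \<notin> null q \<and>
    (\<forall>k. lookup (I.v a0) k - lookup (I.v b0) k = (if k = 3 then - 2 / 2 ^ 0 else 0))"
    using approx[of 0] by blast
  have "\<exists>p r. \<forall>n. (p n, r n) \<in> C.R0 \<and> p n \<notin> null q \<and>
    (\<forall>k. lookup (I.v (p n)) k - lookup (I.v (r n)) k = (if k = 3 then - 2 / 2 ^ n else 0))"
    using approx by metis
  then obtain p r where pr: "\<And>n. (p n, r n) \<in> C.R0 \<and> p n \<notin> null q \<and>
    (\<forall>k. lookup (I.v (p n)) k - lookup (I.v (r n)) k = (if k = 3 then - 2 / 2 ^ n else 0))" by blast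
  show False
  proof (rule C.bounded_degree[of "\<lambda>_. a0" "\<lambda>_. b0" p r])
    fix n and e e' :: "nat \<Rightarrow> nat"
    assume lt: "e (Suc (card S)) < 2 ^ n" "e' (Suc (card S)) < 2 ^ n"
    assume "(\<Sum>j<Suc (card S). of_nat (e j) * (lookup (I.v a0) k - lookup (I.v b0) k))
            + of_nat (e (Suc (card S))) * (lookup (I.v (p n)) k - lookup (I.v (r n)) k) =
          (\<Sum>j<Suc (card S). of_nat (e' j) * (lookup (I.v a0) k - lookup (I.v b0) k))
            + of_nat (e' (Suc (card S))) * (lookup (I.v (p n)) k - lookup (I.v (r n)) k)" for k
    from this[of 3] have "of_nat (e 0) * (- 2) + of_nat (e 1) * (- 2 / 2 ^ n) =
      of_nat (e' 0) * (- 2) + of_nat (e' 1) * (- 2 / 2 ^ n :: rat)" using pr[of n] 0 by (simp add: S)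
    hence "(of_nat (2 ^ n * e 0 + e 1) :: rat) = of_nat (2 ^ n * e' 0 + e' 1)"
      by (simp add: field_simps)
    hence eq: "2 ^ n * e 0 + e 1 = 2 ^ n * e' 0 + e' 1" by (simp only: of_nat_eq_iff)
    have "e 0 = e' 0" "e 1 = e' 1"
      using arg_cong[OF eq, of "\<lambda>t. t div 2 ^ n"] arg_cong[OF eq, of "\<lambda>t. t mod 2 ^ n"] lt by (auto simp: S)
    thus "\<forall>j<Suc (Suc (card S)). e j = e' j" by (auto simp: S less_Suc_eq)
  qed (use 0 pr in auto)
qed

text \<open>At the rational place \<open>z\<^sub>n\<close> is itself integral, and \<open>0\<close> approximates it. But \<open>z\<^sub>n / s\<close> is not
  integral, since the coordinate of \<open>s\<close> dominates. Its approximation is only correct up to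
  integral elements, and these do not change its value for the place at infinity: the two valuations
  share the coordinates \<open>0, 1, 2\<close>. So \<open>1 / s\<close> and \<open>z\<^sub>0 / s\<close> are approximated by two independent elements,
  and \<open>z\<^sub>n / s\<close> by elements of unbounded degree over them.\<close>

theorem (in tower) no_pair_complement_at_rational_place:
  assumes S: "S = {s}"
  shows "\<not> pair_complement q x u w S (\<lambda>_. 1) R"
proof
  assume "pair_complement q x u w S (\<lambda>_. 1) R"
  then interpret C: pair_complement q x u w S "\<lambda>_. 1" R .
  let ?s = "mvar s"
  have Iv: "lookup (I.v ?s) k = (if k = 2 then 1 else 0)" for k by (rule I.v_S_var) (simp add: S)
  have Cv: "lookup (C.v ?s) k = (if k = 2 then 1 else 0)" for k by (rule C.v_S_var) (simp add: S)
  have approx: "\<exists>c d. (c, d) \<in> C.R0 \<and> c \<notin> null q \<and>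
      (\<forall>k. lookup (I.v c) k - lookup (I.v d) k = lookup (I.v a) k - lookup (I.v b) k - (if k = 2 then 1 else 0))"
    if ab: "a \<notin> null q" "b \<notin> null q" "\<And>k. k < 3 \<Longrightarrow> lookup (I.v a) k = lookup (I.v b) k" for a b
  proof -
    have bs: "b * ?s \<notin> null q" "lookup (I.v (b * ?s)) k = lookup (I.v b) k + (if k = 2 then 1 else 0)" for k
      using ab by (auto simp: M.mult_in_iff I.V.val_mult lookup_add Iv)
    have "\<exists>c d. (c, d) \<in> C.R0 \<and> c \<notin> null q \<and>
      (\<forall>k. lookup (I.v c) k - lookup (I.v d) k = lookup (I.v a) k - lookup (I.v (b * ?s)) k)"
    proof (rule C.R0_approximation)
      fix f d assume f: "f \<notin> null q" "d \<notin> null q" and le: "C.v (b * ?s * d) \<le> C.v f"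
      have ad: "a * d \<notin> null q" "b * ?s * d \<notin> null q" using ab f by (auto simp: M.mult_in_iff)
      have Cab: "lookup (C.v a) k = lookup (C.v b) k" if "k < 3" for k
        using ab that by (simp add: C.lookup_v_indep)
      have bd: "lookup (C.v (b * ?s * d)) k = lookup (C.v (a * d)) k + (if k = 2 then 1 else 0)" if "k < 3" for k
        using ab f Cab[OF that] by (simp add: C.V.val_mult M.mult_in_iff lookup_add Cv)
      have "\<exists>k<3. lookup (C.v (a * d)) k < lookup (C.v f) k \<and> (\<forall>l<k. lookup (C.v (a * d)) l = lookup (C.v f) l)"
      proof (cases "C.v (b * ?s * d) = C.v f")
        case True
        thus ?thesis using bd by (intro exI[of _ 2]) (simp flip: True)
      next
        case False
        hence "C.v (b * ?s * d) < C.v f" using le by simp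
        then obtain k where k: "lookup (C.v (b * ?s * d)) k < lookup (C.v f) k"
          "\<And>l. l < k \<Longrightarrow> lookup (C.v (b * ?s * d)) l = lookup (C.v f) l" unfolding lex_less_iff by blast
        show ?thesis
        proof (cases "k \<le> 2")
          case True
          have "lookup (C.v (a * d)) k < lookup (C.v f) k" using k(1) bd[of k] True by (auto split: if_splits)
          moreover have "lookup (C.v (a * d)) l = lookup (C.v f) l" if "l < k" for l
            using k(2)[OF that] bd[of l] True that by auto
          ultimately show ?thesis using True by (intro exI[of _ k]) auto
        next
          case False
          have "lookup (C.v (a * d)) 2 < lookup (C.v f) 2" using k(2)[of 2] bd[of 2] False by auto
          moreover have "lookup (C.v (a * d)) l = lookup (C.v f) l" if "l < 2" for l
            using k(2)[of l] bd[of l] False that by auto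
          ultimately show ?thesis by (intro exI[of _ 2]) auto
        qed
      qed
      then obtain k where k: "k < 3" "lookup (C.v (a * d)) k < lookup (C.v f) k"
        "\<forall>l<k. lookup (C.v (a * d)) l = lookup (C.v f) l" by blast
      thus "I.v (a * d) < I.v f" unfolding lex_less_iff
        using ad f by (intro exI[of _ k]) (auto simp flip: C.lookup_v_indep)
    qed (use ab bs in auto)
    thus ?thesis using bs by (simp add: algebra_simps)
  qed
  obtain a0 b0 where 0: "(a0, b0) \<in> C.R0 \<and> a0 \<notin> null q \<and>
    (\<forall>k. lookup (I.v a0) k - lookup (I.v b0) k = - (if k = 2 then 1 else 0))"
    using approx[of 1 1] by auto
  have approx_orbit: "\<exists>c d. (c, d) \<in> C.R0 \<and> c \<notin> null q \<and>
    (\<forall>k. lookup (I.v c) k - lookup (I.v d) k = (if k = 3 then - 2 / 2 ^ n else 0) - (if k = 2 then 1 else 0))" for n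
  proof -
    obtain Z e where Z: "(T ^^ n) Z = X ^ e * U" using orbit_exists[of n] by blast
    note z = orbit_value[OF Z]
    have "lookup (I.v Z) k - lookup (I.v (X ^ e)) k = (if k = 3 then - 2 / 2 ^ n else 0)" for k
      by (simp add: z I.v_X_power lookup_xpart)
    with approx[of Z "X ^ e"] show ?thesis using z by (simp add: I.v_X_power lookup_xpart)
  qed
  obtain a1 b1 where 1: "(a1, b1) \<in> C.R0 \<and> a1 \<notin> null q \<and>
    (\<forall>k. lookup (I.v a1) k - lookup (I.v b1) k = (if k = 3 then - 2 / 2 ^ 0 else 0) - (if k = 2 then 1 else 0))"
    using approx_orbit[of 0] by blast
  have "\<exists>p r. \<forall>n. (p n, r n) \<in> C.R0 \<and> p n \<notin> null q \<and>
    (\<forall>k. lookup (I.v (p n)) k - lookup (I.v (r n)) k = (if k = 3 then - 2 / 2 ^ n else 0) - (if k = 2 then 1 else 0))"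
    using approx_orbit by metis
  then obtain p r where pr: "\<And>n. (p n, r n) \<in> C.R0 \<and> p n \<notin> null q \<and>
    (\<forall>k. lookup (I.v (p n)) k - lookup (I.v (r n)) k = (if k = 3 then - 2 / 2 ^ n else 0) - (if k = 2 then 1 else 0))"
    by blast
  let ?a = "\<lambda>j :: nat. if j = 0 then a0 else a1" and ?b = "\<lambda>j :: nat. if j = 0 then b0 else b1"
  show False
  proof (rule C.bounded_degree[of ?a ?b p r])
    fix n and e e' :: "nat \<Rightarrow> nat"
    assume lt: "e (Suc (card S)) < 2 ^ n" "e' (Suc (card S)) < 2 ^ n"
    assume sums: "(\<Sum>j<Suc (card S). of_nat (e j) * (lookup (I.v (?a j)) k - lookup (I.v (?b j)) k))
            + of_nat (e (Suc (card S))) * (lookup (I.v (p n)) k - lookup (I.v (r n)) k) =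
          (\<Sum>j<Suc (card S). of_nat (e' j) * (lookup (I.v (?a j)) k - lookup (I.v (?b j)) k))
            + of_nat (e' (Suc (card S))) * (lookup (I.v (p n)) k - lookup (I.v (r n)) k)" for k
    have "of_nat (e 1) * (- 2) + of_nat (e 2) * (- 2 / 2 ^ n) =
      of_nat (e' 1) * (- 2) + of_nat (e' 2) * (- 2 / 2 ^ n :: rat)"
      using sums[of 3] pr[of n] 0 1 by (simp add: S numeral_2_eq_2)
    hence "(of_nat (2 ^ n * e 1 + e 2) :: rat) = of_nat (2 ^ n * e' 1 + e' 2)"
      by (simp add: field_simps)
    hence eq: "2 ^ n * e 1 + e 2 = 2 ^ n * e' 1 + e' 2" by (simp only: of_nat_eq_iff)
    have e12: "e 1 = e' 1" "e 2 = e' 2"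
      using arg_cong[OF eq, of "\<lambda>t. t div 2 ^ n"] arg_cong[OF eq, of "\<lambda>t. t mod 2 ^ n"] lt
      by (auto simp: S numeral_2_eq_2)
    have "- of_nat (e 0) - of_nat (e 1) - of_nat (e 2) = - of_nat (e' 0) - of_nat (e' 1) - (of_nat (e' 2) :: rat)"
      using sums[of 2] pr[of n] 0 1 by (simp add: S numeral_2_eq_2)
    hence "e 0 = e' 0" using e12 by simp
    thus "\<forall>j<Suc (Suc (card S)). e j = e' j" using e12 by (auto simp: S less_Suc_eq numeral_2_eq_2)
  qed (use 0 1 pr in auto)
qed

section \<open>Fraction fields in the natural numbers\<close>

text \<open>The fraction field of a countable ring modulo a prime ideal \<open>N\<close>, with carrier in \<^typ>\<open>nat\<close>:
  a fraction is coded by the least code of a pair that represents it.\<close>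

definition frac :: "'a::{comm_ring_1, countable} set \<Rightarrow> 'a \<Rightarrow> 'a \<Rightarrow> nat" where
  "frac N a b = (LEAST n. case from_nat n of (c, d) \<Rightarrow> d \<notin> N \<and> a * d - b * c \<in> N)"

definition num :: "nat \<Rightarrow> 'a::countable" where "num n = fst (from_nat n :: 'a \<times> 'a)"

definition den :: "nat \<Rightarrow> 'a::countable" where "den n = snd (from_nat n :: 'a \<times> 'a)"

definition frac_field :: "'a::{comm_ring_1, countable} set \<Rightarrow> nat ring" where
  "frac_field N = \<lparr>carrier = {frac N a b | a b. b \<notin> N},
     monoid.mult = (\<lambda>m n. frac N (num m * num n) (den m * den n)), one = frac N 1 1,
     ring.zero = frac N 0 1,
     add = (\<lambda>m n. frac N (num m * den n + num n * den m) (den m * den n))\<rparr>"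

text \<open>The prime field: the fractions of the integers.\<close>

definition frac_const :: "'a::{comm_ring_1, countable} set \<Rightarrow> nat set" where
  "frac_const N = {frac N (of_int m) (of_int n) | m n. of_int n \<notin> N}"

locale countable_leading_valuation = leading_valuation q N val lc
  for q and N :: "'a::{comm_ring_1, countable} set"
    and val :: "'a \<Rightarrow> 'g::{linordered_ab_group_add, countable}" and lc
begin

abbreviation "K \<equiv> frac_field N"
abbreviation "fr \<equiv> frac N"
abbreviation "const_field \<equiv> frac_const N"

lemma frac_spec:
  assumes "b \<notin> N"
  shows "den (fr a b) \<notin> N" "a * den (fr a b) - b * num (fr a b) \<in> N"
proof -
  let ?P = "\<lambda>n. case from_nat n of (c, d) \<Rightarrow> d \<notin> N \<and> a * d - b * c \<in> N"
  have "?P (to_nat (a, b))" using assms N_0 by (simp add: mult.commute)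
  hence "?P (fr a b)" unfolding frac_def by (rule LeastI)
  thus "den (fr a b) \<notin> N" "a * den (fr a b) - b * num (fr a b) \<in> N"
    by (auto simp: num_def den_def split: prod.splits)
qed

lemma frac_eq_iff:
  assumes "b \<notin> N" "d \<notin> N"
  shows "fr a b = fr c d \<longleftrightarrow> a * d - b * c \<in> N"
proof
  assume eq: "fr a b = fr c d"
  let ?n = "num (fr a b)" and ?d = "den (fr a b)"
  have 1: "a * ?d - b * ?n \<in> N" "?d \<notin> N" using frac_spec[OF assms(1)] by auto
  have 2: "c * ?d - d * ?n \<in> N" using frac_spec[OF assms(2), of c] by (simp add: eq)
  have "?d * (a * d - b * c) = d * (a * ?d - b * ?n) - b * (c * ?d - d * ?n)" by (simp add: algebra_simps)
  also have "\<dots> \<in> N" by (intro N_diff N_mult' 1 2)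
  finally show "a * d - b * c \<in> N" using 1(2) by (simp add: mult_in_iff)
next
  assume ad: "a * d - b * c \<in> N"
  have "a * f - b * e \<in> N \<longleftrightarrow> c * f - d * e \<in> N" for e f
  proof -
    have "d * (a * f - b * e) - b * (c * f - d * e) = f * (a * d - b * c)" by (simp add: algebra_simps)
    hence *: "d * (a * f - b * e) - b * (c * f - d * e) \<in> N" using ad N_mult' by metis
    have "d * (a * f - b * e) \<in> N \<longleftrightarrow> b * (c * f - d * e) \<in> N"
      using N_add[OF *, of "b * (c * f - d * e)"] N_diff[of "d * (a * f - b * e)", OF _ *] by auto
    thus ?thesis using assms by (simp add: mult_in_iff)
  qed
  thus "fr a b = fr c d" unfolding frac_def by simp
qed

lemma frac_in_carrier [simp]: "b \<notin> N \<Longrightarrow> fr a b \<in> carrier K"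
  by (auto simp: frac_field_def)

lemma carrierE:
  assumes "m \<in> carrier K" obtains a b where "m = fr a b" "b \<notin> N"
  using assms by (auto simp: frac_field_def)

lemma frac_mult [simp]:
  assumes "b \<notin> N" "d \<notin> N" shows "fr a b \<otimes>\<^bsub>K\<^esub> fr c d = fr (a * c) (b * d)"
proof -
  let ?n1 = "num (fr a b)" and ?d1 = "den (fr a b)" and ?n2 = "num (fr c d)" and ?d2 = "den (fr c d)"
  have 1: "?d1 \<notin> N" "a * ?d1 - b * ?n1 \<in> N" "?d2 \<notin> N" "c * ?d2 - d * ?n2 \<in> N"
    using frac_spec assms by auto
  have "?n1 * ?n2 * (b * d) - ?d1 * ?d2 * (a * c) =
    - ((a * ?d1 - b * ?n1) * (c * ?d2) + b * ?n1 * (c * ?d2 - d * ?n2))" by (simp add: algebra_simps)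
  also have "\<dots> \<in> N" by (intro N_uminus N_add N_mult[OF 1(2)] N_mult'[OF 1(4)])
  finally show ?thesis
    using 1 assms by (simp add: frac_field_def frac_eq_iff mult_in_iff)
qed

lemma frac_add [simp]:
  assumes "b \<notin> N" "d \<notin> N" shows "fr a b \<oplus>\<^bsub>K\<^esub> fr c d = fr (a * d + b * c) (b * d)"
proof -
  let ?n1 = "num (fr a b)" and ?d1 = "den (fr a b)" and ?n2 = "num (fr c d)" and ?d2 = "den (fr c d)"
  have 1: "?d1 \<notin> N" "a * ?d1 - b * ?n1 \<in> N" "?d2 \<notin> N" "c * ?d2 - d * ?n2 \<in> N"
    using frac_spec assms by auto
  have "(?n1 * ?d2 + ?n2 * ?d1) * (b * d) - ?d1 * ?d2 * (a * d + b * c) =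
    - ((a * ?d1 - b * ?n1) * (d * ?d2) + b * ?d1 * (c * ?d2 - d * ?n2))" by (simp add: algebra_simps)
  also have "\<dots> \<in> N" by (intro N_uminus N_add N_mult[OF 1(2)] N_mult'[OF 1(4)])
  finally show ?thesis
    using 1 assms by (simp add: frac_field_def frac_eq_iff mult_in_iff)
qed

lemma frac_one: "\<one>\<^bsub>K\<^esub> = fr 1 1" and frac_zero: "\<zero>\<^bsub>K\<^esub> = fr 0 1"
  by (simp_all add: frac_field_def)

lemma frac_eq_zero_iff: "b \<notin> N \<Longrightarrow> fr a b = \<zero>\<^bsub>K\<^esub> \<longleftrightarrow> a \<in> N"
  by (simp add: frac_zero frac_eq_iff)

lemma frac_eq_one_iff: "b \<notin> N \<Longrightarrow> fr a b = \<one>\<^bsub>K\<^esub> \<longleftrightarrow> a - b \<in> N"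
  by (simp add: frac_one frac_eq_iff)

lemma field_K: "field K"
proof -
  interpret cring K
  proof (rule cringI)
    show "abelian_group K"
    proof (rule abelian_groupI)
      fix m n k assume "m \<in> carrier K" "n \<in> carrier K" "k \<in> carrier K"
      then obtain a b c d e f where *: "m = fr a b" "b \<notin> N" "n = fr c d" "d \<notin> N" "k = fr e f" "f \<notin> N"
        by (auto elim!: carrierE)
      show "m \<oplus>\<^bsub>K\<^esub> n \<oplus>\<^bsub>K\<^esub> k = m \<oplus>\<^bsub>K\<^esub> (n \<oplus>\<^bsub>K\<^esub> k)"
        using * by (simp add: mult_in_iff algebra_simps)
    next
      fix m assume "m \<in> carrier K"
      then obtain a b where *: "m = fr a b" "b \<notin> N" by (rule carrierE)
      show "\<exists>n\<in>carrier K. n \<oplus>\<^bsub>K\<^esub> m = \<zero>\<^bsub>K\<^esub>"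
        using * N_0 by (intro bexI[of _ "fr (- a) b"]) (simp_all add: mult_in_iff frac_eq_zero_iff mult.commute)
    qed (auto elim!: carrierE simp: mult_in_iff frac_zero algebra_simps)
    show "comm_monoid K"
      by (rule comm_monoidI) (auto elim!: carrierE simp: mult_in_iff frac_one algebra_simps)
    fix m n k assume "m \<in> carrier K" "n \<in> carrier K" "k \<in> carrier K"
    then obtain a b c d e f where *: "m = fr a b" "b \<notin> N" "n = fr c d" "d \<notin> N" "k = fr e f" "f \<notin> N"
      by (auto elim!: carrierE)
    show "(m \<oplus>\<^bsub>K\<^esub> n) \<otimes>\<^bsub>K\<^esub> k = m \<otimes>\<^bsub>K\<^esub> k \<oplus>\<^bsub>K\<^esub> n \<otimes>\<^bsub>K\<^esub> k"
      using * N_0 by (simp add: mult_in_iff frac_eq_iff algebra_simps)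
  qed
  show ?thesis
  proof (rule cring_fieldI2)
    show "\<zero>\<^bsub>K\<^esub> \<noteq> \<one>\<^bsub>K\<^esub>" by (simp add: frac_one frac_zero frac_eq_iff)
    fix m assume "m \<in> carrier K" "m \<noteq> \<zero>\<^bsub>K\<^esub>"
    then obtain a b where *: "m = fr a b" "b \<notin> N" "a \<notin> N" by (auto elim!: carrierE simp: frac_eq_zero_iff)
    show "\<exists>n\<in>carrier K. m \<otimes>\<^bsub>K\<^esub> n = \<one>\<^bsub>K\<^esub>"
      using * N_0 by (intro bexI[of _ "fr b a"]) (simp_all add: mult_in_iff frac_eq_one_iff mult.commute)
  qed
qed

sublocale K: field K by (rule field_K)

lemma frac_uminus [simp]: "b \<notin> N \<Longrightarrow> \<ominus>\<^bsub>K\<^esub> fr a b = fr (- a) b"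
  by (rule K.minus_equality) (use N_0 in \<open>simp_all add: mult_in_iff frac_eq_zero_iff mult.commute\<close>)

lemma frac_minus [simp]:
  assumes "b \<notin> N" "d \<notin> N" shows "fr a b \<ominus>\<^bsub>K\<^esub> fr c d = fr (a * d - b * c) (b * d)"
  using assms by (simp add: K.minus_eq)

lemma frac_inverse: "b \<notin> N \<Longrightarrow> a \<notin> N \<Longrightarrow> inv\<^bsub>K\<^esub> fr a b = fr b a"
  using N_0 by (intro K.comm_inv_char) (simp_all add: mult_in_iff frac_eq_one_iff mult.commute)

lemma frac_pow: "b \<notin> N \<Longrightarrow> fr a b [^]\<^bsub>K\<^esub> (n :: nat) = fr (a ^ n) (b ^ n)"
  by (induction n) (simp_all add: frac_one power_notin mult.commute)

lemma frac_finprod: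
  "finite I \<Longrightarrow> finprod K (\<lambda>i. fr (f i) 1) I = fr (prod f I) 1"
  by (induction I rule: finite_induct) (simp_all add: frac_one)

lemma frac_finsum:
  "finite I \<Longrightarrow> finsum K (\<lambda>i. fr (f i) 1) I = fr (sum f I) 1"
  by (induction I rule: finite_induct) (simp_all add: frac_zero)

lemma of_int_in_N_iff [simp]: "of_int n \<in> N \<longleftrightarrow> q dvd n"
  using val_of_int of_int_in_N by blast

lemma frac_constE:
  assumes "m \<in> frac_const N" obtains a b where "m = fr (of_int a) (of_int b)" "\<not> q dvd b"
  using assms by (auto simp: frac_const_def)

lemma frac_constI: "\<not> q dvd b \<Longrightarrow> fr (of_int a) (of_int b) \<in> frac_const N"
  by (auto simp: frac_const_def)

lemma frac_const_subfield: "subfield (frac_const N) K"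
proof (rule K.subfieldI')
  have dvd: "q dvd a * b \<longleftrightarrow> q dvd a \<or> q dvd b" for a b by (rule char_dvd_mult[OF char])
  show "subring (frac_const N) K"
  proof (rule K.subringI)
    show "frac_const N \<subseteq> carrier K" by (auto elim!: frac_constE)
    show "\<one>\<^bsub>K\<^esub> \<in> frac_const N"
      using frac_constI[of 1 1] char_not_dvd_1[OF char] by (simp add: frac_one)
    show "\<ominus>\<^bsub>K\<^esub> m \<in> frac_const N" if "m \<in> frac_const N" for m
    proof -
      obtain a b where "m = fr (of_int a) (of_int b)" "\<not> q dvd b" using \<open>m \<in> frac_const N\<close> by (rule frac_constE)
      thus ?thesis using frac_constI[of b "- a"] by simp
    qed
    fix m n assume "m \<in> frac_const N" "n \<in> frac_const N"
    then obtain a b c d where *: "m = fr (of_int a) (of_int b)" "\<not> q dvd b"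
      "n = fr (of_int c) (of_int d)" "\<not> q dvd d" by (auto elim!: frac_constE)
    show "m \<otimes>\<^bsub>K\<^esub> n \<in> frac_const N" using * frac_constI[of "b * d" "a * c"] by (simp add: dvd)
    show "m \<oplus>\<^bsub>K\<^esub> n \<in> frac_const N" using * frac_constI[of "b * d" "a * d + b * c"] by (simp add: dvd)
  qed
  fix m assume "m \<in> frac_const N - {\<zero>\<^bsub>K\<^esub>}"
  then obtain a b where *: "m = fr (of_int a) (of_int b)" "\<not> q dvd b" "m \<noteq> \<zero>\<^bsub>K\<^esub>"
    by (auto elim!: frac_constE)
  hence "\<not> q dvd a" by (simp add: frac_eq_zero_iff)
  thus "inv\<^bsub>K\<^esub> m \<in> frac_const N" using * frac_constI[of a b] by (simp add: frac_inverse)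
qed

lemma ring_iso_of_eq:
  assumes "bij_betw f (carrier R) (carrier S)" "f \<in> ring_hom R S" shows "R \<simeq> S"
  using assms by (auto simp: is_ring_iso_def ring_iso_def)

lemma frac_const_rat:
  assumes q: "q = 0" shows "rat_ring \<simeq> K\<lparr>carrier := frac_const N\<rparr>"
proof -
  define f where "f r = (case quotient_of r of (a, b) \<Rightarrow> fr (of_int a) (of_int b))" for r
  have f: "f r = fr (of_int a) (of_int b)" if "r = of_int a / of_int b" "b \<noteq> 0" for r a b
  proof -
    obtain c d where cd: "quotient_of r = (c, d)" by (cases "quotient_of r")
    hence d: "d > 0" "r = of_int c / of_int d" using quotient_of_denom_pos quotient_of_div by blast+
    hence "(of_int c * of_int b :: rat) = of_int d * of_int a" using that by (simp add: field_simps)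
    hence "c * b = d * a" by (simp only: of_int_mult[symmetric] of_int_eq_iff)
    hence "of_int c * of_int b - of_int d * of_int a = (0 :: 'a)" by (simp flip: of_int_mult)
    thus ?thesis using that(2) d(1) N_0 by (simp add: f_def cd frac_eq_iff q)
  qed
  have rat: "\<exists>a b. r = of_int a / of_int b \<and> b \<noteq> 0" for r :: rat
    by (metis quotient_of_div quotient_of_denom_pos less_irrefl surj_pair)
  show ?thesis
  proof (rule ring_iso_of_eq)
    show "f \<in> ring_hom rat_ring (K\<lparr>carrier := frac_const N\<rparr>)"
    proof (rule ring_hom_memI)
      fix r s :: rat
      obtain a b c d where *: "r = of_int a / of_int b" "b \<noteq> 0" "s = of_int c / of_int d" "d \<noteq> 0"
        using rat by metis
      show "f r \<in> carrier (K\<lparr>carrier := frac_const N\<rparr>)" using * f[of r a b] frac_constI q by simp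
      have "r * s = of_int (a * c) / of_int (b * d)" using * by simp
      from f[OF this] show "f (r \<otimes>\<^bsub>rat_ring\<^esub> s) = f r \<otimes>\<^bsub>K\<lparr>carrier := frac_const N\<rparr>\<^esub> f s"
        using * f[of r a b] f[of s c d] q by (simp add: rat_ring_def)
      have "r + s = of_int (a * d + b * c) / of_int (b * d)" using * by (simp add: field_simps)
      from f[OF this] show "f (r \<oplus>\<^bsub>rat_ring\<^esub> s) = f r \<oplus>\<^bsub>K\<lparr>carrier := frac_const N\<rparr>\<^esub> f s"
        using * f[of r a b] f[of s c d] q by (simp add: rat_ring_def)
    next
      show "f \<one>\<^bsub>rat_ring\<^esub> = \<one>\<^bsub>K\<lparr>carrier := frac_const N\<rparr>\<^esub>"
        using f[of 1 1 1] by (simp add: rat_ring_def frac_one)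
    qed
    show "bij_betw f (carrier rat_ring) (carrier (K\<lparr>carrier := frac_const N\<rparr>))"
    proof (rule bij_betw_imageI)
      show "inj_on f (carrier rat_ring)"
      proof (rule inj_onI)
        fix r s assume eq: "f r = f s"
        obtain a b c d where *: "r = of_int a / of_int b" "b \<noteq> 0" "s = of_int c / of_int d" "d \<noteq> 0"
          using rat by metis
        hence "of_int a * of_int d - of_int b * of_int c \<in> N"
          using eq f[of r a b] f[of s c d] q by (simp add: frac_eq_iff)
        hence "of_int (a * d - b * c) \<in> N" by simp
        hence "a * d = b * c" unfolding of_int_in_N_iff q by simp
        hence "(of_int a * of_int d :: rat) = of_int b * of_int c" by (simp flip: of_int_mult)
        thus "r = s" unfolding *(1) *(3) using *(2,4) by (simp add: frac_eq_eq mult.commute)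
      qed
      show "f ` carrier rat_ring = carrier (K\<lparr>carrier := frac_const N\<rparr>)"
      proof
        show "f ` carrier rat_ring \<subseteq> carrier (K\<lparr>carrier := frac_const N\<rparr>)"
          using rat f frac_constI q by auto metis
        show "carrier (K\<lparr>carrier := frac_const N\<rparr>) \<subseteq> f ` carrier rat_ring"
        proof
          fix m assume "m \<in> carrier (K\<lparr>carrier := frac_const N\<rparr>)"
          then obtain a b where "m = fr (of_int a) (of_int b)" "b \<noteq> 0" using q by (auto elim!: frac_constE)
          thus "m \<in> f ` carrier rat_ring" using f[of "of_int a / of_int b" a b]
            by (intro image_eqI[of _ f "of_int a / of_int b"]) (auto simp: rat_ring_def)
        qed
      qed
    qed
  qed
qed

lemma frac_const_mod:
  assumes q: "q = int p" "prime p" shows "residue_ring (int p) \<simeq> K\<lparr>carrier := frac_const N\<rparr>"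
proof (rule ring_iso_of_eq)
  let ?f = "\<lambda>n. fr (of_int n) 1"
  have p: "p > 1" using q prime_gt_1_nat by blast
  have eq: "?f m = ?f n \<longleftrightarrow> int p dvd m - n" for m n
  proof -
    have "?f m = ?f n \<longleftrightarrow> of_int (m - n) \<in> N" by (simp add: frac_eq_iff del: of_int_in_N_iff)
    thus ?thesis unfolding of_int_in_N_iff q .
  qed
  have const: "?f n \<in> frac_const N" for n
    using frac_constI[of 1 n] char_not_dvd_1[OF char] by simp
  show "?f \<in> ring_hom (residue_ring (int p)) (K\<lparr>carrier := frac_const N\<rparr>)"
  proof (rule ring_hom_memI)
    fix m n
    show "?f m \<in> carrier (K\<lparr>carrier := frac_const N\<rparr>)" using const by simp
    have "?f (m * n mod int p) = ?f (m * n)" unfolding eq by (simp flip: mod_eq_dvd_iff)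
    thus "?f (m \<otimes>\<^bsub>residue_ring (int p)\<^esub> n) = ?f m \<otimes>\<^bsub>K\<lparr>carrier := frac_const N\<rparr>\<^esub> ?f n"
      by (simp add: residue_ring_def)
    have "?f ((m + n) mod int p) = ?f (m + n)" unfolding eq by (simp flip: mod_eq_dvd_iff)
    thus "?f (m \<oplus>\<^bsub>residue_ring (int p)\<^esub> n) = ?f m \<oplus>\<^bsub>K\<lparr>carrier := frac_const N\<rparr>\<^esub> ?f n"
      by (simp add: residue_ring_def)
  next
    show "?f \<one>\<^bsub>residue_ring (int p)\<^esub> = \<one>\<^bsub>K\<lparr>carrier := frac_const N\<rparr>\<^esub>"
      by (simp add: residue_ring_def frac_one)
  qed
  show "bij_betw ?f (carrier (residue_ring (int p))) (carrier (K\<lparr>carrier := frac_const N\<rparr>))"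
  proof (rule bij_betw_imageI)
    show "inj_on ?f (carrier (residue_ring (int p)))"
    proof (rule inj_onI)
      fix m n assume mn: "m \<in> carrier (residue_ring (int p))" "n \<in> carrier (residue_ring (int p))" "?f m = ?f n"
      hence "int p dvd m - n" unfolding eq by simp
      hence "m mod int p = n mod int p" by (simp add: mod_eq_dvd_iff)
      thus "m = n" using mn by (simp add: residue_ring_def)
    qed
    show "?f ` carrier (residue_ring (int p)) = carrier (K\<lparr>carrier := frac_const N\<rparr>)"
    proof
      show "?f ` carrier (residue_ring (int p)) \<subseteq> carrier (K\<lparr>carrier := frac_const N\<rparr>)"
        using const by auto
      show "carrier (K\<lparr>carrier := frac_const N\<rparr>) \<subseteq> ?f ` carrier (residue_ring (int p))"
      proof
        fix m assume "m \<in> carrier (K\<lparr>carrier := frac_const N\<rparr>)"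
        then obtain a b where m: "m = fr (of_int a) (of_int b)" "\<not> q dvd b" by (auto elim!: frac_constE)
        have "coprime (int p) b" using m(2) q by (intro prime_imp_coprime) auto
        then obtain c where "[b * c = 1] (mod int p)" using cong_solve_coprime_int[of b "int p"]
          by (auto simp: coprime_commute)
        hence "int p dvd 1 - b * c" by (simp add: cong_iff_dvd_diff dvd_diff_commute)
        hence "int p dvd a * (1 - b * c)" by (rule dvd_mult)
        hence "of_int (a * (1 - b * c)) \<in> N" unfolding of_int_in_N_iff q .
        also have "of_int (a * (1 - b * c)) = (of_int a * 1 - of_int b * of_int (a * c) :: 'a)"
          by (simp add: algebra_simps)
        finally have "m = ?f (a * c)" unfolding m(1) using m(2) by (subst frac_eq_iff) simp_all
        also have "\<dots> = ?f ((a * c) mod int p)" unfolding eq by (simp add: mod_eq_dvd_iff[symmetric])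
        finally show "m \<in> ?f ` carrier (residue_ring (int p))" using p by (auto simp: residue_ring_def)
      qed
    qed
  qed
qed

text \<open>The isomorphism type of the prime field depends on the characteristic only.\<close>

lemma frac_const_iso:
  fixes k :: "'k ring"
  assumes k: "field k" and iso: "q = 0 \<and> k \<simeq> rat_ring \<or> (\<exists>p. q = int p \<and> prime p \<and> k \<simeq> residue_ring (int p))"
  shows "K\<lparr>carrier := frac_const N\<rparr> \<simeq> k"
proof -
  interpret k: field k by (rule k)
  have "k \<simeq> K\<lparr>carrier := frac_const N\<rparr>"
    using iso
  proof (elim disjE exE conjE)
    show ?thesis if "q = 0" "k \<simeq> rat_ring" using ring_iso_trans[OF that(2) frac_const_rat[OF that(1)]] .
    show ?thesis if "q = int p" "prime p" "k \<simeq> residue_ring (int p)" for p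
      using ring_iso_trans[OF that(3) frac_const_mod[OF that(1,2)]] .
  qed
  thus ?thesis by (rule ring_iso_sym[OF k.ring_axioms])
qed

end

section \<open>The valued fraction field\<close>

text \<open>An ordered group of type \<open>'g\<close>, with carrier in \<^typ>\<open>nat\<close>.\<close>

definition coded_group :: "'g::{linordered_ab_group_add, countable} itself \<Rightarrow> nat monoid" where
  "coded_group _ = \<lparr>carrier = range (to_nat :: 'g \<Rightarrow> nat),
     monoid.mult = (\<lambda>m n. to_nat (from_nat m + from_nat n :: 'g)), one = to_nat (0 :: 'g)\<rparr>"

definition coded_order :: "'g::{linordered_ab_group_add, countable} itself \<Rightarrow> (nat \<times> nat) set" where
  "coded_order _ = {(to_nat a, to_nat b) | a b :: 'g. a \<le> b}"

lemma coded_order_iff [simp]: "(to_nat a, to_nat b) \<in> coded_order TYPE('g) \<longleftrightarrow> a \<le> b"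
  for a b :: "'g::{linordered_ab_group_add, countable}"
  by (auto simp: coded_order_def)

lemma coded_group_simps:
  "carrier (coded_group TYPE('g)) = range (to_nat :: 'g \<Rightarrow> nat)"
  "to_nat a \<otimes>\<^bsub>coded_group TYPE('g)\<^esub> to_nat b = to_nat (a + b)"
  "\<one>\<^bsub>coded_group TYPE('g)\<^esub> = to_nat (0 :: 'g)"
  for a b :: "'g::{linordered_ab_group_add, countable}"
  by (simp_all add: coded_group_def)

lemma coded_group: "ordered_abelian_group (coded_group TYPE('g::{linordered_ab_group_add, countable})) (coded_order TYPE('g))"
proof -
  interpret comm_group "coded_group TYPE('g)"
  proof (rule comm_groupI)
    fix m assume "m \<in> carrier (coded_group TYPE('g))"
    then obtain a :: 'g where "m = to_nat a" by (auto simp: coded_group_simps)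
    thus "\<exists>n\<in>carrier (coded_group TYPE('g)). n \<otimes>\<^bsub>coded_group TYPE('g)\<^esub> m = \<one>\<^bsub>coded_group TYPE('g)\<^esub>"
      by (intro bexI[of _ "to_nat (- a)"]) (auto simp: coded_group_simps)
  qed (auto simp: coded_group_simps add_ac)
  show ?thesis
  proof
    show "linear_order_on (carrier (coded_group TYPE('g))) (coded_order TYPE('g))"
      unfolding linear_order_on_def partial_order_on_def preorder_on_def
    proof (intro conjI)
      show "refl_on (carrier (coded_group TYPE('g))) (coded_order TYPE('g))"
        by (auto simp: refl_on_def coded_group_simps)
      show "trans (coded_order TYPE('g))"
        by (rule transI) (auto simp: coded_order_def)
      show "antisym (coded_order TYPE('g))" by (rule antisymI) (auto simp: coded_order_def)
      show "total_on (carrier (coded_group TYPE('g))) (coded_order TYPE('g))"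
        by (auto simp: total_on_def coded_group_simps)
    qed (auto simp: coded_order_def coded_group_simps)
    show "(c \<otimes>\<^bsub>coded_group TYPE('g)\<^esub> a, c \<otimes>\<^bsub>coded_group TYPE('g)\<^esub> b) \<in> coded_order TYPE('g)"
      if "(a, b) \<in> coded_order TYPE('g)" "c \<in> carrier (coded_group TYPE('g))" for a b c
      using that by (auto simp: coded_order_def coded_group_simps)
  qed
qed

text \<open>The value of a fraction on its chosen numerator and denominator; \<open>frac_val_frac\<close> shows that all
  representatives give the same.\<close>

definition frac_val :: "'a::{comm_ring_1, countable} set \<Rightarrow> ('a \<Rightarrow> 'g::{linordered_ab_group_add, countable})
    \<Rightarrow> nat \<Rightarrow> nat extval" where
  "frac_val N val m = (if num m \<in> N then Infty else Fin (to_nat (val (num m) - val (den m))))"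

context countable_leading_valuation
begin

abbreviation "vK \<equiv> frac_val N val"

lemma frac_val_frac:
  assumes "b \<notin> N" shows "vK (fr a b) = (if a \<in> N then Infty else Fin (to_nat (val a - val b)))"
proof -
  let ?n = "num (fr a b)" and ?d = "den (fr a b)"
  note d = frac_spec[OF assms, of a]
  show ?thesis
  proof (cases "a \<in> N")
    case True
    hence "b * ?n \<in> N" using d N_diff[of "a * ?d" "a * ?d - b * ?n"] N_mult[OF True] by simp
    thus ?thesis using True assms by (simp add: frac_val_def mult_in_iff)
  next
    case False
    hence ad: "a * ?d \<notin> N" using d by (simp add: mult_in_iff)
    from val_cong[OF this d(2)] have "b * ?n \<notin> N" "val (b * ?n) = val (a * ?d)" by auto
    hence "?n \<notin> N" "val b + val ?n = val a + val ?d" using False assms d(1) by (auto simp: mult_in_iff val_mult)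
    moreover from this(2) have "val ?n - val ?d = val a - val b" by (simp add: algebra_simps)
    ultimately show ?thesis using False by (simp add: frac_val_def)
  qed
qed

lemma extval_le_frac:
  assumes "b \<notin> N" "d \<notin> N"
  shows "extval_le (coded_order TYPE('g)) (vK (fr a b)) (vK (fr c d)) \<longleftrightarrow> c \<in> N \<or> a \<notin> N \<and> val a - val b \<le> val c - val d"
  using assms by (simp add: frac_val_frac)

lemma valued_field_K: "valued_field K (coded_group TYPE('g)) (coded_order TYPE('g)) vK"
proof -
  interpret G: ordered_abelian_group "coded_group TYPE('g)" "coded_order TYPE('g)" by (rule coded_group)
  show ?thesis
  proof
    fix m assume "m \<in> carrier K"
    then obtain a b where m: "m = fr a b" "b \<notin> N" by (rule carrierE)
    show "vK m \<in> insert Infty (Fin ` carrier (coded_group TYPE('g)))" using m by (simp add: frac_val_frac coded_group_simps)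
    show "vK m = Infty \<longleftrightarrow> m = \<zero>\<^bsub>K\<^esub>" using m by (simp add: frac_val_frac frac_eq_zero_iff)
  next
    fix m n assume "m \<in> carrier K" "n \<in> carrier K"
    then obtain a b c d where *: "m = fr a b" "b \<notin> N" "n = fr c d" "d \<notin> N" by (auto elim!: carrierE)
    show "vK (m \<otimes>\<^bsub>K\<^esub> n) = extval_add (coded_group TYPE('g)) (vK m) (vK n)"
      using * by (auto simp: frac_val_frac mult_in_iff val_mult coded_group_simps algebra_simps)
    show "extval_le (coded_order TYPE('g)) (vK m) (vK (m \<oplus>\<^bsub>K\<^esub> n)) \<or> extval_le (coded_order TYPE('g)) (vK n) (vK (m \<oplus>\<^bsub>K\<^esub> n))"
    proof (cases "a * d + b * c \<in> N")
      case True
      thus ?thesis using * by (simp add: extval_le_frac mult_in_iff)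
    next
      case False
      have bd: "b * d \<notin> N" using * by (simp add: mult_in_iff)
      consider "a \<in> N" "c \<notin> N" | "a \<notin> N" "c \<in> N" | "a \<notin> N" "c \<notin> N"
        using False N_add N_mult N_mult' by blast
      thus ?thesis
      proof cases
        case 1
        hence "val (b * c + a * d) = val (b * c)" using add_less[of "b * c" "a * d"] * N_mult by (simp add: mult_in_iff)
        thus ?thesis using * 1 False by (simp add: extval_le_frac mult_in_iff val_mult add.commute algebra_simps)
      next
        case 2
        hence "val (a * d + b * c) = val (a * d)" using add_less[of "a * d" "b * c"] * N_mult' by (simp add: mult_in_iff)
        thus ?thesis using * 2 False by (simp add: extval_le_frac mult_in_iff val_mult algebra_simps)
      next
        case 3
        hence "val (a * d) \<le> val (a * d + b * c) \<or> val (b * c) \<le> val (a * d + b * c)"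
          using val_add_ge[of "a * d" "b * c"] False * by (simp add: mult_in_iff)
        thus ?thesis using * 3 False by (auto simp: extval_le_frac mult_in_iff val_mult algebra_simps)
      qed
    qed
  qed
qed

lemma trivially_valued_K: "trivially_valued K (coded_group TYPE('g)) vK (frac_const N)"
  unfolding trivially_valued_def
proof
  fix m assume m: "m \<in> frac_const N - {\<zero>\<^bsub>K\<^esub>}"
  then obtain a b where *: "m = fr (of_int a) (of_int b)" "\<not> q dvd b" by (auto elim!: frac_constE)
  hence "\<not> q dvd a" using m by (simp add: frac_eq_zero_iff)
  thus "vK m = Fin \<one>\<^bsub>coded_group TYPE('g)\<^esub>" using * val_of_int by (simp add: frac_val_frac coded_group_simps)
qed

text \<open>The passage from weak complements to pairs, on which degrees of polynomials can be estimated.\<close>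

lemma weak_complement_pairs:
  assumes R: "weak_complement K (coded_group TYPE('g)) (coded_order TYPE('g)) vK R"
  defines "P \<equiv> {(a, b). b \<notin> N \<and> fr a b \<in> R}"
  shows "(0, 1) \<in> P" "(a, b) \<in> P \<Longrightarrow> b \<notin> N" "(a, b) \<in> P \<Longrightarrow> (- a, b) \<in> P"
    "(a, b) \<in> P \<Longrightarrow> (c, d) \<in> P \<Longrightarrow> (a * d + b * c, b * d) \<in> P"
    "(a, b) \<in> P \<Longrightarrow> (c, d) \<in> P \<Longrightarrow> (a * c, b * d) \<in> P"
    "(a, b) \<in> P \<Longrightarrow> d \<notin> N \<Longrightarrow> a * d - b * c \<in> N \<Longrightarrow> (c, d) \<in> P"
    "(a, b) \<in> P \<Longrightarrow> a \<notin> N \<Longrightarrow> val a \<le> val b"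
    "b \<notin> N \<Longrightarrow> \<exists>c d. (c, d) \<in> P \<and> (a * d - b * c \<in> N \<or> val (b * d) \<le> val (a * d - b * c))"
proof -
  have sub: "additive_subgroup R K" and mult: "\<And>r s. r \<in> R \<Longrightarrow> s \<in> R \<Longrightarrow> r \<otimes>\<^bsub>K\<^esub> s \<in> R"
    and le: "\<And>r. r \<in> R \<Longrightarrow> r \<noteq> \<zero>\<^bsub>K\<^esub> \<Longrightarrow> extval_le (coded_order TYPE('g)) (vK r) (Fin \<one>\<^bsub>coded_group TYPE('g)\<^esub>)"
    and approx: "\<And>a. a \<in> carrier K \<Longrightarrow> \<exists>r\<in>R. extval_le (coded_order TYPE('g)) (Fin \<one>\<^bsub>coded_group TYPE('g)\<^esub>) (vK (a \<ominus>\<^bsub>K\<^esub> r))"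
    using R unfolding weak_complement_def by auto
  interpret additive_subgroup R K by (rule sub)
  show "(0, 1) \<in> P" using zero_closed by (simp add: P_def frac_zero)
  show "b \<notin> N" if "(a, b) \<in> P" using that by (simp add: P_def)
  show "(- a, b) \<in> P" if "(a, b) \<in> P"
    using that a_inv_closed[of "fr a b"] by (simp add: P_def)
  show "(a * d + b * c, b * d) \<in> P" if "(a, b) \<in> P" "(c, d) \<in> P"
    using that a_closed[of "fr a b" "fr c d"] by (simp add: P_def mult_in_iff)
  show "(a * c, b * d) \<in> P" if "(a, b) \<in> P" "(c, d) \<in> P"
    using that mult[of "fr a b" "fr c d"] by (simp add: P_def mult_in_iff)
  show "(c, d) \<in> P" if "(a, b) \<in> P" "d \<notin> N" "a * d - b * c \<in> N"
    using that frac_eq_iff[of b d a c] by (simp add: P_def)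
  show "val a \<le> val b" if "(a, b) \<in> P" "a \<notin> N"
    using that le[of "fr a b"] by (simp add: P_def frac_eq_zero_iff frac_val_frac coded_group_simps)
  show "\<exists>c d. (c, d) \<in> P \<and> (a * d - b * c \<in> N \<or> val (b * d) \<le> val (a * d - b * c))" if b: "b \<notin> N"
  proof -
    obtain r where r: "r \<in> R" "extval_le (coded_order TYPE('g)) (Fin \<one>\<^bsub>coded_group TYPE('g)\<^esub>) (vK (fr a b \<ominus>\<^bsub>K\<^esub> r))"
      using approx[of "fr a b"] b by auto
    have "r \<in> carrier K" using r(1) a_subset by blast
    then obtain c d where cd: "r = fr c d" "d \<notin> N" by (rule carrierE)
    have "a * d - b * c \<in> N \<or> val (b * d) \<le> val (a * d - b * c)"
      using r(2) b cd by (auto simp: frac_val_frac mult_in_iff coded_group_simps split: if_splits)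
    moreover have "(c, d) \<in> P" using r(1) cd by (simp add: P_def)
    ultimately show ?thesis by blast
  qed
qed

section \<open>Residue fields, cross-sections and orderings\<close>

lemma valuation_ring_frac:
  "b \<notin> N \<Longrightarrow> fr a b \<in> carrier (valuation_ring K (coded_group TYPE('g)) (coded_order TYPE('g)) vK) \<longleftrightarrow> a \<in> N \<or> val b \<le> val a"
  by (simp add: valuation_ring_def frac_val_frac coded_group_simps)

lemma valuation_ideal_frac:
  "b \<notin> N \<Longrightarrow> fr a b \<in> valuation_ideal K (coded_group TYPE('g)) (coded_order TYPE('g)) vK \<longleftrightarrow> a \<in> N \<or> val b < val a"
  by (auto simp: valuation_ideal_def frac_val_frac coded_group_simps)

abbreviation "O\<^sub>v \<equiv> valuation_ring K (coded_group TYPE('g)) (coded_order TYPE('g)) vK"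
abbreviation "M\<^sub>v \<equiv> valuation_ideal K (coded_group TYPE('g)) (coded_order TYPE('g)) vK"
abbreviation "res \<equiv> residue_map K (coded_group TYPE('g)) (coded_order TYPE('g)) vK"

lemma Ov_simps: "m \<otimes>\<^bsub>O\<^sub>v\<^esub> n = m \<otimes>\<^bsub>K\<^esub> n" "m \<oplus>\<^bsub>O\<^sub>v\<^esub> n = m \<oplus>\<^bsub>K\<^esub> n" "\<one>\<^bsub>O\<^sub>v\<^esub> = \<one>\<^bsub>K\<^esub>" "\<zero>\<^bsub>O\<^sub>v\<^esub> = \<zero>\<^bsub>K\<^esub>"
  by (simp_all add: valuation_ring_def)

lemma Ov_carrierE:
  assumes "m \<in> carrier O\<^sub>v" obtains a b where "m = fr a b" "b \<notin> N" "a \<in> N \<or> val b \<le> val a"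
proof -
  have "m \<in> carrier K" using assms by (simp add: valuation_ring_def)
  then obtain a b where *: "m = fr a b" "b \<notin> N" by (rule carrierE)
  thus thesis using that assms valuation_ring_frac by blast
qed

lemma val_sum_ge: "a \<in> N \<or> g \<le> val a \<Longrightarrow> b \<in> N \<or> g \<le> val b \<Longrightarrow> a + b \<in> N \<or> g \<le> val (a + b)"
proof (cases "a \<in> N \<or> b \<in> N \<or> a + b \<in> N")
  case True
  assume *: "a \<in> N \<or> g \<le> val a" "b \<in> N \<or> g \<le> val b"
  show ?thesis
  proof (cases "a + b \<in> N")
    case False
    have "val (a + b) = val b" if "a \<in> N" "b \<notin> N" using add_less[of b a] that by (simp add: add.commute)
    moreover have "val (a + b) = val a" if "b \<in> N" "a \<notin> N" using add_less[of a b] that by simp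
    ultimately show ?thesis using True False * N_add by metis
  qed simp
next
  case False
  assume *: "a \<in> N \<or> g \<le> val a" "b \<in> N \<or> g \<le> val b"
  thus ?thesis using val_add_ge[of a b] False order_trans by blast
qed

lemma val_sum_greater: "a \<in> N \<or> g < val a \<Longrightarrow> b \<in> N \<or> g < val b \<Longrightarrow> a + b \<in> N \<or> g < val (a + b)"
proof (cases "a \<in> N \<or> b \<in> N \<or> a + b \<in> N")
  case True
  assume *: "a \<in> N \<or> g < val a" "b \<in> N \<or> g < val b"
  show ?thesis
  proof (cases "a + b \<in> N")
    case False
    have "val (a + b) = val b" if "a \<in> N" "b \<notin> N" using add_less[of b a] that by (simp add: add.commute)
    moreover have "val (a + b) = val a" if "b \<in> N" "a \<notin> N" using add_less[of a b] that by simp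
    ultimately show ?thesis using True False * N_add by metis
  qed simp
next
  case False
  assume *: "a \<in> N \<or> g < val a" "b \<in> N \<or> g < val b"
  thus ?thesis using val_add_ge[of a b] False less_le_trans by blast
qed

lemma cring_Ov: "cring O\<^sub>v"
proof -
  have "subcring (carrier O\<^sub>v) K"
  proof (rule K.subcringI'[OF K.subringI])
    show "carrier O\<^sub>v \<subseteq> carrier K" by (auto simp: valuation_ring_def)
    show "\<one>\<^bsub>K\<^esub> \<in> carrier O\<^sub>v" by (simp add: frac_one valuation_ring_frac)
    show "\<ominus>\<^bsub>K\<^esub> m \<in> carrier O\<^sub>v" if "m \<in> carrier O\<^sub>v" for m
      using that by (auto elim!: Ov_carrierE simp: valuation_ring_frac val_uminus)
        (metis val_uminus)
    fix m n assume "m \<in> carrier O\<^sub>v" "n \<in> carrier O\<^sub>v"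
    then obtain a b c d where *: "m = fr a b" "b \<notin> N" "a \<in> N \<or> val b \<le> val a"
      "n = fr c d" "d \<notin> N" "c \<in> N \<or> val d \<le> val c" by (auto elim!: Ov_carrierE)
    have bd: "b * d \<notin> N" "val (b * d) = val b + val d" using * by (auto simp: mult_in_iff val_mult)
    show "m \<otimes>\<^bsub>K\<^esub> n \<in> carrier O\<^sub>v"
      using * bd by (cases "a \<in> N \<or> c \<in> N") (auto simp: valuation_ring_frac mult_in_iff val_mult add_mono)
    have "a * d \<in> N \<or> val (b * d) \<le> val (a * d)" "b * c \<in> N \<or> val (b * d) \<le> val (b * c)"
      using * by (cases "a \<in> N"; cases "c \<in> N"; simp add: mult_in_iff val_mult)+
    thus "m \<oplus>\<^bsub>K\<^esub> n \<in> carrier O\<^sub>v"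
      using * bd val_sum_ge by (simp add: valuation_ring_frac)
  qed
  hence "cring (K\<lparr>carrier := carrier O\<^sub>v\<rparr>)"
    using K.subcring_iff[of "carrier O\<^sub>v"] subcringE(1) by blast
  thus ?thesis by (simp add: valuation_ring_def)
qed

lemma ideal_Mv: "ideal M\<^sub>v O\<^sub>v"
proof -
  interpret Ov: cring O\<^sub>v by (rule cring_Ov)
  have sub: "M\<^sub>v \<subseteq> carrier O\<^sub>v" by (auto simp: valuation_ideal_def valuation_ring_def)
  have M_E: "\<exists>a b. m = fr a b \<and> b \<notin> N \<and> (a \<in> N \<or> val b < val a)" if m: "m \<in> M\<^sub>v" for m
  proof -
    obtain a b where "m = fr a b" "b \<notin> N" using sub m by (blast elim: Ov_carrierE)
    thus ?thesis using m valuation_ideal_frac by blast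
  qed
  have closed: "m \<oplus>\<^bsub>K\<^esub> n \<in> M\<^sub>v" if mn: "m \<in> M\<^sub>v" "n \<in> M\<^sub>v" for m n
  proof -
    obtain a b c d where *: "m = fr a b" "b \<notin> N" "a \<in> N \<or> val b < val a"
      "n = fr c d" "d \<notin> N" "c \<in> N \<or> val d < val c" using M_E mn by metis
    have "a * d \<in> N \<or> val (b * d) < val (a * d)" "b * c \<in> N \<or> val (b * d) < val (b * c)"
      using * by (cases "a \<in> N"; cases "c \<in> N"; simp add: mult_in_iff val_mult)+
    thus ?thesis using * val_sum_greater by (simp add: valuation_ideal_frac mult_in_iff)
  qed
  have mult: "m \<otimes>\<^bsub>K\<^esub> n \<in> M\<^sub>v" if mn: "m \<in> carrier O\<^sub>v" "n \<in> M\<^sub>v" for m n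
  proof -
    obtain a b where 1: "m = fr a b" "b \<notin> N" "a \<in> N \<or> val b \<le> val a" using mn(1) by (rule Ov_carrierE)
    obtain c d where 2: "n = fr c d" "d \<notin> N" "c \<in> N \<or> val d < val c" using M_E mn(2) by metis
    show ?thesis
    proof (cases "a \<in> N \<or> c \<in> N")
      case True thus ?thesis using 1 2 by (auto simp: valuation_ideal_frac mult_in_iff)
    next
      case False thus ?thesis using 1 2 by (simp add: valuation_ideal_frac mult_in_iff val_mult add_le_less_mono)
    qed
  qed
  have neg: "\<ominus>\<^bsub>O\<^sub>v\<^esub> m \<in> M\<^sub>v" if m: "m \<in> M\<^sub>v" for m
  proof -
    have "\<ominus>\<^bsub>O\<^sub>v\<^esub> m = \<ominus>\<^bsub>O\<^sub>v\<^esub> \<one>\<^bsub>O\<^sub>v\<^esub> \<otimes>\<^bsub>O\<^sub>v\<^esub> m" using m sub by (simp add: Ov.l_minus subsetD)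
    also have "\<dots> = \<ominus>\<^bsub>O\<^sub>v\<^esub> \<one>\<^bsub>O\<^sub>v\<^esub> \<otimes>\<^bsub>K\<^esub> m" by (simp only: Ov_simps)
    also have "\<dots> \<in> M\<^sub>v" using m by (intro mult) simp_all
    finally show ?thesis .
  qed
  show ?thesis
  proof (rule idealI)
    show "subgroup M\<^sub>v (add_monoid O\<^sub>v)"
    proof (rule Ov.add.subgroupI)
      have "\<zero>\<^bsub>K\<^esub> \<in> M\<^sub>v" using N_0 by (simp add: frac_zero valuation_ideal_frac)
      thus "M\<^sub>v \<noteq> {}" by blast
    qed (use sub closed neg in \<open>simp_all add: Ov_simps\<close>)
    fix m n assume mn: "m \<in> M\<^sub>v" "n \<in> carrier O\<^sub>v"
    thus "n \<otimes>\<^bsub>O\<^sub>v\<^esub> m \<in> M\<^sub>v" using mult by (simp add: Ov_simps)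
    moreover have "n \<otimes>\<^bsub>O\<^sub>v\<^esub> m = m \<otimes>\<^bsub>O\<^sub>v\<^esub> n" using mn sub by (intro Ov.m_comm) auto
    ultimately show "m \<otimes>\<^bsub>O\<^sub>v\<^esub> n \<in> M\<^sub>v" by simp
  qed (rule Ov.ring_axioms)
qed

abbreviation "Rv \<equiv> residue_field K (coded_group TYPE('g)) (coded_order TYPE('g)) vK"

lemma res_hom: "res \<in> ring_hom O\<^sub>v Rv"
  using ideal.rcos_ring_hom[OF ideal_Mv] unfolding residue_field_def residue_map_def .

lemma carrier_Rv: "carrier Rv = res ` carrier O\<^sub>v"
  by (auto simp: residue_field_def FactRing_def A_RCOSETS_def' residue_map_def)

lemma Ov_minus: "m \<in> carrier O\<^sub>v \<Longrightarrow> n \<in> carrier O\<^sub>v \<Longrightarrow> m \<ominus>\<^bsub>O\<^sub>v\<^esub> n = m \<ominus>\<^bsub>K\<^esub> n"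
proof -
  interpret Ov: cring O\<^sub>v by (rule cring_Ov)
  assume *: "m \<in> carrier O\<^sub>v" "n \<in> carrier O\<^sub>v"
  have car: "carrier O\<^sub>v \<subseteq> carrier K" by (auto simp: valuation_ring_def)
  have "\<ominus>\<^bsub>O\<^sub>v\<^esub> n \<oplus>\<^bsub>K\<^esub> n = \<zero>\<^bsub>K\<^esub>" using Ov.l_neg[OF *(2)] by (simp add: Ov_simps)
  hence "\<ominus>\<^bsub>K\<^esub> n = \<ominus>\<^bsub>O\<^sub>v\<^esub> n" using car * Ov.a_inv_closed by (intro K.minus_equality) auto
  thus ?thesis by (simp add: a_minus_def Ov_simps)
qed

lemma res_eq_iff:
  "m \<in> carrier O\<^sub>v \<Longrightarrow> n \<in> carrier O\<^sub>v \<Longrightarrow> res m = res n \<longleftrightarrow> m \<ominus>\<^bsub>K\<^esub> n \<in> M\<^sub>v"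
  using ring.quotient_eq_iff_same_a_r_cos[OF cring.axioms(1)[OF cring_Ov] ideal_Mv, of m n]
  unfolding residue_map_def by (simp add: Ov_minus)

lemma const_Ov: "frac_const N \<subseteq> carrier O\<^sub>v"
proof
  fix m assume "m \<in> frac_const N"
  then obtain a b where *: "m = fr (of_int a) (of_int b)" "\<not> q dvd b" by (rule frac_constE)
  have "of_int a \<in> N \<or> val (of_int b :: 'a) \<le> val (of_int a)"
    using val_of_int[OF *(2)] val_of_int[of a] by (cases "q dvd a") auto
  thus "m \<in> carrier O\<^sub>v" using * by (simp add: valuation_ring_frac)
qed

lemma const_Mv: "m \<in> frac_const N \<Longrightarrow> m \<in> M\<^sub>v \<Longrightarrow> m = \<zero>\<^bsub>K\<^esub>"
proof -
  assume m: "m \<in> frac_const N" "m \<in> M\<^sub>v"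
  obtain a b where *: "m = fr (of_int a) (of_int b)" "\<not> q dvd b" using m(1) by (rule frac_constE)
  hence "of_int a \<in> N \<or> val (of_int b :: 'a) < val (of_int a)" using m(2) by (simp add: valuation_ideal_frac)
  hence "of_int a \<in> N" using val_of_int[OF *(2)] val_of_int[of a] by (cases "q dvd a") auto
  thus ?thesis using * by (simp add: frac_eq_zero_iff)
qed

text \<open>The quotient of the leading coefficients of numerator and denominator has the required residue.\<close>

lemma const_approximation:
  assumes "m \<in> carrier O\<^sub>v" shows "\<exists>c\<in>frac_const N. m \<ominus>\<^bsub>K\<^esub> c \<in> M\<^sub>v"
proof -
  obtain a b where *: "m = fr a b" "b \<notin> N" "a \<in> N \<or> val b \<le> val a" using assms by (rule Ov_carrierE)
  show ?thesis
  proof (cases "a \<in> N \<or> val b < val a")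
    case True
    have "\<zero>\<^bsub>K\<^esub> \<in> frac_const N" using frac_constI[of 1 0] char_not_dvd_1[OF char] by (simp add: frac_zero)
    moreover have "m \<ominus>\<^bsub>K\<^esub> \<zero>\<^bsub>K\<^esub> = m" using * by (simp add: K.minus_eq)
    ultimately show ?thesis using True * by (intro bexI[of _ "\<zero>\<^bsub>K\<^esub>"]) (simp_all add: valuation_ideal_frac)
  next
    case False
    hence ab: "a \<notin> N" "val a = val b" using * by auto
    have la: "\<not> q dvd lc a" "\<not> q dvd lc b" using lc_nonzero ab * by auto
    have na: "of_int (lc a) \<notin> N" "of_int (lc b) \<notin> N" using la by simp_all
    have 1: "a * of_int (lc b) \<notin> N" "- (b * of_int (lc a)) \<notin> N"
      using ab * na by (auto simp: mult_in_iff)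
    have v: "val (of_int (lc a) :: 'a) = 0" "val (of_int (lc b) :: 'a) = 0" using val_of_int la by auto
    have 2: "val (a * of_int (lc b)) = val b" "val (- (b * of_int (lc a))) = val b"
      using ab * na v 1 by (simp_all add: val_mult val_uminus)
    have 3: "[lc (a * of_int (lc b)) = lc a * lc b] (mod q)"
      using cong_trans[OF lc_mult[OF ab(1) na(2)] cong_mult[OF cong_refl]] val_of_int[OF la(2)] by blast
    have "[lc (b * of_int (lc a)) = lc b * lc a] (mod q)"
      using cong_trans[OF lc_mult[OF *(2) na(1)] cong_mult[OF cong_refl]] val_of_int[OF la(1)] by blast
    hence 4: "[- lc (b * of_int (lc a)) = - (lc b * lc a)] (mod q)" by (simp only: cong_minus_minus_iff)
    have "b * of_int (lc a) \<notin> N" using 1 by simp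
    from cong_trans[OF lc_uminus[OF this] 4]
    have "[lc (- (b * of_int (lc a))) = - (lc b * lc a)] (mod q)" .
    from cong_add[OF 3 this] have "q dvd lc (a * of_int (lc b)) + lc (- (b * of_int (lc a)))"
      by (simp add: cong_0_iff mult.commute)
    from add_cancel[OF 1 _ this] 2
    have "a * of_int (lc b) - b * of_int (lc a) \<in> N \<or> val b < val (a * of_int (lc b) - b * of_int (lc a))" by simp
    hence "m \<ominus>\<^bsub>K\<^esub> fr (of_int (lc a)) (of_int (lc b)) \<in> M\<^sub>v"
      using * na v by (simp add: valuation_ideal_frac mult_in_iff val_mult del: of_int_in_N_iff)
    thus ?thesis using frac_constI[OF la(2)] by blast
  qed
qed

lemma frac_const_subring: "subring (frac_const N) K"
  using frac_const_subfield by (simp add: subfieldE)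

lemma const_minus: "c \<in> frac_const N \<Longrightarrow> d \<in> frac_const N \<Longrightarrow> c \<ominus>\<^bsub>K\<^esub> d \<in> frac_const N"
  using subringE(5,7)[OF frac_const_subring] by (simp add: a_minus_def)

lemma res_const_inj: "c \<in> frac_const N \<Longrightarrow> d \<in> frac_const N \<Longrightarrow> res c = res d \<Longrightarrow> c = d"
proof -
  assume cd: "c \<in> frac_const N" "d \<in> frac_const N" "res c = res d"
  have car: "c \<in> carrier K" "d \<in> carrier K" using cd subringE(1)[OF frac_const_subring] by auto
  have "c \<ominus>\<^bsub>K\<^esub> d \<in> M\<^sub>v" using cd const_Ov res_eq_iff[of c d] by blast
  hence "c \<ominus>\<^bsub>K\<^esub> d = \<zero>\<^bsub>K\<^esub>" by (intro const_Mv const_minus cd)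
  thus ?thesis using car by (simp add: K.r_right_minus_eq)
qed

lemma Rv_const: "A \<in> carrier Rv \<Longrightarrow> \<exists>c\<in>frac_const N. A = res c"
proof -
  assume "A \<in> carrier Rv"
  then obtain m where m: "A = res m" "m \<in> carrier O\<^sub>v" by (auto simp: carrier_Rv)
  from const_approximation[OF m(2)] obtain c where c: "c \<in> frac_const N" "m \<ominus>\<^bsub>K\<^esub> c \<in> M\<^sub>v" by blast
  hence "res m = res c" using res_eq_iff[OF m(2), of c] const_Ov by blast
  thus ?thesis using m c by blast
qed

lemma const_res_iso: "res \<in> ring_iso (K\<lparr>carrier := frac_const N\<rparr>) Rv"
  unfolding ring_iso_def
proof (intro CollectI conjI)
  show "res \<in> ring_hom (K\<lparr>carrier := frac_const N\<rparr>) Rv"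
  proof (rule ring_hom_memI)
    fix c d assume "c \<in> carrier (K\<lparr>carrier := frac_const N\<rparr>)" "d \<in> carrier (K\<lparr>carrier := frac_const N\<rparr>)"
    hence Ov: "c \<in> carrier O\<^sub>v" "d \<in> carrier O\<^sub>v" using const_Ov by auto
    show "res (c \<otimes>\<^bsub>K\<lparr>carrier := frac_const N\<rparr>\<^esub> d) = res c \<otimes>\<^bsub>Rv\<^esub> res d"
      using ring_hom_mult[OF res_hom Ov] by (simp add: Ov_simps)
    show "res (c \<oplus>\<^bsub>K\<lparr>carrier := frac_const N\<rparr>\<^esub> d) = res c \<oplus>\<^bsub>Rv\<^esub> res d"
      using ring_hom_add[OF res_hom Ov] by (simp add: Ov_simps)
    show "res c \<in> carrier Rv" using Ov by (simp add: carrier_Rv)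
  next
    show "res \<one>\<^bsub>K\<lparr>carrier := frac_const N\<rparr>\<^esub> = \<one>\<^bsub>Rv\<^esub>"
      using ring_hom_one[OF res_hom] by (simp add: Ov_simps)
  qed
  show "bij_betw res (carrier (K\<lparr>carrier := frac_const N\<rparr>)) (carrier Rv)"
  proof (rule bij_betw_imageI)
    show "inj_on res (carrier (K\<lparr>carrier := frac_const N\<rparr>))" using res_const_inj by (auto simp: inj_on_def)
    show "res ` carrier (K\<lparr>carrier := frac_const N\<rparr>) = carrier Rv"
      using Rv_const const_Ov unfolding carrier_Rv by fastforce
  qed
qed

text \<open>By \<open>const_approximation\<close> the residue map is bijective on the prime field; its inverse is the
  embedding.\<close>

lemma residue_field_embedding_exists:
  "\<exists>f. residue_field_embedding K (coded_group TYPE('g)) (coded_order TYPE('g)) vK f"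
proof -
  define f where "f A = (THE c. c \<in> frac_const N \<and> res c = A)" for A
  have f: "f (res c) = c" if "c \<in> frac_const N" for c
    unfolding f_def by (rule the_equality) (use that res_const_inj[of _ c] in auto)
  have mult: "c \<otimes>\<^bsub>K\<^esub> d \<in> frac_const N" "c \<oplus>\<^bsub>K\<^esub> d \<in> frac_const N" if "c \<in> frac_const N" "d \<in> frac_const N" for c d
    using subringE(6,7)[OF frac_const_subring] that by auto
  have one: "\<one>\<^bsub>K\<^esub> \<in> frac_const N" using subringE(3)[OF frac_const_subring] .
  have "f \<in> ring_hom Rv O\<^sub>v"
  proof (rule ring_hom_memI)
    fix A B assume "A \<in> carrier Rv" "B \<in> carrier Rv"
    then obtain c d where *: "A = res c" "c \<in> frac_const N" "B = res d" "d \<in> frac_const N"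
      using Rv_const by metis
    have Ov: "c \<in> carrier O\<^sub>v" "d \<in> carrier O\<^sub>v" using * const_Ov by auto
    show "f A \<in> carrier O\<^sub>v" using * f const_Ov by auto
    have "A \<otimes>\<^bsub>Rv\<^esub> B = res (c \<otimes>\<^bsub>K\<^esub> d)" using * ring_hom_mult[OF res_hom Ov] by (simp add: Ov_simps)
    thus "f (A \<otimes>\<^bsub>Rv\<^esub> B) = f A \<otimes>\<^bsub>O\<^sub>v\<^esub> f B" using * f mult by (simp add: Ov_simps)
    have "A \<oplus>\<^bsub>Rv\<^esub> B = res (c \<oplus>\<^bsub>K\<^esub> d)" using * ring_hom_add[OF res_hom Ov] by (simp add: Ov_simps)
    thus "f (A \<oplus>\<^bsub>Rv\<^esub> B) = f A \<oplus>\<^bsub>O\<^sub>v\<^esub> f B" using * f mult by (simp add: Ov_simps)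
  next
    have "\<one>\<^bsub>Rv\<^esub> = res \<one>\<^bsub>K\<^esub>" using ring_hom_one[OF res_hom] by (simp add: Ov_simps)
    thus "f \<one>\<^bsub>Rv\<^esub> = \<one>\<^bsub>O\<^sub>v\<^esub>" using f one by (simp add: Ov_simps)
  qed
  moreover have "\<forall>A\<in>carrier Rv. res (f A) = A" using Rv_const f by fastforce
  ultimately show ?thesis unfolding residue_field_embedding_def by blast
qed

text \<open>A section has to be multiplicative on the values that occur only; the coded group may be larger
  than the value group.\<close>

lemma cross_sectionI:
  fixes s :: "'g \<Rightarrow> nat"
  defines "V \<equiv> {val a - val b | a b. a \<notin> N \<and> b \<notin> N}"
  assumes "\<And>g. g \<in> V \<Longrightarrow> s g \<in> carrier K \<and> vK (s g) = Fin (to_nat g)"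
    and "\<And>g h. g \<in> V \<Longrightarrow> h \<in> V \<Longrightarrow> s (g + h) = s g \<otimes>\<^bsub>K\<^esub> s h"
  shows "cross_section K (coded_group TYPE('g)) vK (\<lambda>n. s (from_nat n))"
proof -
  have carrier: "\<exists>g\<in>V. n = to_nat g" if n: "n \<in> carrier (value_group K (coded_group TYPE('g)) vK)" for n
  proof -
    obtain m where m: "m \<in> carrier K" "vK m = Fin n" using n by (auto simp: value_group_def)
    from m(1) obtain a b where "m = fr a b" "b \<notin> N" by (rule carrierE)
    thus ?thesis using m(2) by (auto simp: frac_val_frac V_def split: if_splits)
  qed
  have nonzero: "s g \<noteq> \<zero>\<^bsub>K\<^esub>" if "g \<in> V" for g
  proof
    assume "s g = \<zero>\<^bsub>K\<^esub>"
    hence "vK (s g) = Infty" using N_0 by (simp add: frac_zero frac_val_frac)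
    thus False using assms(2)[OF that] by simp
  qed
  show ?thesis
    unfolding cross_section_def
  proof (intro conjI ballI homI)
    fix n assume "n \<in> carrier (value_group K (coded_group TYPE('g)) vK)"
    then obtain g where g: "g \<in> V" "n = to_nat g" using carrier by blast
    show "s (from_nat n) \<in> carrier (units_of K)"
      using g assms(2)[OF g(1)] nonzero[OF g(1)] by (simp add: units_of_def K.field_Units)
    show "vK (s (from_nat n)) = Fin n" using g assms(2)[OF g(1)] by simp
    fix n' assume "n' \<in> carrier (value_group K (coded_group TYPE('g)) vK)"
    then obtain g' where g': "g' \<in> V" "n' = to_nat g'" using carrier by blast
    show "s (from_nat (n \<otimes>\<^bsub>value_group K (coded_group TYPE('g)) vK\<^esub> n')) = s (from_nat n) \<otimes>\<^bsub>units_of K\<^esub> s (from_nat n')"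
      using g g' assms(3) by (simp add: value_group_def coded_group_simps units_of_def)
  qed
qed

end

text \<open>In characteristic zero the signs of the leading coefficients order the fraction field.\<close>

locale ordered_leading_valuation = countable_leading_valuation q N val lc
  for q and N :: "'a::{comm_ring_1, countable} set"
    and val :: "'a \<Rightarrow> 'g::{linordered_ab_group_add, countable}" and lc +
  assumes q_0: "q = 0"
begin

definition sg :: "'a \<Rightarrow> int" where "sg a = (if a \<in> N then 0 else sgn (lc a))"

lemma cong_0: "[a = b] (mod q) \<longleftrightarrow> a = b" for a b :: int by (simp add: q_0 cong_def)

lemma sg_eq_0_iff: "sg a = 0 \<longleftrightarrow> a \<in> N"
  using lc_nonzero[of a] by (auto simp: sg_def q_0 sgn_0_0)

lemma sg_mult: "sg (a * b) = sg a * sg b"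
  using lc_mult[of a b] by (simp add: sg_def mult_in_iff cong_0 sgn_mult)

lemma sg_uminus: "sg (- a) = - sg a"
  using lc_uminus[of a] by (simp add: sg_def cong_0)

lemma sg_cong: "a - b \<in> N \<Longrightarrow> sg a = sg b"
proof -
  assume ab: "a - b \<in> N"
  show ?thesis
  proof (cases "a \<in> N")
    case True
    hence "b \<in> N" using N_diff[OF True ab] by simp
    thus ?thesis using True by (simp add: sg_def)
  next
    case False
    thus ?thesis using val_cong[OF False ab] by (simp add: sg_def cong_0)
  qed
qed

lemma sg_of_int: "sg (of_int n) = sgn n"
  using val_of_int[of n] of_int_in_N[of n] by (cases "n = 0") (auto simp: sg_def q_0 cong_0)

lemma sg_1 [simp]: "sg 1 = 1" using sg_of_int[of 1] by simp

text \<open>The leading coefficients of two positive elements cannot cancel.\<close>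

lemma sg_add_nonneg: "0 \<le> sg a \<Longrightarrow> 0 \<le> sg b \<Longrightarrow> 0 \<le> sg (a + b)"
proof -
  assume *: "0 \<le> sg a" "0 \<le> sg b"
  consider "a \<in> N" | "b \<in> N" | "a \<notin> N" "b \<notin> N" by blast
  thus ?thesis
  proof cases
    case 1 thus ?thesis using sg_cong[of "a + b" b] * by simp
  next
    case 2 thus ?thesis using sg_cong[of "a + b" a] * by simp
  next
    case 3
    hence pos: "lc a > 0" "lc b > 0" using * lc_nonzero[of a] lc_nonzero[of b] by (auto simp: sg_def q_0 sgn_if split: if_splits)
    consider "val a < val b" | "val b < val a" | "val a = val b" by fastforce
    thus ?thesis
    proof cases
      case 1
      thus ?thesis using add_less[of a b] 3 pos by (simp add: sg_def cong_0)
    next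
      case 2
      thus ?thesis using add_less[of b a] 3 pos by (simp add: sg_def cong_0 add.commute)
    next
      case eq: 3
      have "\<not> q dvd lc a + lc b" using pos by (simp add: q_0)
      from add_eq[OF 3 eq this] pos show ?thesis by (simp add: sg_def cong_0)
    qed
  qed
qed

lemma sg_square: "b \<notin> N \<Longrightarrow> sg b * sg b = 1"
  using sg_eq_0_iff[of b] by (auto simp: sg_def sgn_if split: if_splits)

definition fsg :: "nat \<Rightarrow> int" where "fsg m = sg (num m) * sg (den m)"

lemma fsg_frac: "b \<notin> N \<Longrightarrow> fsg (fr a b) = sg a * sg b"
proof -
  assume b: "b \<notin> N"
  note d = frac_spec[OF b, of a]
  have "sg a * sg (den (fr a b)) = sg b * sg (num (fr a b))"
    using sg_cong[OF d(2)] by (simp add: sg_mult)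
  hence "sg b * (sg a * sg (den (fr a b))) * sg (den (fr a b)) = sg b * (sg b * sg (num (fr a b))) * sg (den (fr a b))"
    by simp
  hence "sg a * sg b * (sg (den (fr a b)) * sg (den (fr a b))) = (sg b * sg b) * (sg (num (fr a b)) * sg (den (fr a b)))"
    by (simp only: mult_ac)
  thus ?thesis using sg_square[OF b] sg_square[OF d(1)] by (simp add: fsg_def)
qed

definition frac_order :: "(nat \<times> nat) set" where
  "frac_order = {(m, n). m \<in> carrier K \<and> n \<in> carrier K \<and> 0 \<le> fsg (n \<ominus>\<^bsub>K\<^esub> m)}"

lemma fsg_mult: "m \<in> carrier K \<Longrightarrow> n \<in> carrier K \<Longrightarrow> fsg (m \<otimes>\<^bsub>K\<^esub> n) = fsg m * fsg n"
  by (auto elim!: carrierE simp: fsg_frac mult_in_iff sg_mult)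

lemma fsg_uminus: "m \<in> carrier K \<Longrightarrow> fsg (\<ominus>\<^bsub>K\<^esub> m) = - fsg m"
  by (auto elim!: carrierE simp: fsg_frac sg_uminus)

lemma fsg_eq_0_iff: "m \<in> carrier K \<Longrightarrow> fsg m = 0 \<longleftrightarrow> m = \<zero>\<^bsub>K\<^esub>"
  by (auto elim!: carrierE simp: fsg_frac frac_eq_zero_iff sg_eq_0_iff)

lemma fsg_add_nonneg:
  assumes "m \<in> carrier K" "n \<in> carrier K" "0 \<le> fsg m" "0 \<le> fsg n"
  shows "0 \<le> fsg (m \<oplus>\<^bsub>K\<^esub> n)"
proof -
  obtain a b c d where *: "m = fr a b" "b \<notin> N" "n = fr c d" "d \<notin> N"
    using assms by (auto elim!: carrierE)
  have "0 \<le> sg (a * b * (d * d) + c * d * (b * b))"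
    using assms * by (intro sg_add_nonneg) (simp_all add: sg_mult sg_square fsg_frac)
  also have "a * b * (d * d) + c * d * (b * b) = (a * d + b * c) * (b * d)" by (simp add: algebra_simps)
  finally show ?thesis using * by (simp add: fsg_frac mult_in_iff sg_mult)
qed

lemma minus_add_minus:
  "m \<in> carrier K \<Longrightarrow> n \<in> carrier K \<Longrightarrow> k \<in> carrier K \<Longrightarrow> (n \<ominus>\<^bsub>K\<^esub> m) \<oplus>\<^bsub>K\<^esub> (k \<ominus>\<^bsub>K\<^esub> n) = k \<ominus>\<^bsub>K\<^esub> m"
  by (auto elim!: carrierE simp: mult_in_iff frac_eq_iff algebra_simps N_0)

lemma minus_uminus: "m \<in> carrier K \<Longrightarrow> n \<in> carrier K \<Longrightarrow> m \<ominus>\<^bsub>K\<^esub> n = \<ominus>\<^bsub>K\<^esub> (n \<ominus>\<^bsub>K\<^esub> m)"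
  by (auto elim!: carrierE simp: mult_in_iff frac_eq_iff algebra_simps N_0)

lemma frac_order_linear: "linear_order_on (carrier K) frac_order"
  unfolding linear_order_on_def partial_order_on_def preorder_on_def
proof (intro conjI)
  show "frac_order \<subseteq> carrier K \<times> carrier K" by (auto simp: frac_order_def)
  show "refl_on (carrier K) frac_order"
  proof (rule refl_onI)
    fix m assume m: "m \<in> carrier K"
    hence "fsg (m \<ominus>\<^bsub>K\<^esub> m) = 0" by (simp add: fsg_eq_0_iff)
    thus "(m, m) \<in> frac_order" using m by (simp add: frac_order_def)
  qed
  show "trans frac_order"
  proof (rule transI)
    fix m n k assume *: "(m, n) \<in> frac_order" "(n, k) \<in> frac_order"
    hence "0 \<le> fsg ((n \<ominus>\<^bsub>K\<^esub> m) \<oplus>\<^bsub>K\<^esub> (k \<ominus>\<^bsub>K\<^esub> n))" by (intro fsg_add_nonneg) (auto simp: frac_order_def)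
    thus "(m, k) \<in> frac_order" using * by (simp add: frac_order_def minus_add_minus)
  qed
  show "antisym frac_order"
  proof (rule antisymI)
    fix m n assume "(m, n) \<in> frac_order" "(n, m) \<in> frac_order"
    hence *: "m \<in> carrier K" "n \<in> carrier K" "0 \<le> fsg (n \<ominus>\<^bsub>K\<^esub> m)" "0 \<le> fsg (m \<ominus>\<^bsub>K\<^esub> n)"
      by (auto simp: frac_order_def)
    have "fsg (m \<ominus>\<^bsub>K\<^esub> n) = - fsg (n \<ominus>\<^bsub>K\<^esub> m)" using * by (simp add: minus_uminus[of m n] fsg_uminus)
    hence "fsg (m \<ominus>\<^bsub>K\<^esub> n) = 0" using * by simp
    hence "m \<ominus>\<^bsub>K\<^esub> n = \<zero>\<^bsub>K\<^esub>" using * by (simp add: fsg_eq_0_iff)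
    thus "m = n" using * by simp
  qed
  show "total_on (carrier K) frac_order"
  proof (rule total_onI)
    fix m n assume "m \<in> carrier K" "n \<in> carrier K"
    thus "(m, n) \<in> frac_order \<or> (n, m) \<in> frac_order"
      using fsg_uminus[of "n \<ominus>\<^bsub>K\<^esub> m"] by (auto simp: frac_order_def minus_uminus[of m n])
  qed
qed

lemma ordered_field_K: "ordered_field K frac_order"
proof (intro ordered_field.intro field_K ordered_field_axioms.intro frac_order_linear)
  fix m n k assume *: "(m, n) \<in> frac_order" "k \<in> carrier K"
  have "(k \<oplus>\<^bsub>K\<^esub> n) \<ominus>\<^bsub>K\<^esub> (k \<oplus>\<^bsub>K\<^esub> m) = n \<ominus>\<^bsub>K\<^esub> m"
    using * by (auto elim!: carrierE simp: frac_order_def mult_in_iff frac_eq_iff algebra_simps N_0)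
  thus "(k \<oplus>\<^bsub>K\<^esub> m, k \<oplus>\<^bsub>K\<^esub> n) \<in> frac_order" using * by (simp add: frac_order_def)
next
  fix m n assume *: "(\<zero>\<^bsub>K\<^esub>, m) \<in> frac_order" "(\<zero>\<^bsub>K\<^esub>, n) \<in> frac_order"
  have [simp]: "k \<ominus>\<^bsub>K\<^esub> \<zero>\<^bsub>K\<^esub> = k" if "k \<in> carrier K" for k using that by (simp add: K.minus_eq)
  show "(\<zero>\<^bsub>K\<^esub>, m \<otimes>\<^bsub>K\<^esub> n) \<in> frac_order" using * by (auto simp: frac_order_def fsg_mult)
qed

lemma frac_order_zero: "m \<in> carrier K \<Longrightarrow> (\<zero>\<^bsub>K\<^esub>, m) \<in> frac_order \<longleftrightarrow> 0 \<le> fsg m"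
  by (simp add: frac_order_def K.minus_eq)

text \<open>An element of smaller value determines the sign of a sum.\<close>

lemma compatible_K: "compatible_valuation K frac_order (coded_group TYPE('g)) (coded_order TYPE('g)) vK"
  unfolding compatible_valuation_def
proof (intro conjI allI impI valued_field_K)
  fix m n assume *: "(\<zero>\<^bsub>K\<^esub>, m) \<in> frac_order \<and> m \<noteq> \<zero>\<^bsub>K\<^esub> \<and> (m, n) \<in> frac_order"
  hence car: "m \<in> carrier K" "n \<in> carrier K" by (auto simp: frac_order_def)
  then obtain a b c d where mn: "m = fr a b" "b \<notin> N" "n = fr c d" "d \<notin> N" by (auto elim!: carrierE)
  have pos: "sg a * sg b = 1"
  proof -
    have "0 \<le> fsg m" "fsg m \<noteq> 0" using * car frac_order_zero fsg_eq_0_iff by auto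
    thus ?thesis using mn by (auto simp: fsg_frac) (auto simp: sg_def sgn_if split: if_splits)
  qed
  hence a: "a \<notin> N" using sg_eq_0_iff[of a] by auto
  have le: "0 \<le> fsg (fr (c * b - d * a) (d * b))" using * mn by (simp add: frac_order_def)
  hence le': "0 \<le> sg (c * b - d * a) * (sg d * sg b)" using mn by (simp add: fsg_frac mult_in_iff sg_mult)
  have no: False if "c * b \<in> N \<or> val (d * a) < val (c * b)"
  proof -
    have da: "- (d * a) \<notin> N" using a mn by (simp add: mult_in_iff)
    have "val (- (d * a)) = val (d * a)" using da by (intro val_uminus) simp
    hence "[lc (- (d * a) + c * b) = lc (- (d * a))] (mod q) \<and> - (d * a) + c * b \<notin> N"
      using add_less[OF da, of "c * b"] that by auto
    hence "sg (c * b - d * a) = sg (- (d * a))" using da by (simp add: sg_def cong_0)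
    hence "sg (c * b - d * a) = - (sg d * sg a)" by (simp only: sg_uminus sg_mult)
    hence "0 \<le> - (sg a * sg b) * (sg d * sg d)" using le' by (simp add: mult_ac)
    thus False using pos sg_square[OF mn(4)] by simp
  qed
  have c: "c \<notin> N" using no N_mult by blast
  have "val (c * b) \<le> val (d * a)" using no by force
  hence "val c + val b \<le> val d + val a" using a c mn by (simp add: val_mult)
  thus "extval_le (coded_order TYPE('g)) (vK n) (vK m)"
    using mn a c by (simp add: extval_le_frac algebra_simps)
qed

text \<open>The smallest positive element of a discretely ordered ring with \<open>1\<close> is \<open>1\<close>, so by compatibility
  its nonzero elements have value at most \<open>0\<close>; and \<open>0 \<le> m - r < 1\<close> gives \<open>m - r\<close> value at least \<open>0\<close>.\<close>

lemma integer_part_weak_complement: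
  assumes I: "integer_part K frac_order I"
  shows "weak_complement K (coded_group TYPE('g)) (coded_order TYPE('g)) vK I"
proof -
  have sub: "subring I K" and disc: "discretely_ordered K frac_order I"
    and approx: "\<And>m. m \<in> carrier K \<Longrightarrow> \<exists>r\<in>I. (r, m) \<in> frac_order \<and> (m, r \<oplus>\<^bsub>K\<^esub> \<one>\<^bsub>K\<^esub>) \<in> frac_order"
    using I unfolding integer_part_def by auto
  note E = subringE[OF sub]
  have Icar: "r \<in> carrier K" if "r \<in> I" for r using E(1) that by blast
  have comp: "extval_le (coded_order TYPE('g)) (vK n) (vK m)"
    if "(\<zero>\<^bsub>K\<^esub>, m) \<in> frac_order" "m \<noteq> \<zero>\<^bsub>K\<^esub>" "(m, n) \<in> frac_order" for m n
    using compatible_K that unfolding compatible_valuation_def by blast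
  have v1: "vK \<one>\<^bsub>K\<^esub> = Fin \<one>\<^bsub>coded_group TYPE('g)\<^esub>" by (simp add: frac_one frac_val_frac coded_group_simps)
  have fsg1: "fsg \<one>\<^bsub>K\<^esub> = 1" by (simp add: frac_one fsg_frac)
  obtain e where e: "e \<in> I" "e \<noteq> \<zero>\<^bsub>K\<^esub>" "0 \<le> fsg e"
    "\<And>r. r \<in> I \<Longrightarrow> r \<noteq> \<zero>\<^bsub>K\<^esub> \<Longrightarrow> 0 \<le> fsg r \<Longrightarrow> 0 \<le> fsg (r \<ominus>\<^bsub>K\<^esub> e)"
  proof -
    obtain e where e: "e \<in> I - {\<zero>\<^bsub>K\<^esub>}" "(\<zero>\<^bsub>K\<^esub>, e) \<in> frac_order"
      "\<forall>r\<in>I - {\<zero>\<^bsub>K\<^esub>}. (\<zero>\<^bsub>K\<^esub>, r) \<in> frac_order \<longrightarrow> (e, r) \<in> frac_order"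
      using disc unfolding discretely_ordered_def by blast
    show thesis
    proof (rule that)
      show "0 \<le> fsg (r \<ominus>\<^bsub>K\<^esub> e)" if "r \<in> I" "r \<noteq> \<zero>\<^bsub>K\<^esub>" "0 \<le> fsg r" for r
        using e(3) that frac_order_zero[OF Icar[OF that(1)]] by (auto simp: frac_order_def)
    qed (use e Icar frac_order_zero in auto)
  qed
  have ecar: "e \<in> carrier K" using Icar e(1) .
  have "fsg e > 0" using e(2,3) fsg_eq_0_iff[OF ecar] by simp
  have "fsg (\<one>\<^bsub>K\<^esub> \<ominus>\<^bsub>K\<^esub> e) \<ge> 0" using e(4)[OF E(3)] fsg1 by simp
  moreover have "fsg (\<one>\<^bsub>K\<^esub> \<ominus>\<^bsub>K\<^esub> e) \<le> 0"
  proof -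
    have ee: "e \<otimes>\<^bsub>K\<^esub> e \<in> I" using E(6) e(1) by blast
    moreover have pos: "fsg (e \<otimes>\<^bsub>K\<^esub> e) > 0" using \<open>fsg e > 0\<close> ecar by (simp add: fsg_mult)
    ultimately have "0 \<le> fsg (e \<otimes>\<^bsub>K\<^esub> e \<ominus>\<^bsub>K\<^esub> e)"
      using fsg_eq_0_iff[of "e \<otimes>\<^bsub>K\<^esub> e"] ecar by (intro e(4)) auto
    also have "e \<otimes>\<^bsub>K\<^esub> e \<ominus>\<^bsub>K\<^esub> e = e \<otimes>\<^bsub>K\<^esub> (\<ominus>\<^bsub>K\<^esub> (\<one>\<^bsub>K\<^esub> \<ominus>\<^bsub>K\<^esub> e))"
      using ecar by (auto elim!: carrierE simp: frac_one mult_in_iff frac_eq_iff algebra_simps N_0)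
    also have "fsg \<dots> = fsg e * - fsg (\<one>\<^bsub>K\<^esub> \<ominus>\<^bsub>K\<^esub> e)" using ecar by (simp add: fsg_mult fsg_uminus)
    finally show ?thesis using \<open>fsg e > 0\<close> by (simp add: mult_le_0_iff)
  qed
  ultimately have "\<one>\<^bsub>K\<^esub> \<ominus>\<^bsub>K\<^esub> e = \<zero>\<^bsub>K\<^esub>" using fsg_eq_0_iff[of "\<one>\<^bsub>K\<^esub> \<ominus>\<^bsub>K\<^esub> e"] ecar by simp
  hence e1: "e = \<one>\<^bsub>K\<^esub>" using ecar by simp
  have le: "extval_le (coded_order TYPE('g)) (vK r) (vK \<one>\<^bsub>K\<^esub>)" if "r \<in> I" "r \<noteq> \<zero>\<^bsub>K\<^esub>" "0 \<le> fsg r" for r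
  proof (rule comp)
    show "(\<zero>\<^bsub>K\<^esub>, \<one>\<^bsub>K\<^esub>) \<in> frac_order" using fsg1 by (simp add: frac_order_zero)
    show "(\<one>\<^bsub>K\<^esub>, r) \<in> frac_order" using e(4)[OF that] Icar[OF that(1)] by (simp add: e1 frac_order_def)
  qed simp
  have uminus: "vK (\<ominus>\<^bsub>K\<^esub> m) = vK m" if "m \<in> carrier K" for m
    using that by (auto elim!: carrierE simp: frac_val_frac val_uminus)
  show ?thesis
    unfolding weak_complement_def
  proof (intro conjI ballI)
    show "additive_subgroup I K" using sub by (intro additive_subgroup.intro subring.axioms(1))
    show "r \<otimes>\<^bsub>K\<^esub> s \<in> I" if "r \<in> I" "s \<in> I" for r s using E(6) that by blast
    fix r assume r: "r \<in> I - {\<zero>\<^bsub>K\<^esub>}"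
    hence rcar: "r \<in> carrier K" using Icar by blast
    show "extval_le (coded_order TYPE('g)) (vK r) (Fin \<one>\<^bsub>coded_group TYPE('g)\<^esub>)"
    proof (cases "0 \<le> fsg r")
      case True thus ?thesis using le[of r] r v1 by simp
    next
      case False
      have "\<ominus>\<^bsub>K\<^esub> r \<noteq> \<zero>\<^bsub>K\<^esub>" using r rcar by simp
      thus ?thesis using le[of "\<ominus>\<^bsub>K\<^esub> r"] False r rcar E(5) v1 by (simp add: uminus fsg_uminus)
    qed
  next
    fix m assume m: "m \<in> carrier K"
    then obtain r where r: "r \<in> I" "(r, m) \<in> frac_order" "(m, r \<oplus>\<^bsub>K\<^esub> \<one>\<^bsub>K\<^esub>) \<in> frac_order" using approx by blast
    have rcar: "r \<in> carrier K" using Icar r(1) .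
    have "extval_le (coded_order TYPE('g)) (Fin \<one>\<^bsub>coded_group TYPE('g)\<^esub>) (vK (m \<ominus>\<^bsub>K\<^esub> r))"
    proof (cases "m \<ominus>\<^bsub>K\<^esub> r = \<zero>\<^bsub>K\<^esub>")
      case True
      hence "vK (m \<ominus>\<^bsub>K\<^esub> r) = Infty" using N_0 by (simp add: frac_zero frac_val_frac)
      thus ?thesis by simp
    next
      case False
      have "(\<zero>\<^bsub>K\<^esub>, m \<ominus>\<^bsub>K\<^esub> r) \<in> frac_order" using r(2) m rcar by (simp add: frac_order_def K.minus_eq)
      moreover have "\<one>\<^bsub>K\<^esub> \<ominus>\<^bsub>K\<^esub> (m \<ominus>\<^bsub>K\<^esub> r) = (r \<oplus>\<^bsub>K\<^esub> \<one>\<^bsub>K\<^esub>) \<ominus>\<^bsub>K\<^esub> m"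
        using m rcar by (auto elim!: carrierE simp: frac_one mult_in_iff frac_eq_iff algebra_simps N_0)
      hence "(m \<ominus>\<^bsub>K\<^esub> r, \<one>\<^bsub>K\<^esub>) \<in> frac_order" using r(3) m rcar by (simp add: frac_order_def)
      ultimately show ?thesis using comp[of "m \<ominus>\<^bsub>K\<^esub> r" "\<one>\<^bsub>K\<^esub>"] False v1 by simp
    qed
    thus "\<exists>r\<in>I. extval_le (coded_order TYPE('g)) (Fin \<one>\<^bsub>coded_group TYPE('g)\<^esub>) (vK (m \<ominus>\<^bsub>K\<^esub> r))"
      using r(1) by blast
  qed
qed

abbreviation "ro \<equiv> residue_order K frac_order (coded_group TYPE('g)) (coded_order TYPE('g)) vK"

text \<open>Infinitesimals do not change the sign of a nonzero constant; so the residue map transports the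
  order of the prime field to the induced order of the residue field.\<close>

lemma fsg_add_infinitesimal:
  assumes "m \<in> frac_const N" "m \<noteq> \<zero>\<^bsub>K\<^esub>" "t \<in> M\<^sub>v"
  shows "fsg (m \<oplus>\<^bsub>K\<^esub> t) = fsg m"
proof -
  obtain a b where m: "m = fr (of_int a) (of_int b)" "\<not> q dvd b" using assms(1) by (rule frac_constE)
  have a: "\<not> q dvd a" using assms(2) m by (simp add: frac_eq_zero_iff)
  have "t \<in> carrier K" using assms(3) by (simp add: valuation_ideal_def)
  then obtain c d where t: "t = fr c d" "d \<notin> N" by (rule carrierE)
  have cd: "c \<in> N \<or> val d < val c" using assms(3) t by (simp add: valuation_ideal_frac)
  have ad: "of_int a * d \<notin> N" "val (of_int a * d) = val d"
    using val_of_int[OF a] t by (simp_all add: mult_in_iff val_mult del: of_int_in_N_iff)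
  have "of_int b * c \<in> N \<or> val (of_int a * d) < val (of_int b * c)"
    using cd val_of_int[OF m(2)] ad by (cases "c \<in> N") (simp_all add: mult_in_iff val_mult)
  from add_less[OF ad(1) this] have "sg (of_int a * d + of_int b * c) = sg (of_int a * d)"
    using ad(1) by (simp add: sg_def cong_0)
  hence "fsg (m \<oplus>\<^bsub>K\<^esub> t) = sg (of_int a) * sg (of_int b) * (sg d * sg d)"
    using m t by (simp add: fsg_frac mult_in_iff sg_mult)
  thus ?thesis using m sg_square[OF t(2)] by (simp add: fsg_frac)
qed

lemma residue_order_const:
  assumes "c \<in> frac_const N" "d \<in> frac_const N"
  shows "(res c, res d) \<in> ro \<longleftrightarrow> (c, d) \<in> frac_order"
proof
  have Ov: "c \<in> carrier O\<^sub>v" "d \<in> carrier O\<^sub>v" using assms const_Ov by auto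
  have car: "c \<in> carrier K" "d \<in> carrier K" using Ov by (auto simp: valuation_ring_def)
  {
    assume "(c, d) \<in> frac_order"
    thus "(res c, res d) \<in> ro" using Ov unfolding residue_order_def by blast
  next
    assume "(res c, res d) \<in> ro"
    then obtain a b where ab: "res c = res a" "res d = res b" "a \<in> carrier O\<^sub>v" "b \<in> carrier O\<^sub>v" "(a, b) \<in> frac_order"
      unfolding residue_order_def by auto
    have "a \<in> carrier K" "b \<in> carrier K" using ab by (auto simp: valuation_ring_def)
    note car = car this
    define t where "t = (c \<ominus>\<^bsub>K\<^esub> a) \<oplus>\<^bsub>K\<^esub> (b \<ominus>\<^bsub>K\<^esub> d)"
    have "c \<ominus>\<^bsub>K\<^esub> a \<in> M\<^sub>v" "b \<ominus>\<^bsub>K\<^esub> d \<in> M\<^sub>v"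
      using res_eq_iff[OF Ov(1) ab(3)] res_eq_iff[OF ab(4) Ov(2)] ab(1,2) by auto
    hence t: "t \<in> M\<^sub>v" using additive_subgroup.a_closed[OF ideal.axioms(1)[OF ideal_Mv]]
      unfolding t_def by (simp add: Ov_simps)
    have eq: "b \<ominus>\<^bsub>K\<^esub> a = (d \<ominus>\<^bsub>K\<^esub> c) \<oplus>\<^bsub>K\<^esub> t"
      using car unfolding t_def by (auto elim!: carrierE simp: mult_in_iff frac_eq_iff algebra_simps N_0)
    show "(c, d) \<in> frac_order"
    proof (cases "d \<ominus>\<^bsub>K\<^esub> c = \<zero>\<^bsub>K\<^esub>")
      case True
      hence "fsg (d \<ominus>\<^bsub>K\<^esub> c) = 0" by (simp add: fsg_eq_0_iff)
      thus ?thesis using car by (simp add: frac_order_def)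
    next
      case False
      hence "fsg (b \<ominus>\<^bsub>K\<^esub> a) = fsg (d \<ominus>\<^bsub>K\<^esub> c)"
        unfolding eq by (intro fsg_add_infinitesimal const_minus assms t)
      thus ?thesis using ab(5) car by (simp add: frac_order_def)
    qed
  }
qed

lemma residue_orderE:
  assumes "(A, B) \<in> ro"
  obtains c d where "A = res c" "B = res d" "c \<in> frac_const N" "d \<in> frac_const N" "(c, d) \<in> frac_order"
proof -
  have "A \<in> carrier Rv" "B \<in> carrier Rv" using assms unfolding residue_order_def carrier_Rv by auto
  then obtain c d where "c \<in> frac_const N" "A = res c" "d \<in> frac_const N" "B = res d" using Rv_const by metis
  thus thesis using that residue_order_const assms by blast
qed

text \<open>The ordered residue field is the field of rational numbers, which is archimedean.\<close>

lemma natural_valuation_K: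
  "natural_valuation K frac_order (coded_group TYPE('g)) (coded_order TYPE('g)) vK"
proof -
  interpret KO: ordered_field K frac_order by (rule ordered_field_K)
  let ?F = "K\<lparr>carrier := frac_const N\<rparr>"
  have F: "field ?F" using K.subfield_iff(2)[OF frac_const_subfield] .
  have car: "c \<in> carrier K" if "c \<in> frac_const N" for c using that subringE(1)[OF frac_const_subring] by auto
  have res_add: "res c \<oplus>\<^bsub>Rv\<^esub> res d = res (c \<oplus>\<^bsub>K\<^esub> d)" and res_mult: "res c \<otimes>\<^bsub>Rv\<^esub> res d = res (c \<otimes>\<^bsub>K\<^esub> d)"
    and closed: "c \<oplus>\<^bsub>K\<^esub> d \<in> frac_const N" "c \<otimes>\<^bsub>K\<^esub> d \<in> frac_const N"
    if "c \<in> frac_const N" "d \<in> frac_const N" for c d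
  proof -
    have "c \<in> carrier O\<^sub>v" "d \<in> carrier O\<^sub>v" using that const_Ov by auto
    thus "res c \<oplus>\<^bsub>Rv\<^esub> res d = res (c \<oplus>\<^bsub>K\<^esub> d)" "res c \<otimes>\<^bsub>Rv\<^esub> res d = res (c \<otimes>\<^bsub>K\<^esub> d)"
      using ring_hom_add[OF res_hom] ring_hom_mult[OF res_hom] by (simp_all add: Ov_simps)
    show "c \<oplus>\<^bsub>K\<^esub> d \<in> frac_const N" "c \<otimes>\<^bsub>K\<^esub> d \<in> frac_const N"
      using subringE(6,7)[OF frac_const_subring] that by auto
  qed
  have zero: "\<zero>\<^bsub>K\<^esub> \<in> frac_const N" and one: "\<one>\<^bsub>K\<^esub> \<in> frac_const N"
    using subringE(2,3)[OF frac_const_subring] by auto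
  have res_one: "\<one>\<^bsub>Rv\<^esub> = res \<one>\<^bsub>K\<^esub>" using ring_hom_one[OF res_hom] by (simp add: Ov_simps)
  have "ring Rv" using ideal.quotient_is_ring[OF ideal_Mv] by (simp add: residue_field_def)
  then interpret Rv: ring Rv .
  have res_zero: "\<zero>\<^bsub>Rv\<^esub> = res \<zero>\<^bsub>K\<^esub>"
  proof -
    have "res \<zero>\<^bsub>K\<^esub> \<oplus>\<^bsub>Rv\<^esub> res \<zero>\<^bsub>K\<^esub> = res \<zero>\<^bsub>K\<^esub>" using res_add[OF zero zero] by simp
    moreover have "res \<zero>\<^bsub>K\<^esub> \<in> carrier Rv" using zero const_Ov by (auto simp: carrier_Rv)
    ultimately show ?thesis using Rv.add.r_cancel_one[of "res \<zero>\<^bsub>K\<^esub>" "res \<zero>\<^bsub>K\<^esub>"] by simp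
  qed
  have "field (Rv\<lparr>zero := res \<zero>\<^bsub>?F\<^esub>\<rparr>)"
    by (rule field.ring_iso_imp_img_field[OF F const_res_iso])
  moreover have "Rv\<lparr>zero := res \<zero>\<^bsub>?F\<^esub>\<rparr> = Rv" using res_zero by (cases Rv) simp
  ultimately have field_Rv: "field Rv" by simp
  have trans: "(c, e) \<in> frac_order" if "(c, d) \<in> frac_order" "(d, e) \<in> frac_order" for c d e
    using frac_order_linear that
    unfolding linear_order_on_def partial_order_on_def preorder_on_def by (blast dest: transD)
  have antisym: "c = d" if "(c, d) \<in> frac_order" "(d, c) \<in> frac_order" for c d
    using frac_order_linear that
    unfolding linear_order_on_def partial_order_on_def by (blast dest: antisymD)
  have total: "(c, d) \<in> frac_order \<or> (d, c) \<in> frac_order" if "c \<in> carrier K" "d \<in> carrier K" for c d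
    using frac_order_linear that
    unfolding linear_order_on_def partial_order_on_def preorder_on_def total_on_def refl_on_def by metis
  have "ordered_field Rv ro"
  proof (intro ordered_field.intro field_Rv ordered_field_axioms.intro)
    show "linear_order_on (carrier Rv) ro"
      unfolding linear_order_on_def partial_order_on_def preorder_on_def
    proof (intro conjI)
      show "ro \<subseteq> carrier Rv \<times> carrier Rv" unfolding residue_order_def carrier_Rv by auto
      show "refl_on (carrier Rv) ro"
      proof (rule refl_onI)
        fix A assume "A \<in> carrier Rv"
        then obtain c where "c \<in> frac_const N" "A = res c" using Rv_const by blast
        thus "(A, A) \<in> ro" using residue_order_const[of c c] total[of c c] car by blast
      qed
      show "trans ro"
      proof (rule transI)
        fix A B C assume "(A, B) \<in> ro" "(B, C) \<in> ro"
        then obtain c d d' e where *: "A = res c" "B = res d" "c \<in> frac_const N" "d \<in> frac_const N" "(c, d) \<in> frac_order"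
          "B = res d'" "C = res e" "d' \<in> frac_const N" "e \<in> frac_const N" "(d', e) \<in> frac_order"
          by (elim residue_orderE)
        hence "d = d'" using res_const_inj by blast
        thus "(A, C) \<in> ro" using * trans residue_order_const by metis
      qed
      show "antisym ro"
      proof (rule antisymI)
        fix A B assume "(A, B) \<in> ro" "(B, A) \<in> ro"
        then obtain c d d' e where *: "A = res c" "B = res d" "c \<in> frac_const N" "d \<in> frac_const N" "(c, d) \<in> frac_order"
          "B = res d'" "A = res e" "d' \<in> frac_const N" "e \<in> frac_const N" "(d', e) \<in> frac_order"
          by (elim residue_orderE)
        hence "d = d'" "c = e" using res_const_inj by blast+
        thus "A = B" using * antisym by blast
      qed
      show "total_on (carrier Rv) ro"
      proof (rule total_onI)
        fix A B assume "A \<in> carrier Rv" "B \<in> carrier Rv"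
        then obtain c d where "c \<in> frac_const N" "A = res c" "d \<in> frac_const N" "B = res d" using Rv_const by metis
        thus "(A, B) \<in> ro \<or> (B, A) \<in> ro" using residue_order_const total car by metis
      qed
    qed
  next
    fix A B C assume "(A, B) \<in> ro" "C \<in> carrier Rv"
    then obtain c d e where *: "A = res c" "B = res d" "c \<in> frac_const N" "d \<in> frac_const N" "(c, d) \<in> frac_order"
      "e \<in> frac_const N" "C = res e" using Rv_const by (metis residue_orderE)
    have "(e \<oplus>\<^bsub>K\<^esub> c, e \<oplus>\<^bsub>K\<^esub> d) \<in> frac_order" using * car KO.add_mono by blast
    thus "(C \<oplus>\<^bsub>Rv\<^esub> A, C \<oplus>\<^bsub>Rv\<^esub> B) \<in> ro" using * by (simp add: res_add closed residue_order_const)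
  next
    fix A B assume *: "(\<zero>\<^bsub>Rv\<^esub>, A) \<in> ro" "(\<zero>\<^bsub>Rv\<^esub>, B) \<in> ro"
    hence "A \<in> carrier Rv" "B \<in> carrier Rv" unfolding residue_order_def carrier_Rv by auto
    then obtain c d where cd: "c \<in> frac_const N" "A = res c" "d \<in> frac_const N" "B = res d" using Rv_const by metis
    hence "(\<zero>\<^bsub>K\<^esub>, c) \<in> frac_order" "(\<zero>\<^bsub>K\<^esub>, d) \<in> frac_order"
      using * zero residue_order_const by (simp_all add: res_zero)
    hence "(\<zero>\<^bsub>K\<^esub>, c \<otimes>\<^bsub>K\<^esub> d) \<in> frac_order" by (rule KO.mult_nonneg)
    thus "(\<zero>\<^bsub>Rv\<^esub>, A \<otimes>\<^bsub>Rv\<^esub> B) \<in> ro" using cd zero by (simp add: res_mult closed residue_order_const res_zero)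
  qed
  moreover have "\<exists>n :: nat. (A, [n] \<cdot>\<^bsub>Rv\<^esub> \<one>\<^bsub>Rv\<^esub>) \<in> ro" if A: "A \<in> carrier Rv" for A
  proof -
    obtain c where c: "c \<in> frac_const N" "A = res c" using Rv_const[OF A] by blast
    obtain a b where ab: "c = fr (of_int a) (of_int b)" "\<not> q dvd b" using c(1) by (rule frac_constE)
    have int_const: "fr (of_int m) 1 \<in> frac_const N" for m
      using frac_constI[of 1 m] char_not_dvd_1[OF char] by simp
    have n: "[n] \<cdot>\<^bsub>Rv\<^esub> \<one>\<^bsub>Rv\<^esub> = res (fr (of_int (int n)) 1)" for n
    proof (induction n)
      case 0
      show ?case by (simp add: res_zero frac_zero)
    next
      case (Suc n)
      have "fr (of_nat n) 1 \<in> frac_const N" using int_const[of "int n"] by simp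
      hence "[Suc n] \<cdot>\<^bsub>Rv\<^esub> \<one>\<^bsub>Rv\<^esub> = res (fr (of_int (int n)) 1 \<oplus>\<^bsub>K\<^esub> \<one>\<^bsub>K\<^esub>)"
        using Suc one by (simp add: res_one res_add)
      thus ?case by (simp add: frac_one add.commute)
    qed
    define n where "n = nat \<bar>a\<bar>"
    have b: "b \<noteq> 0" using ab(2) by (simp add: q_0)
    have "a * b \<le> \<bar>a\<bar> * \<bar>b\<bar>" by (metis abs_ge_self abs_mult)
    also have "\<dots> \<le> \<bar>a\<bar> * (b * b)"
    proof (rule mult_left_mono)
      have "1 * \<bar>b\<bar> \<le> \<bar>b\<bar> * \<bar>b\<bar>" using b by (intro mult_right_mono) auto
      thus "\<bar>b\<bar> \<le> b * b" by simp
    qed simp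
    finally have "0 \<le> (int n * b - a) * b" by (simp add: n_def algebra_simps)
    hence "0 \<le> sgn ((int n * b - a) * b)" by (simp add: sgn_if)
    also have "\<dots> = fsg (fr (of_int (int n)) 1 \<ominus>\<^bsub>K\<^esub> c)"
      using ab(2) by (simp add: ab(1) fsg_frac sgn_mult sg_of_int[symmetric] sg_mult)
    finally have "(c, fr (of_int (int n)) 1) \<in> frac_order"
      using c(1) car int_const by (auto simp: frac_order_def)
    hence "(A, [n] \<cdot>\<^bsub>Rv\<^esub> \<one>\<^bsub>Rv\<^esub>) \<in> ro" unfolding n c(2)
      using residue_order_const[OF c(1) int_const] by blast
    thus ?thesis by blast
  qed
  ultimately show ?thesis
    unfolding natural_valuation_def archimedean_ordered_field_def using compatible_K by blast
qed

end

section \<open>The rational function fields\<close>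

context tower_valuation
begin

sublocale V: countable_leading_valuation q "null q" v vlc ..

text \<open>The variables are algebraically independent: after clearing the denominators of the coefficients,
  a relation is a polynomial that vanishes modulo \<open>q\<close>, coefficient by coefficient.\<close>

lemma rational_function_field_K:
  assumes ix: "bij_betw ix {..<m} (UNIV :: 'i set)"
  shows "rational_function_field V.K V.const_field m"
proof -
  let ?N = "null q :: 'i mpoly set"
  let ?x = "\<lambda>i. V.fr (mvar (ix i)) 1"
  have x: "?x \<in> {..<m} \<rightarrow> carrier V.K" by simp
  have independent: "algebraically_independent V.K (frac_const ?N) m ?x"
    unfolding algebraically_independent_def
  proof (intro allI impI, elim conjE)
    fix E and c :: "(nat \<Rightarrow> nat) \<Rightarrow> nat"
    assume E: "finite E" "E \<subseteq> {..<m} \<rightarrow>\<^sub>E UNIV" and c: "c \<in> E \<rightarrow> frac_const ?N"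
      and sum: "finsum V.K (\<lambda>e. c e \<otimes>\<^bsub>V.K\<^esub> finprod V.K (\<lambda>i. ?x i [^]\<^bsub>V.K\<^esub> e i) {..<m}) E = \<zero>\<^bsub>V.K\<^esub>"
    define mon where "mon e = (\<lambda>j. e (inv_into {..<m} ix j) :: nat)" for e :: "nat \<Rightarrow> nat"
    have mon: "finprod V.K (\<lambda>i. ?x i [^]\<^bsub>V.K\<^esub> e i) {..<m} = V.fr (single (mon e) 1) 1" for e
    proof -
      have "finprod V.K (\<lambda>i. ?x i [^]\<^bsub>V.K\<^esub> e i) {..<m} = V.fr (\<Prod>i<m. mvar (ix i) ^ e i) 1"
        by (simp add: V.frac_pow V.frac_finprod)
      also have "(\<Prod>i<m. mvar (ix i) ^ e i) = (\<Prod>i<m. mvar (ix i) ^ mon e (ix i))"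
        using bij_betw_imp_inj_on[OF ix] by (intro prod.cong) (auto simp: mon_def)
      also have "\<dots> = (\<Prod>j\<in>UNIV. mvar j ^ mon e j)" by (rule prod.reindex_bij_betw[OF ix])
      also have "\<dots> = single (mon e) 1" by (simp add: single_eq_prod)
      finally show ?thesis .
    qed
    have mon_inj: "e = e'" if "e \<in> E" "e' \<in> E" "mon e = mon e'" for e e'
    proof (rule PiE_ext)
      show "e \<in> {..<m} \<rightarrow>\<^sub>E UNIV" "e' \<in> {..<m} \<rightarrow>\<^sub>E UNIV" using that E by auto
      fix i assume i: "i \<in> {..<m}"
      have "mon e (ix i) = mon e' (ix i)" using that by simp
      thus "e i = e' i" using i bij_betw_imp_inj_on[OF ix] by (simp add: mon_def)
    qed
    have "\<forall>e\<in>E. \<exists>p. c e = V.fr (of_int (fst p)) (of_int (snd p)) \<and> \<not> q dvd snd p"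
    proof
      fix e assume "e \<in> E"
      hence "c e \<in> frac_const ?N" using c by blast
      then obtain a b where "c e = V.fr (of_int a) (of_int b)" "\<not> q dvd b" by (rule V.frac_constE)
      thus "\<exists>p. c e = V.fr (of_int (fst p)) (of_int (snd p)) \<and> \<not> q dvd snd p" by (intro exI[of _ "(a, b)"]) simp
    qed
    from bchoice[OF this] obtain p where p: "\<forall>e\<in>E. c e = V.fr (of_int (fst (p e))) (of_int (snd (p e))) \<and> \<not> q dvd snd (p e)"
      by (elim exE)
    define D where "D = (\<Prod>e\<in>E. snd (p e))"
    define M where "M e = fst (p e) * (\<Prod>e'\<in>E - {e}. snd (p e'))" for e
    have ndvd: "\<not> q dvd (\<Prod>e\<in>E'. snd (p e))" if "E' \<subseteq> E" for E'
    proof -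
      have "finite E'" using that E(1) finite_subset by blast
      thus ?thesis using that p char_dvd_mult[OF char] char_not_dvd_1[OF char]
        by (induction E' rule: finite_induct) auto
    qed
    have Dc: "V.fr (of_int D) 1 \<otimes>\<^bsub>V.K\<^esub> (c e \<otimes>\<^bsub>V.K\<^esub> V.fr (single (mon e) 1) 1) = V.fr (of_int (M e) * single (mon e) 1) 1"
      if e: "e \<in> E" for e
    proof -
      have "D = snd (p e) * (\<Prod>e'\<in>E - {e}. snd (p e'))" unfolding D_def using e E(1) by (rule prod.remove[rotated])
      hence D: "(of_int D :: 'i mpoly) = of_int (snd (p e)) * of_int (\<Prod>e'\<in>E - {e}. snd (p e'))" by (simp only: of_int_mult)
      have nd: "of_int (snd (p e)) \<notin> ?N" using p e by simp
      have eq: "c e = V.fr (of_int (fst (p e))) (of_int (snd (p e)))" using p e by blast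
      have "of_int D * (of_int (fst (p e)) * single (mon e) 1) * 1 - 1 * (of_int (snd (p e)) * 1) * (of_int (M e) * single (mon e) 1) = (0 :: 'i mpoly)"
        unfolding D M_def of_int_mult by (simp only: mult_ac mult_1_left mult_1_right diff_self)
      hence "of_int D * (of_int (fst (p e)) * single (mon e) 1) * 1 - 1 * (of_int (snd (p e)) * 1) * (of_int (M e) * single (mon e) 1) \<in> ?N"
        by (simp only: null_0)
      thus ?thesis unfolding eq using nd
        by (simp only: V.frac_mult V.frac_eq_iff V.one_notin V.mult_in_iff not_False_eq_True de_Morgan_disj simp_thms)
    qed
    have cK: "c e \<in> carrier V.K" if "e \<in> E" for e
    proof -
      have "c e \<in> frac_const ?N" using c that by blast
      thus ?thesis using subringE(1)[OF V.frac_const_subring] by (rule subsetD[rotated])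
    qed
    have "\<zero>\<^bsub>V.K\<^esub> = V.fr (of_int D) 1 \<otimes>\<^bsub>V.K\<^esub> finsum V.K (\<lambda>e. c e \<otimes>\<^bsub>V.K\<^esub> V.fr (single (mon e) 1) 1) E"
      using sum unfolding mon by simp
    also have "\<dots> = finsum V.K (\<lambda>e. V.fr (of_int D) 1 \<otimes>\<^bsub>V.K\<^esub> (c e \<otimes>\<^bsub>V.K\<^esub> V.fr (single (mon e) 1) 1)) E"
      using E(1) cK by (intro V.K.finsum_rdistr) auto
    also have "\<dots> = finsum V.K (\<lambda>e. V.fr (of_int (M e) * single (mon e) 1) 1) E"
      by (intro V.K.finsum_cong') (use Dc in auto)
    also have "\<dots> = V.fr (\<Sum>e\<in>E. of_int (M e) * single (mon e) 1) 1" by (rule V.frac_finsum) (rule E(1))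
    finally have "V.fr (\<Sum>e\<in>E. of_int (M e) * single (mon e) 1) 1 = \<zero>\<^bsub>V.K\<^esub>" by (rule sym)
    hence null: "(\<Sum>e\<in>E. of_int (M e) * single (mon e) 1) \<in> ?N"
      by (simp only: V.frac_eq_zero_iff[OF V.one_notin])
    show "\<forall>e\<in>E. c e = \<zero>\<^bsub>V.K\<^esub>"
    proof
      fix e assume e: "e \<in> E"
      have "lookup (\<Sum>e\<in>E. of_int (M e) * single (mon e) 1) (mon e) = (\<Sum>e'\<in>E. if e' = e then M e else 0)"
        unfolding lookup_sum
        by (intro sum.cong refl) (use e mon_inj in \<open>auto simp: lookup_single when_def\<close>)
      also have "\<dots> = M e" using E(1) e by simp
      finally have M: "lookup (\<Sum>e\<in>E. of_int (M e) * single (mon e) 1) (mon e) = M e" .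
      have "q dvd lookup (\<Sum>e\<in>E. of_int (M e) * single (mon e) 1) (mon e)"
        using null unfolding null_def mem_Collect_eq by (rule spec)
      hence "q dvd fst (p e) * (\<Prod>e'\<in>E - {e}. snd (p e'))" unfolding M unfolding M_def .
      moreover have "\<not> q dvd (\<Prod>e'\<in>E - {e}. snd (p e'))" by (rule ndvd) blast
      ultimately have "q dvd fst (p e)" by (simp only: char_dvd_mult[OF char] simp_thms)
      thus "c e = \<zero>\<^bsub>V.K\<^esub>" using p e by (simp add: V.frac_eq_zero_iff)
    qed
  qed
  let ?G = "generate_field V.K (frac_const ?N \<union> ?x ` {..<m})"
  have sub: "frac_const ?N \<union> ?x ` {..<m} \<subseteq> carrier V.K"
    using subringE(1)[OF V.frac_const_subring] by auto
  have poly: "V.fr f 1 \<in> ?G" for f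
  proof (induction f rule: mpoly_induct)
    case (const n)
    have "V.fr (of_int n) 1 \<in> frac_const ?N" using V.frac_constI[of 1 n] char_not_dvd_1[OF char] by simp
    thus ?case by (intro generate_field.incl) simp
  next
    case (var j)
    obtain i where "i < m" "j = ix i" using bij_betw_imp_surj_on[OF ix] by auto
    thus ?case by (intro generate_field.incl) auto
  next
    case (add f g)
    thus ?case using generate_field.eng_add[OF add] by simp
  next
    case (mult f g)
    thus ?case using generate_field.eng_mult[OF mult] by simp
  qed
  have "?G = carrier V.K"
  proof
    show "?G \<subseteq> carrier V.K" using V.K.generate_field_in_carrier[OF sub] by auto
    show "carrier V.K \<subseteq> ?G"
    proof
      fix k assume "k \<in> carrier V.K"
      then obtain a b where k: "k = V.fr a b" "b \<notin> ?N" by (rule V.carrierE)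
      have "inv\<^bsub>V.K\<^esub> V.fr b 1 \<in> ?G" using k by (intro generate_field.m_inv poly) (simp add: V.frac_eq_zero_iff)
      from generate_field.eng_mult[OF poly[of a] this] show "k \<in> ?G" using k by (simp add: V.frac_inverse)
    qed
  qed
  hence "algebraically_independent V.K (frac_const ?N) m ?x \<and>
      generate_field V.K (frac_const ?N \<union> ?x ` {..<m}) = carrier V.K" using independent by blast
  thus ?thesis
    unfolding rational_function_field_def using V.field_K V.frac_const_subfield x
    by (intro conjI bexI[of _ ?x]) simp_all
qed

lemma weak_complement_imp_pair_complement:
  assumes "weak_complement V.K (coded_group TYPE(lex_vector)) (coded_order TYPE(lex_vector)) V.vK R"
  shows "pair_complement q x u w S \<alpha> {(a, b). b \<notin> null q \<and> V.fr a b \<in> R}"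
proof -
  note * = V.weak_complement_pairs[OF assms]
  show ?thesis
  proof (intro pair_complement.intro tower_valuation_axioms pair_complement_axioms.intro)
    show "V.pair_ring {(a, b). b \<notin> null q \<and> V.fr a b \<in> R}"
      by (rule V.pair_ringI) (fact *)+
  qed (fact *)+
qed

end

lemma field_rat_ring: "field rat_ring"
proof -
  interpret cring rat_ring
  proof (rule cringI)
    show "abelian_group rat_ring"
    proof (rule abelian_groupI)
      fix r assume "r \<in> carrier rat_ring"
      show "\<exists>s\<in>carrier rat_ring. s \<oplus>\<^bsub>rat_ring\<^esub> r = \<zero>\<^bsub>rat_ring\<^esub>"
        by (intro bexI[of _ "- r"]) (simp_all add: rat_ring_def)
    qed (simp_all add: rat_ring_def)
    show "comm_monoid rat_ring" by (rule comm_monoidI) (simp_all add: rat_ring_def)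
  qed (simp add: rat_ring_def distrib_right)
  show ?thesis
  proof (rule cring_fieldI2)
    fix r assume "r \<in> carrier rat_ring" "r \<noteq> \<zero>\<^bsub>rat_ring\<^esub>"
    thus "\<exists>s\<in>carrier rat_ring. r \<otimes>\<^bsub>rat_ring\<^esub> s = \<one>\<^bsub>rat_ring\<^esub>"
      by (intro bexI[of _ "inverse r"]) (simp_all add: rat_ring_def)
  qed (simp add: rat_ring_def)
qed

context tower_valuation
begin

text \<open>At the rational place the value group is free on the values of \<open>x\<close>, \<open>s\<close> and \<open>z\<^sub>0\<close>, and the products of
  powers of these three elements form a cross-section.\<close>

lemma cross_section_exists:
  assumes \<alpha>: "\<And>n. \<alpha> n = 1" and S: "S = {s}"
  shows "\<exists>f. cross_section V.K (coded_group TYPE(lex_vector)) V.vK f"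
proof -
  have int: "\<exists>i. lookup (v f) k = of_int i" and zero: "k \<notin> {0, 2, 3} \<Longrightarrow> lookup (v f) k = 0"
    if f: "f \<notin> null q" for f k
  proof -
    obtain n e h where r: "rep f n e h" using rep_exists f by blast
    then obtain l where l: "mval (\<alpha> n) (Res h) = wt (\<alpha> n) l" "l u = 0"
      using mval_Res[OF \<alpha>_nonzero, of h n] unfolding rep_def by metis
    have sum_S: "(\<Sum>i\<in>S. l i) = l s" by (simp add: S)
    have "lookup (v f) k = of_int (if k = 0 then int e + int (l x) else if k = 2 then int (l s)
        else if k = 3 then int (l w) else 0)"
      unfolding v_rep(1)[OF r] l(1)
      using l(2) sum_S by (simp add: lookup_add lookup_xpart lookup_wt \<alpha> del: of_nat_sum)
    thus "\<exists>i. lookup (v f) k = of_int i" "k \<notin> {0, 2, 3} \<Longrightarrow> lookup (v f) k = 0" by auto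
  qed
  have lookup_power: "lookup (v (f ^ m)) k = of_nat m * lookup (v f) k" if "f \<notin> null q" for f m k
    using that by (induction m) (simp_all add: V.val_power_Suc lookup_add algebra_simps del: power_Suc)
  have vU: "lookup (v U) k = (if k = 3 then 1 else 0)" for k
  proof -
    have r: "rep U 0 0 U" using W_poly_val[of 1 1] by (simp add: rep_def Res_mvar)
    show ?thesis using W_poly_val[of 1 1] vars_distinct
      by (auto simp: v_rep(1)[OF r] \<alpha> Res_mvar lookup_add lookup_xpart lookup_wt unit_exp_def)
  qed
  have vX: "lookup (v X) k = (if k = 0 then 1 else 0)" for k
    using v_X_power(2)[of 1] by (simp add: lookup_xpart)
  have vs: "lookup (v (mvar s)) k = (if k = 2 then 1 else 0)" for k
    by (rule v_S_var) (simp add: S)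
  define mon where "mon i j l = X ^ nat i * mvar s ^ nat j * U ^ nat l" for i j l
  have mon: "mon i j l \<notin> null q" "lookup (v (mon i j l)) k =
      (if k = 0 then of_nat (nat i) else if k = 2 then of_nat (nat j) else if k = 3 then of_nat (nat l) else 0)" for i j l k
    by (simp_all add: mon_def M.mult_in_iff M.power_notin V.val_mult lookup_add lookup_power vX vs vU)
  \<comment> \<open>Since \<open>nat\<close> cuts off at \<open>0\<close>, the negative exponents are exactly those of the denominator.\<close>
  define t where "t i j l = V.fr (mon i j l) (mon (- i) (- j) (- l))" for i j l
  have t_carrier: "t i j l \<in> carrier V.K" for i j l by (simp add: t_def mon)
  have t_val: "V.vK (t i j l) = Fin (to_nat g)"
    if "lookup g 0 = of_int i" "lookup g 2 = of_int j" "lookup g 3 = of_int l" "\<And>k. k \<notin> {0, 2, 3} \<Longrightarrow> lookup g k = 0"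
    for g :: lex_vector and i j l
  proof -
    have nat: "of_nat (nat i) - of_nat (nat (- i)) = (of_int i :: rat)" for i
      by (cases "i \<ge> 0") simp_all
    have "v (mon i j l) - v (mon (- i) (- j) (- l)) = g"
      unfolding lex_eq_iff lookup_minus mon by (auto simp: that nat)
    thus ?thesis by (simp add: t_def V.frac_val_frac mon)
  qed
  have t_mult: "t (i + i') (j + j') (l + l') = t i j l \<otimes>\<^bsub>V.K\<^esub> t i' j' l'" for i j l i' j' l'
  proof -
    have pw: "p ^ nat (i + i') * (p ^ nat (- i) * p ^ nat (- i')) = p ^ nat (- (i + i')) * (p ^ nat i * p ^ nat i')"
      for p :: "'i mpoly" and i i' :: int
      unfolding power_add[symmetric] by (rule arg_cong[of _ _ "\<lambda>m. p ^ m"]) simp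
    have "mon (i + i') (j + j') (l + l') * (mon (- i) (- j) (- l) * mon (- i') (- j') (- l')) =
      (X ^ nat (i + i') * (X ^ nat (- i) * X ^ nat (- i'))) *
      (mvar s ^ nat (j + j') * (mvar s ^ nat (- j) * mvar s ^ nat (- j'))) *
      (U ^ nat (l + l') * (U ^ nat (- l) * U ^ nat (- l')))"
      unfolding mon_def by (simp only: mult_ac)
    also have "\<dots> = mon (- (i + i')) (- (j + j')) (- (l + l')) * (mon i j l * mon i' j' l')"
      unfolding pw mon_def by (simp only: mult_ac)
    finally show ?thesis by (simp add: t_def V.frac_eq_iff M.mult_in_iff mon)
  qed
  define \<tau> where "\<tau> g = t \<lfloor>lookup g 0\<rfloor> \<lfloor>lookup g 2\<rfloor> \<lfloor>lookup g 3\<rfloor>" for g :: lex_vector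
  have integral_values: "(\<exists>i j l. lookup g 0 = of_int i \<and> lookup g 2 = of_int j \<and> lookup g 3 = of_int l) \<and> (\<forall>k. k \<notin> {0, 2, 3} \<longrightarrow> lookup g k = 0)"
    if g: "g \<in> {v a - v b | a b. a \<notin> null q \<and> b \<notin> null q}" for g
  proof -
    obtain a b where ab: "g = v a - v b" "a \<notin> null q" "b \<notin> null q" using g by blast
    have "\<exists>i. lookup g k = of_int i" for k
      using int[OF ab(2), of k] int[OF ab(3), of k] by (metis ab(1) lookup_minus of_int_diff)
    thus ?thesis using zero ab by (simp add: lookup_minus)
  qed
  have "cross_section V.K (coded_group TYPE(lex_vector)) V.vK (\<lambda>n. \<tau> (from_nat n))"
  proof (rule V.cross_sectionI)
    fix g assume "g \<in> {v a - v b | a b. a \<notin> null q \<and> b \<notin> null q}"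
    from integral_values[OF this] obtain i j l where g: "lookup g 0 = of_int i" "lookup g 2 = of_int j" "lookup g 3 = of_int l"
      "\<And>k. k \<notin> {0, 2, 3} \<Longrightarrow> lookup g k = 0" by blast
    show "\<tau> g \<in> carrier V.K \<and> V.vK (\<tau> g) = Fin (to_nat g)"
      using t_val[OF g] t_carrier by (simp add: \<tau>_def g)
    fix g' assume "g' \<in> {v a - v b | a b. a \<notin> null q \<and> b \<notin> null q}"
    from integral_values[OF this] obtain i' j' l' where g': "lookup g' 0 = of_int i'" "lookup g' 2 = of_int j'" "lookup g' 3 = of_int l'"
      by blast
    show "\<tau> (g + g') = \<tau> g \<otimes>\<^bsub>V.K\<^esub> \<tau> g'"
      using t_mult[of i i' j j' l l'] by (simp add: \<tau>_def g g' lookup_add)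
  qed
  thus ?thesis by blast
qed

lemma rational_function_field_card:
  assumes "m = 3 + card S"
  shows "rational_function_field V.K V.const_field m"
proof -
  have "finite S" by simp
  hence "card (UNIV :: 'i set) = m"
    unfolding vars_UNIV assms using vars_distinct by (simp add: card_insert_if)
  then obtain ix where "bij_betw ix {..<m} (UNIV :: 'i set)"
    using ex_bij_betw_nat_finite[of "UNIV :: 'i set"] by (auto simp: atLeast0LessThan)
  thus ?thesis by (rule rational_function_field_K)
qed

end

theorem theorem7:
  shows "((\<forall>k :: 'k ring. prime_field k \<longrightarrow>
             (\<exists>(K :: nat ring) F (\<Gamma> :: nat monoid) leq v.
                rational_function_field K F 3 \<and> K\<lparr>carrier := F\<rparr> \<simeq> k \<and>
                valued_field K \<Gamma> leq v \<and> trivially_valued K \<Gamma> v F \<and>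
                \<not> (\<exists>R. weak_complement K \<Gamma> leq v R))) \<and>
          (\<exists>(K :: nat ring) F leK.
                rational_function_field K F 3 \<and> K\<lparr>carrier := F\<rparr> \<simeq> rat_ring \<and>
                ordered_field K leK \<and>
                \<not> (\<exists>I. integer_part K leK I))) \<and>
         ((\<forall>k :: 'k ring. prime_field k \<longrightarrow>
             (\<exists>(K :: nat ring) F (\<Gamma> :: nat monoid) leq v.
                rational_function_field K F 4 \<and> K\<lparr>carrier := F\<rparr> \<simeq> k \<and>
                valued_field K \<Gamma> leq v \<and> trivially_valued K \<Gamma> v F \<and>
                \<not> (\<exists>R. weak_complement K \<Gamma> leq v R) \<and>
                (\<exists>f. residue_field_embedding K \<Gamma> leq v f) \<and>
                (\<exists>s. cross_section K \<Gamma> v s))) \<and>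
          (\<exists>(K :: nat ring) F leK.
                rational_function_field K F 4 \<and> K\<lparr>carrier := F\<rparr> \<simeq> rat_ring \<and>
                ordered_field K leK \<and>
                \<not> (\<exists>I. integer_part K leK I) \<and>
                (\<exists>(\<Gamma> :: nat monoid) leq v.
                   natural_valuation K leK \<Gamma> leq v \<and>
                   (\<exists>f. residue_field_embedding K \<Gamma> leq v f) \<and>
                   (\<exists>s. cross_section K \<Gamma> v s))))"
proof -
  \<comment> \<open>Types with three and four elements serve as sets of variables.\<close>
  let ?x3 = "None :: bool option" and ?u3 = "Some True" and ?w3 = "Some False"
  let ?x4 = "None :: bool option option" and ?u4 = "Some None" and ?w4 = "Some (Some True)"
    and ?s4 = "Some (Some False)"
  have UNIV3: "(UNIV :: bool option set) = {?x3, ?u3, ?w3}"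
    by (auto simp: UNIV_option_conv UNIV_bool)
  have UNIV4: "(UNIV :: bool option option set) = {?x4, ?u4, ?w4, ?s4}"
    by (auto simp: UNIV_option_conv UNIV_bool)
  have tower3: "tower q ?x3 ?u3 ?w3 {}" if "char_zero_or_prime q" for q
    by (rule tower.intro) (simp_all add: that UNIV3)
  have tower4: "tower q ?x4 ?u4 ?w4 {?s4}" if "char_zero_or_prime q" for q
    by (rule tower.intro) (simp_all add: that UNIV4)
  have val3: "tower_valuation q ?x3 ?u3 ?w3 {} inf_slope" if "char_zero_or_prime q" for q
  proof -
    interpret tower q ?x3 ?u3 ?w3 "{}" by (rule tower3) fact
    show ?thesis by (rule I.tower_valuation_axioms)
  qed
  have val4: "tower_valuation q ?x4 ?u4 ?w4 {?s4} (\<lambda>_. 1)" if "char_zero_or_prime q" for q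
    using tower4[OF that] by (intro tower_valuation.intro tower_valuation_axioms.intro) auto
  have char: "\<exists>q. char_zero_or_prime q \<and> (q = 0 \<and> k \<simeq> rat_ring \<or> (\<exists>p. q = int p \<and> prime p \<and> k \<simeq> residue_ring (int p)))"
    if "prime_field k" for k :: "'k ring"
    using that unfolding prime_field_def char_zero_or_prime_def by (metis prime_nat_int_transfer)
  have char0: "char_zero_or_prime 0" by (simp add: char_zero_or_prime_def)
  have one: "\<exists>(K :: nat ring) F (\<Gamma> :: nat monoid) leq v.
                rational_function_field K F 3 \<and> K\<lparr>carrier := F\<rparr> \<simeq> k \<and>
                valued_field K \<Gamma> leq v \<and> trivially_valued K \<Gamma> v F \<and>
                \<not> (\<exists>R. weak_complement K \<Gamma> leq v R)" if k: "prime_field k" for k :: "'k ring"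
  proof -
    obtain q where q: "char_zero_or_prime q"
      "q = 0 \<and> k \<simeq> rat_ring \<or> (\<exists>p. q = int p \<and> prime p \<and> k \<simeq> residue_ring (int p))" using char[OF k] by blast
    interpret tower_valuation q ?x3 ?u3 ?w3 "{}" inf_slope by (rule val3) fact
    have "field k" using k by (simp add: prime_field_def)
    from V.frac_const_iso[OF this q(2)] have "V.K\<lparr>carrier := V.const_field\<rparr> \<simeq> k" .
    moreover have "rational_function_field V.K V.const_field 3"
      by (rule rational_function_field_card) simp
    moreover have "\<not> (\<exists>R. weak_complement V.K (coded_group TYPE(lex_vector)) (coded_order TYPE(lex_vector)) V.vK R)"
      using weak_complement_imp_pair_complement no_pair_complement_at_infinity[OF refl] by blast
    ultimately show ?thesis using V.valued_field_K V.trivially_valued_K by blast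
  qed
  have two: "\<exists>(K :: nat ring) F leK. rational_function_field K F 3 \<and> K\<lparr>carrier := F\<rparr> \<simeq> rat_ring \<and>
                ordered_field K leK \<and> \<not> (\<exists>I. integer_part K leK I)"
  proof -
    interpret tower_valuation 0 ?x3 ?u3 ?w3 "{}" inf_slope by (rule val3) (rule char0)
    interpret O: ordered_leading_valuation 0 "null 0" v vlc by unfold_locales simp
    have "V.K\<lparr>carrier := V.const_field\<rparr> \<simeq> rat_ring"
      by (rule V.frac_const_iso[OF field_rat_ring]) (simp add: ring_iso_refl)
    moreover have "rational_function_field V.K V.const_field 3"
      by (rule rational_function_field_card) simp
    moreover have "\<not> (\<exists>I. integer_part V.K O.frac_order I)"
      using O.integer_part_weak_complement weak_complement_imp_pair_complement
        no_pair_complement_at_infinity[OF refl] by blast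
    ultimately show ?thesis using O.ordered_field_K by blast
  qed
  have three: "\<exists>(K :: nat ring) F (\<Gamma> :: nat monoid) leq v.
                rational_function_field K F 4 \<and> K\<lparr>carrier := F\<rparr> \<simeq> k \<and>
                valued_field K \<Gamma> leq v \<and> trivially_valued K \<Gamma> v F \<and>
                \<not> (\<exists>R. weak_complement K \<Gamma> leq v R) \<and>
                (\<exists>f. residue_field_embedding K \<Gamma> leq v f) \<and> (\<exists>s. cross_section K \<Gamma> v s)"
    if k: "prime_field k" for k :: "'k ring"
  proof -
    obtain q where q: "char_zero_or_prime q"
      "q = 0 \<and> k \<simeq> rat_ring \<or> (\<exists>p. q = int p \<and> prime p \<and> k \<simeq> residue_ring (int p))" using char[OF k] by blast
    interpret tower_valuation q ?x4 ?u4 ?w4 "{?s4}" "\<lambda>_. 1" by (rule val4) fact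
    have "field k" using k by (simp add: prime_field_def)
    from V.frac_const_iso[OF this q(2)] have "V.K\<lparr>carrier := V.const_field\<rparr> \<simeq> k" .
    moreover have "rational_function_field V.K V.const_field 4"
      by (rule rational_function_field_card) simp
    moreover have "\<not> (\<exists>R. weak_complement V.K (coded_group TYPE(lex_vector)) (coded_order TYPE(lex_vector)) V.vK R)"
      using weak_complement_imp_pair_complement no_pair_complement_at_rational_place[OF refl] by blast
    ultimately show ?thesis
      using V.valued_field_K V.trivially_valued_K V.residue_field_embedding_exists
        cross_section_exists[OF refl refl] by blast
  qed
  have four: "\<exists>(K :: nat ring) F leK.
                rational_function_field K F 4 \<and> K\<lparr>carrier := F\<rparr> \<simeq> rat_ring \<and>
                ordered_field K leK \<and>
                \<not> (\<exists>I. integer_part K leK I) \<and>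
                (\<exists>(\<Gamma> :: nat monoid) leq v.
                   natural_valuation K leK \<Gamma> leq v \<and>
                   (\<exists>f. residue_field_embedding K \<Gamma> leq v f) \<and>
                   (\<exists>s. cross_section K \<Gamma> v s))"
  proof -
    interpret tower_valuation 0 ?x4 ?u4 ?w4 "{?s4}" "\<lambda>_. 1" by (rule val4) (rule char0)
    interpret O: ordered_leading_valuation 0 "null 0" v vlc by unfold_locales simp
    have "V.K\<lparr>carrier := V.const_field\<rparr> \<simeq> rat_ring"
      by (rule V.frac_const_iso[OF field_rat_ring]) (simp add: ring_iso_refl)
    moreover have "rational_function_field V.K V.const_field 4"
      by (rule rational_function_field_card) simp
    moreover have "\<not> (\<exists>I. integer_part V.K O.frac_order I)"
      using O.integer_part_weak_complement weak_complement_imp_pair_complement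
        no_pair_complement_at_rational_place[OF refl] by blast
    ultimately show ?thesis
      using O.ordered_field_K O.natural_valuation_K V.residue_field_embedding_exists
        cross_section_exists[OF refl refl] by blast
  qed
  show ?thesis using one two three four by blast
qed

end
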